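(* For each $n\ge 1$ let $x_1,\dots,x_n$ be the random points in $\frac1n\mathbb Z$ with joint probability mass function proportional to $$\prod_{1\le i<j\le n}\big(\mu_n(x_i)-\mu_n(x_j)\big)^2\prod_{j=1}^n w_n(nx_j),$$ with associated recurrence coefficients $a_{j,n},b_{j,n}$. Assume there exist a function $\mu$ and a subset $K\subset\mathbb R$ such that $\mu(K)$ is compact, $\sup_{x\in K}|\mu(x)|<\infty$, $L_K(\mu)<\infty$, and such that, for all $k\in\mathbb N$, $$\mathbb E\big[X_n(|\mu_n|^k\chi_{K^c})\big]=o(n^{-1})\qquad(n\to\infty),$$ and $$\lim_{n\to\infty}\sup_{x\in\frac1n\mathbb Z\cap K}|\mu_n(x)-\mu(x)|=0,\qquad \lim_{n\to\infty}L_{\mu_n(\frac1n\mathbb Z\cap K)}\big(\mu\circ\mu_n^{-1}-\mathrm{id}\big)=0,$$ where $\mathrm{id}(x)=x$. Assume further that there exist two real numbers $a(1),b(1)$ such that, for any fixed $j$, $a_{j+n,n}\to a(1)$ and $b_{j+n,n}\to b(1)$ as $n\to\infty$. Consider a test function $f$ such that $f\circ\mu^{-1}$ is continuously differentiable on $\mu(K)$ and $f\circ\mu^{-1}$ grows at most polynomially at infinity. Then, as $n\to\infty$, in distribution, $$X_n(f)-\mathbb E[X_n(f)]\to\mathcal N\Big(0,\sum_{k\ge1}k\,\big|\widehat{f\circ\mu^{-1}}_k\big|^2\Big),$$ where $$\widehat{f\circ\mu^{-1}}_k=\frac1{2\pi}\int_0^{2\pi}f\circ\mu^{-1}\big(2a(1)\cos\theta+b(1)\big)e^{-ik\theta}\,d\theta$$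 and $\mu^{-1}$ is the inverse function of $\mu$.
   Context: For each $n$, $\nu_n:\mathbb Z\to\mathbb R$ is strictly monotone and $w_n:\mathbb Z\to[0,\infty)$ satisfies $\sum_{y\in\mathbb Z}|\nu_n(y)|^kw_n(y)<\infty$ for all $k\in\mathbb N$ and has at least $n$ points in its support. Put $\mu_n(x)=\nu_n(nx)$ for $x\in\frac1n\mathbb Z$; $\mu_n^{-1}$ is its inverse, defined on the range of $\mu_n$. For a function $f:\mathbb R\to\mathbb R$, $X_n(f)=\sum_{j=1}^nf(x_j)$. $\chi_{K^c}$ is the indicator function of the complement of $K$. The function $\mu$ is assumed invertible, so that $\mu^{-1}$ makes sense. For a real function $f$ defined on $I\subset\mathbb R$ and $E\subset\mathbb R$, $L_E(f)=\sup_{x\ne y\in E\cap I}\left|\frac{f(x)-f(y)}{x-y}\right|$. Recurrence coefficients: $p_{k,n}$ is the polynomial of degree $k$ with positive leading coefficient such that $\sum_{y\in\mathbb Z}p_{k,n}(\nu_n(y))p_{l,n}(\nu_n(y))w_n(y)=\delta_{k,l}$, and $r_{k,n}(y)=p_{k,n}(\nu_n(y))$. They satisfy $\nu_n(y)r_{j,n}(y)=a_{j,n}r_{j+1,n}(y)+b_{j,n}r_{j,n}(y)+a_{j-1,n}r_{j-1,n}(y)$ for $j\ge0$, with $a_{j,n}>0$, $b_{j,n}\in\mathbb R$, $a_{-1,n}=0$.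
   Formalization: Added assumption: for every k, E[X_n(|μ|^k χ_{K^c})] → 0; without it E[X_n(f)] can be infinite, since μ and μ_n are related only on K. Polynomial growth of f∘μ^{-1} is read as a bound C(1+|t|^m) on the whole range of μ. *)

theory Defs
  imports "HOL-Probability.Probability" "HOL-Library.Landau_Symbols"
    "HOL-Computational_Algebra.Polynomial"
begin

section \<open>Scaled lattice and the point ensemble\<close>

definition lattice :: "nat \<Rightarrow> real set" where
  "lattice n = (\<lambda>y::int. of_int y / real n) ` UNIV"

text \<open>\<open>rescale \<nu> n x = \<nu> (n x)\<close>; this is only meaningful for \<open>x \<in> lattice n\<close>, where \<open>n x\<close> is an
  integer and the floor merely converts its type.\<close>

definition rescale :: "(int \<Rightarrow> real) \<Rightarrow> nat \<Rightarrow> real \<Rightarrow> real" where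
  "rescale \<nu> n x = \<nu> \<lfloor>real n * x\<rfloor>"

definition rescale_inv :: "(int \<Rightarrow> real) \<Rightarrow> nat \<Rightarrow> real \<Rightarrow> real" where
  "rescale_inv \<nu> n = inv_into (lattice n) (rescale \<nu> n)"

definition ensemble_weight ::
    "(int \<Rightarrow> real) \<Rightarrow> (int \<Rightarrow> real) \<Rightarrow> nat \<Rightarrow> (nat \<Rightarrow> real) \<Rightarrow> real" where
  "ensemble_weight \<nu> w n x =
     (if x \<in> {1..n} \<rightarrow>\<^sub>E lattice n
      then (\<Prod>j\<in>{1..n}. \<Prod>i\<in>{1..<j}. (rescale \<nu> n (x i) - rescale \<nu> n (x j))\<^sup>2)
           * (\<Prod>j\<in>{1..n}. rescale w n (x j))
      else 0)"

text \<open>The joint law of the \<open>n\<close> random points, as a law of tuples indexed by \<open>{1..n}\<close>. The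
  normalising constant is determined, because the masses of a pmf sum to 1.\<close>

definition is_ensemble_law ::
    "(int \<Rightarrow> real) \<Rightarrow> (int \<Rightarrow> real) \<Rightarrow> nat \<Rightarrow> (nat \<Rightarrow> real) pmf \<Rightarrow> bool" where
  "is_ensemble_law \<nu> w n P \<longleftrightarrow> (\<exists>c. \<forall>x. pmf P x = c * ensemble_weight \<nu> w n x)"

definition linear_stat :: "nat \<Rightarrow> (real \<Rightarrow> real) \<Rightarrow> (nat \<Rightarrow> real) \<Rightarrow> real" where
  "linear_stat n f x = (\<Sum>j=1..n. f (x j))"

section \<open>Orthonormal polynomials and recurrence coefficients\<close>

definition support_at_least :: "(int \<Rightarrow> real) \<Rightarrow> nat \<Rightarrow> bool" where
  "support_at_least w m \<longleftrightarrow> infinite {y. w y \<noteq> 0} \<or> m \<le> card {y. w y \<noteq> 0}"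

text \<open>The weight may have finite support. The orthonormal polynomial of degree \<open>k\<close> exists if and
  only if the support has at least \<open>k + 1\<close> points, so \<open>a j\<close> and the \<open>j\<close>-th recurrence relation
  (which involves the polynomial of degree \<open>j + 1\<close>) require \<open>j + 2\<close> points. Values of \<open>a\<close>, \<open>b\<close> at
  other indices are unconstrained.\<close>

definition recurrence_coeffs ::
    "(int \<Rightarrow> real) \<Rightarrow> (int \<Rightarrow> real) \<Rightarrow> (nat \<Rightarrow> real) \<Rightarrow> (nat \<Rightarrow> real) \<Rightarrow> bool" where
  "recurrence_coeffs \<nu> w a b \<longleftrightarrow>
     (\<exists>p :: nat \<Rightarrow> real poly.
        (\<forall>k. support_at_least w (k + 1) \<longrightarrow> degree (p k) = k \<and> lead_coeff (p k) > 0) \<and>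
        (\<forall>k l. support_at_least w (k + 1) \<longrightarrow> support_at_least w (l + 1) \<longrightarrow>
           ((\<lambda>y. poly (p k) (\<nu> y) * poly (p l) (\<nu> y) * w y)
              has_sum (if k = l then 1 else 0)) UNIV) \<and>
        (\<forall>j. support_at_least w (j + 2) \<longrightarrow>
           a j > 0 \<and>
           (\<forall>y. \<nu> y * poly (p j) (\<nu> y) =
                  a j * poly (p (j + 1)) (\<nu> y) + b j * poly (p j) (\<nu> y)
                  + (if j = 0 then 0 else a (j - 1) * poly (p (j - 1)) (\<nu> y)))))"

section \<open>Regularity of functions\<close>

text \<open>The supremum defining \<open>L\<^sub>E(f)\<close> for \<open>f\<close> defined on \<open>I\<close> is taken in \<open>ennreal\<close>, so that it may be
  infinite and is 0 over an empty index set.\<close>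

definition lip_const :: "real set \<Rightarrow> real set \<Rightarrow> (real \<Rightarrow> real) \<Rightarrow> ennreal" where
  "lip_const I E f =
     (SUP (x, y) \<in> {(x, y). x \<in> E \<inter> I \<and> y \<in> E \<inter> I \<and> x \<noteq> y}.
        ennreal \<bar>(f x - f y) / (x - y)\<bar>)"

text \<open>Continuous differentiability on an arbitrary (not necessarily open) set in the usual sense:
  the restriction to the set agrees with a \<open>C\<^sup>1\<close> function on an open neighbourhood.\<close>

definition C1_on :: "real set \<Rightarrow> (real \<Rightarrow> real) \<Rightarrow> bool" where
  "C1_on S h \<longleftrightarrow>
     (\<exists>U g g'. open U \<and> S \<subseteq> U \<and> (\<forall>t\<in>S. g t = h t) \<and>
        (\<forall>t\<in>U. (g has_real_derivative g' t) (at t)) \<and> continuous_on U g')"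

definition poly_growth_on :: "real set \<Rightarrow> (real \<Rightarrow> real) \<Rightarrow> bool" where
  "poly_growth_on S h \<longleftrightarrow> (\<exists>C m. \<forall>t\<in>S. \<bar>h t\<bar> \<le> C * (1 + \<bar>t\<bar> ^ m))"

section \<open>The limit law\<close>

definition fourier_coeff :: "real \<Rightarrow> real \<Rightarrow> (real \<Rightarrow> real) \<Rightarrow> nat \<Rightarrow> complex" where
  "fourier_coeff \<alpha> \<beta> h k =
     1 / (2 * of_real pi) *
     integral {0..2 * pi}
       (\<lambda>\<theta>. complex_of_real (h (2 * \<alpha> * cos \<theta> + \<beta>)) * exp (- \<i> * of_nat k * of_real \<theta>))"

text \<open>The centred normal law with variance \<open>v\<close>; the variance is allowed to vanish.\<close>

definition centered_normal :: "real \<Rightarrow> real measure" where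
  "centered_normal v =
     (if v = 0 then return borel 0 else density lborel (normal_density 0 (sqrt v)))"

end

theory Submission
  imports Defs "HOL-Combinatorics.Permutations"
begin

text \<open>
  The tuple \<open>k\<close> stands for the Slater determinant of the orthonormal functions
  \<open>\<phi>\<^bsub>k 0\<^esub>, \<dots>, \<phi>\<^bsub>k (n-1)\<^esub>\<close>. Up to a factor, the density of the ensemble is the square of the determinant
  of the tuple \<open>0, \<dots>, n - 1\<close>, the filled sea. Multiplication by a linear statistic \<open>\<Sum>\<^sub>j g (x\<^sub>j)\<close> acts on
  Slater determinants as the second quantization of the matrix \<open>G\<close> of multiplication by \<open>g\<close>, which is
  banded if \<open>g\<close> is a polynomial in \<open>\<mu>\<^sub>n\<close>. Split \<open>G\<close> into its strictly raising part \<open>U\<close> and the rest. The rest acts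
  on the sea as a scalar, the adjoint of \<open>U\<close> annihilates it, and the second quantization of
  \<open>C = [G, U]\<close> is what remains after commuting \<open>U\<close> past the other factors of a moment. For a Toeplitz
  matrix \<open>C\<close> vanishes near level \<open>n\<close>, so its second quantization acts as a scalar \<open>\<sigma>\<^sup>2\<close>, and the centred
  moments satisfy exactly \<open>M (m + 1) = m \<sigma>\<^sup>2 M (m - 1)\<close>: they are Gaussian. Since a moment of order \<open>m\<close>
  only sees finitely many entries of \<open>G\<close> around level \<open>n\<close>, convergence of the recurrence coefficients yields
  Gaussian moments in the limit for polynomial \<open>g\<close>.

  In general, the variance of a linear statistic of \<open>u\<close> is \<open>\<Sum> (u x - u y)\<^sup>2 K(x, y)\<^sup>2 / 2\<close>, hence bounded
  by the squared Lipschitz constant of \<open>u\<close> relative to \<open>\<mu>\<^sub>n\<close> times the variance for \<open>\<mu>\<^sub>n\<close> itself, up to terms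
  controlled by the tail conditions. Polynomials approximating \<open>f \<circ> \<mu>\<^sup>-\<^sup>1\<close> in \<open>C\<^sup>1\<close> then give the result.
\<close>

section \<open>Second quantization of matrices\<close>

text \<open>Moments settle only the polynomial case, because nothing bounds higher moments of a
  general statistic. The general case is a comparison in mean square, carried to the limit by
  characteristic functions. The error must be small uniformly in n although n terms are summed. A
  sup-norm error in the test function would only bound the variance by a multiple of n, whereas the
  Lipschitz seminorm gives a bound free of n; hence approximation in C^1, and hence the hypothesis
  on \<mu> composed with the inverse of \<mu>_n, which transports Lipschitz bounds from \<mu> to
  \<mu>_n.

  The limit variance contains the values of h, the composition of f with the inverse of \<mu>, at 2
  \<alpha> cos \<theta> + \<beta>, while regularity of h is known on \<mu>(K) only. That these
  points lie in \<mu>(K) is not assumed and has to be derived from the tail condition.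

  Convergence of the variances of the approximants is again probabilistic: the Lipschitz bound,
  applied to polynomials and passed to the limit in n, dominates the Fourier-side quadratic
  form.\<close>

type_synonym mtx = "nat \<Rightarrow> nat \<Rightarrow> real"

text \<open>These are the moments of the normal law with mean 0 and variance \<open>v\<close>, in
  the recursive form that the commutation argument delivers.\<close>

fun gaussian_moment :: "real \<Rightarrow> nat \<Rightarrow> real" where
  "gaussian_moment v 0 = 1"
| "gaussian_moment v (Suc 0) = 0"
| "gaussian_moment v (Suc (Suc m)) = real (Suc m) * v * gaussian_moment v m"

text \<open>Only finitely many levels \<open>N\<close> are kept, because orthogonal polynomials of high degree do not exist when
  the weight has finite support.\<close>

locale levels =
  fixes n N :: nat
  assumes n_le_N: "n \<le> N"
begin

text \<open>\<open>lift A\<close> is dual to the derivation of the exterior algebra that extends \<open>e\<^sub>j \<mapsto> \<Sum>\<^sub>l A l j e\<^sub>l\<close>. Hence in a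
  composition of lifts the outermost matrix acts first on the tuple \<open>k\<close>.\<close>

definition lift :: "mtx \<Rightarrow> ((nat \<Rightarrow> nat) \<Rightarrow> real) \<Rightarrow> (nat \<Rightarrow> nat) \<Rightarrow> real" where
  "lift A F k = (\<Sum>i<n. \<Sum>l<N. A l (k i) * F (k(i := l)))"

text \<open>Subtracting \<open>c\<close> mirrors centring: on Slater determinants
  \<open>clift c G\<close> becomes multiplication by the statistic minus \<open>c\<close>.\<close>

definition clift :: "real \<Rightarrow> mtx \<Rightarrow> ((nat \<Rightarrow> nat) \<Rightarrow> real) \<Rightarrow> (nat \<Rightarrow> nat) \<Rightarrow> real" where
  "clift c A F k = lift A F k - c * F k"

text \<open>The coefficient of \<open>e\<^sub>0 \<and> \<dots> \<and> e\<^bsub>n-1\<^esub>\<close> in \<open>e\<^bsub>k 0\<^esub> \<and> \<dots> \<and> e\<^bsub>k (n-1)\<^esub>\<close>.\<close>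

definition vac :: "(nat \<Rightarrow> nat) \<Rightarrow> real" where
  "vac k = (let p = (\<lambda>i. if i < n then k i else i) in
              if p permutes {..<n} then of_int (sign p) else 0)"

definition tr :: "mtx \<Rightarrow> real" where
  "tr A = (\<Sum>i<n. A i i)"

text \<open>The inner sum stops at \<open>N\<close>, so the truncation leaves a trace near level
  \<open>N\<close> besides the one near level 0. This is why \<open>off_block\<close> below admits
  two blocks.\<close>

definition comm :: "mtx \<Rightarrow> mtx \<Rightarrow> mtx" where
  "comm A B i j = (\<Sum>l<N. A i l * B l j - B i l * A l j)"

definition alternating :: "((nat \<Rightarrow> nat) \<Rightarrow> real) \<Rightarrow> bool" where
  "alternating F \<longleftrightarrow>
     (\<forall>k i j. i < n \<longrightarrow> j < n \<longrightarrow> i \<noteq> j \<longrightarrow> F (k \<circ> Transposition.transpose i j) = - F k)"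

definition banded :: "nat \<Rightarrow> mtx \<Rightarrow> bool" where
  "banded b A \<longleftrightarrow> (\<forall>i j. A i j \<noteq> 0 \<longrightarrow> i \<le> j + b \<and> j \<le> i + b)"

text \<open>If \<open>s \<le> n \<le> t\<close>, such a matrix does not couple the levels below
  \<open>n\<close> to the others, so its lift acts on the sea as a scalar.\<close>

definition off_block :: "nat \<Rightarrow> nat \<Rightarrow> mtx \<Rightarrow> bool" where
  "off_block s t A \<longleftrightarrow> (\<forall>i j. A i j \<noteq> 0 \<longrightarrow> (i < s \<and> j < s) \<or> (t \<le> i \<and> t \<le> j))"

section \<open>Linearity and commutators of lifts\<close>

lemma lift_add: "lift (\<lambda>i j. A i j + B i j) F k = lift A F k + lift B F k"
  by (simp add: lift_def algebra_simps sum.distrib)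

lemma lift_diff: "lift (\<lambda>i j. A i j - B i j) F k = lift A F k - lift B F k"
  by (simp add: lift_def algebra_simps sum_subtractf)

lemma lift_smult: "lift A (\<lambda>k. c * F k) k = c * lift A F k"
  by (simp add: lift_def sum_distrib_left algebra_simps)

lemma lift_diff_right: "lift A (\<lambda>k. F k - G k) k = lift A F k - lift A G k"
  by (simp add: lift_def algebra_simps sum_subtractf)

lemma lift_clift: "lift A (clift c B F) k = lift A (lift B F) k - c * lift A F k"
  using lift_diff_right[of A "lift B F" "\<lambda>k. c * F k" k]
  by (simp add: lift_smult clift_def[abs_def])

lemma clift_smult: "clift c A (\<lambda>k. d * F k) k = d * clift c A F k"
  by (simp add: clift_def lift_smult algebra_simps)

text \<open>Two lifts act either twice on the same particle or on two different ones. The first case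
  yields a matrix product, with the factors in reversed order by duality.\<close>

lemma lift_lift:
  "lift A (lift B F) k =
     lift (\<lambda>i j. \<Sum>l<N. B i l * A l j) F k +
     (\<Sum>i<n. \<Sum>i'\<in>{..<n}-{i}. \<Sum>l<N. \<Sum>l'<N. A l (k i) * B l' (k i') * F (k(i := l, i' := l')))"
proof -
  have "lift A (lift B F) k = (\<Sum>i<n. \<Sum>l<N. A l (k i) *
          (\<Sum>i'<n. \<Sum>l'<N. B l' ((k(i:=l)) i') * F (k(i := l, i' := l'))))"
    by (simp add: lift_def)
  also have "\<dots> = (\<Sum>i<n. \<Sum>l<N. A l (k i) * (\<Sum>l'<N. B l' l * F (k(i := l')))
       + A l (k i) * (\<Sum>i'\<in>{..<n}-{i}. \<Sum>l'<N. B l' (k i') * F (k(i := l, i' := l'))))"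
  proof (intro sum.cong refl)
    fix i l assume "i \<in> {..<n}"
    have "(\<Sum>i'<n. \<Sum>l'<N. B l' ((k(i:=l)) i') * F (k(i := l, i' := l'))) =
        (\<Sum>l'<N. B l' l * F (k(i := l'))) +
        (\<Sum>i'\<in>{..<n}-{i}. \<Sum>l'<N. B l' ((k(i:=l)) i') * F (k(i := l, i' := l')))"
      using \<open>i \<in> {..<n}\<close> by (subst sum.remove[of _ i]) auto
    also have "(\<Sum>i'\<in>{..<n}-{i}. \<Sum>l'<N. B l' ((k(i:=l)) i') * F (k(i := l, i' := l'))) =
       (\<Sum>i'\<in>{..<n}-{i}. \<Sum>l'<N. B l' (k i') * F (k(i := l, i' := l')))"
      by (intro sum.cong) auto
    finally show "A l (k i) *
          (\<Sum>i'<n. \<Sum>l'<N. B l' ((k(i:=l)) i') * F (k(i := l, i' := l'))) =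
       A l (k i) * (\<Sum>l'<N. B l' l * F (k(i := l')))
       + A l (k i) * (\<Sum>i'\<in>{..<n}-{i}. \<Sum>l'<N. B l' (k i') * F (k(i := l, i' := l')))"
      by (simp only: distrib_left)
  qed
  also have "\<dots> = (\<Sum>i<n. \<Sum>l<N. A l (k i) * (\<Sum>l'<N. B l' l * F (k(i := l'))))
       + (\<Sum>i<n. \<Sum>l<N. A l (k i) * (\<Sum>i'\<in>{..<n}-{i}. \<Sum>l'<N. B l' (k i') * F (k(i := l, i' := l'))))"
    by (simp add: sum.distrib)
  also have "(\<Sum>i<n. \<Sum>l<N. A l (k i) * (\<Sum>l'<N. B l' l * F (k(i := l')))) =
      lift (\<lambda>i j. \<Sum>l<N. B i l * A l j) F k"
    unfolding lift_def
    by (simp add: sum_distrib_left sum_distrib_right, subst (2) sum.swap) (simp add: algebra_simps)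
  also have "(\<Sum>i<n. \<Sum>l<N. A l (k i) * (\<Sum>i'\<in>{..<n}-{i}. \<Sum>l'<N. B l' (k i') * F (k(i := l, i' := l'))))
     = (\<Sum>i<n. \<Sum>i'\<in>{..<n}-{i}. \<Sum>l<N. \<Sum>l'<N. A l (k i) * B l' (k i') * F (k(i := l, i' := l')))"
    by (simp add: sum_distrib_left sum.swap[of _ "{..<N}" "{..<n} - {_}"] mult.assoc)
  finally show ?thesis .
qed

text \<open>The two-particle part of \<open>lift_lift\<close> is symmetric in the two matrices and
  cancels, so only the commutator of the one-particle parts is left.\<close>

lemma lift_commute: "lift A (lift B F) k = lift B (lift A F) k + lift (comm B A) F k"
proof -
  let ?R = "\<lambda>A B. (\<Sum>i<n. \<Sum>i'\<in>{..<n}-{i}. \<Sum>l<N. \<Sum>l'<N.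
      A l (k i) * B l' (k i') * F (k(i := l, i' := l')))"
  let ?P = "SIGMA i:{..<n}. {..<n}-{i}"
  have R: "?R A B = (\<Sum>(i,i')\<in>?P. \<Sum>l<N. \<Sum>l'<N.
      A l (k i) * B l' (k i') * F (k(i := l, i' := l')))" for A B
    by (rule sum.Sigma) auto
  have "?R A B = (\<Sum>(i,i')\<in>?P. \<Sum>l<N. \<Sum>l'<N. A l (k i') * B l' (k i) * F (k(i' := l, i := l')))"
    unfolding R
    by (rule sum.reindex_bij_witness[of _ "\<lambda>(a,b). (b,a)" "\<lambda>(a,b). (b,a)"]) auto
  also have "\<dots> = ?R B A"
    unfolding R
  proof (rule sum.cong[OF refl])
    fix p assume "p \<in> ?P"
    then obtain i i' where p: "p = (i, i')" "i' \<noteq> i" by auto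
    have "(\<Sum>l<N. \<Sum>l'<N. A l (k i') * B l' (k i) * F (k(i' := l, i := l'))) =
       (\<Sum>l<N. \<Sum>l'<N. B l (k i) * A l' (k i') * F (k(i := l, i' := l')))"
      using p(2) by (subst sum.swap) (simp add: fun_upd_twist mult_ac)
    then show "(case p of (i, i') \<Rightarrow> \<Sum>l<N. \<Sum>l'<N. A l (k i') * B l' (k i) * F (k(i' := l, i := l'))) =
       (case p of (i, i') \<Rightarrow> \<Sum>l<N. \<Sum>l'<N. B l (k i) * A l' (k i') * F (k(i := l, i' := l')))"
      by (simp add: p)
  qed
  finally have RR: "?R A B = ?R B A" .
  have "lift (comm B A) F k = lift (\<lambda>i j. \<Sum>l<N. B i l * A l j) F k
     - lift (\<lambda>i j. \<Sum>l<N. A i l * B l j) F k"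
    by (subst lift_diff[symmetric]) (simp add: comm_def[abs_def] sum_subtractf)
  then show ?thesis
    using RR by (simp add: lift_lift)
qed

section \<open>Alternating functions and the filled sea\<close>

lemma alternating_dup:
  assumes "alternating F" "i < n" "j < n" "i \<noteq> j" "k i = k j"
  shows "F k = 0"
proof -
  have "k \<circ> Transposition.transpose i j = k"
    using assms(5) by (auto simp: fun_eq_iff Transposition.transpose_def)
  then show ?thesis
    using assms(1-4) unfolding alternating_def by (metis neg_equal_zero)
qed

lemma alternating_vac: "alternating vac"
  unfolding alternating_def
proof (intro allI impI)
  fix k :: "nat \<Rightarrow> nat" and i j assume ij: "i < n" "j < n" "i \<noteq> j"
  define q where "q = (\<lambda>k a. if a < n then k a else a :: nat)"
  have q: "q (k \<circ> Transposition.transpose i j) = q k \<circ> Transposition.transpose i j" for k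
    using ij by (auto simp: q_def fun_eq_iff Transposition.transpose_def)
  have tp: "Transposition.transpose i j permutes {..<n}"
    using ij by (intro permutes_swap_id) auto
  have *: "q k \<circ> Transposition.transpose i j permutes {..<n}" if "q k permutes {..<n}" for k
    by (rule permutes_compose[OF tp that])
  have iff: "q k \<circ> Transposition.transpose i j permutes {..<n} \<longleftrightarrow> q k permutes {..<n}"
  proof
    assume "q k \<circ> Transposition.transpose i j permutes {..<n}"
    from permutes_compose[OF tp this] show "q k permutes {..<n}"
      by (simp add: comp_assoc)
  qed (rule *)
  have v: "vac k = (if q k permutes {..<n} then of_int (sign (q k)) else 0)" for k
    by (simp add: vac_def q_def Let_def)
  have perm: "permutation (q k)" if "q k permutes {..<n}"
    using that by (meson finite_lessThan permutation_permutes)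
  show "vac (k \<circ> Transposition.transpose i j) = - vac k"
    using ij by (auto simp: v q iff sign_compose perm permutation_swap_id sign_swap_id)
qed

lemma vac_nonzero:
  assumes "vac k \<noteq> 0" shows "inj_on k {..<n}" "k ` {..<n} = {..<n}"
proof -
  let ?q = "\<lambda>i. if i < n then k i else i"
  have p: "?q permutes {..<n}"
    using assms by (auto simp: vac_def Let_def split: if_splits)
  have "inj_on ?q {..<n}" using permutes_inj_on[OF p] .
  then show "inj_on k {..<n}" by (auto simp: inj_on_def)
  have "?q ` {..<n} = {..<n}" using permutes_image[OF p] .
  then show "k ` {..<n} = {..<n}" by auto
qed

lemma vac_le_1: "\<bar>vac k\<bar> \<le> 1"
  by (auto simp: vac_def Let_def sign_def)

lemma vac_id: "vac (\<lambda>i. i) = 1"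
  using permutes_id[of "{..<n}"] sign_id by (auto simp: vac_def Let_def id_def)

lemma lift_vac_id: "lift A vac (\<lambda>i. i) = tr A"
proof -
  have z: "vac ((\<lambda>i. i)(i := l)) = (if l = i then 1 else 0)" if "i < n" for i l
  proof (cases "l = i")
    case True
    moreover have "(\<lambda>i. i)(i := i) = (\<lambda>i. i)" by auto
    ultimately show ?thesis by (simp add: vac_id)
  next
    case False
    have "vac ((\<lambda>i. i)(i := l)) = 0"
    proof (rule ccontr)
      assume "vac ((\<lambda>i. i)(i := l)) \<noteq> 0"
      from vac_nonzero[OF this] have inj: "inj_on ((\<lambda>i. i)(i := l)) {..<n}"
        and im: "((\<lambda>i. i)(i := l)) ` {..<n} = {..<n}" .
      have "l < n" using im that by (metis fun_upd_same imageI lessThan_iff)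
      then show False using inj False that by (auto simp: inj_on_def)
    qed
    then show ?thesis using False by simp
  qed
  have "lift A vac (\<lambda>i. i) = (\<Sum>i<n. \<Sum>l<N. if l = i then A i i else 0)"
    unfolding lift_def by (intro sum.cong refl) (auto simp: z simp del: fun_upd_apply)
  also have "\<dots> = tr A"
    unfolding tr_def using n_le_N by (intro sum.cong refl) auto
  finally show ?thesis .
qed

lemma alternating_lift:
  assumes "alternating F" shows "alternating (lift A F)"
  unfolding alternating_def
proof (intro allI impI)
  fix k :: "nat \<Rightarrow> nat" and i j assume ij: "i < n" "j < n" "i \<noteq> j"
  let ?t = "Transposition.transpose i j"
  have upd: "(k \<circ> ?t)(a := l) = (k(?t a := l)) \<circ> ?t" for a l
    by (auto simp: fun_eq_iff Transposition.transpose_def)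
  have "lift A F (k \<circ> ?t) = (\<Sum>a<n. \<Sum>l<N. A l (k (?t a)) * - F (k(?t a := l)))"
    unfolding lift_def upd using assms ij by (simp add: alternating_def)
  also have "\<dots> = (\<Sum>a<n. \<Sum>l<N. A l (k a) * - F (k(a := l)))"
    using ij by (intro sum.reindex_bij_betw[of ?t "{..<n}" "{..<n}" "\<lambda>a. \<Sum>l<N. A l (k a) * - F (k(a := l))"]
          permutes_imp_bij permutes_swap_id) auto
  also have "\<dots> = - lift A F k"
    by (simp add: lift_def sum_negf)
  finally show "lift A F (k \<circ> ?t) = - lift A F k" .
qed

lemma alternating_clift:
  assumes "alternating F" shows "alternating (clift c A F)"
  using alternating_lift[OF assms, of A] assms by (simp add: alternating_def clift_def)

lemma alternating_clift_funpow: "alternating ((clift c A ^^ m) vac)"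
  by (induction m) (auto simp: alternating_vac alternating_clift)

lemma alternating_diff:
  assumes "alternating F" "alternating G" shows "alternating (\<lambda>k. F k - G k)"
  using assms by (simp add: alternating_def)

text \<open>\<open>vac\<close> only sees tuples that fill the sea. The entry \<open>A i j\<close>
  with \<open>i < n \<le> j\<close> is what could bring an outside particle into it; if all of these
  vanish, a move contributes only when it changes nothing.\<close>

lemma lift_vac:
  assumes "\<And>i j. i < n \<Longrightarrow> n \<le> j \<Longrightarrow> A i j = 0"
  shows "lift A vac k = tr A * vac k"
proof (cases "inj_on k {..<n}")
  case True
  show ?thesis
  proof (cases "k ` {..<n} \<subseteq> {..<n}")
    case sub: True
    have im: "k ` {..<n} = {..<n}"
      using True sub by (simp add: endo_inj_surj)
    have z: "vac (k(i := l)) = (if l = k i then vac k else 0)" if "i < n" for i l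
    proof (cases "l = k i")
      case False
      show ?thesis
      proof (rule ccontr)
        assume "vac (k(i:=l)) \<noteq> (if l = k i then vac k else 0)"
        with False have "vac (k(i:=l)) \<noteq> 0" by auto
        from vac_nonzero[OF this] have "inj_on (k(i:=l)) {..<n}" and "(k(i:=l)) ` {..<n} = {..<n}" .
        have "l \<in> (k(i:=l)) ` {..<n}" using that by force
        then have "l < n" using \<open>(k(i:=l)) ` {..<n} = {..<n}\<close> by auto
        then obtain j where "j < n" "l = k j" using im by (metis imageE lessThan_iff)
        with False have "j \<noteq> i" by auto
        with \<open>inj_on (k(i:=l)) {..<n}\<close> \<open>j < n\<close> \<open>l = k j\<close> that show False
          by (auto simp: inj_on_def)
      qed
    qed auto
    have "lift A vac k = (\<Sum>i<n. \<Sum>l<N. if l = k i then A (k i) (k i) * vac k else 0)"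
      unfolding lift_def by (intro sum.cong refl) (auto simp: z)
    also have "\<dots> = (\<Sum>i<n. A (k i) (k i) * vac k)"
      using sub n_le_N by (intro sum.cong refl) (auto simp: subset_iff image_iff intro: less_le_trans)
    also have "\<dots> = (\<Sum>i\<in>k ` {..<n}. A i i) * vac k"
      by (simp add: sum.reindex[OF True] sum_distrib_right)
    finally show ?thesis by (simp add: im tr_def)
  next
    case False
    then have "\<exists>i0. i0 < n \<and> \<not> k i0 < n" by auto
    then obtain i0 where i0: "i0 < n" "k i0 \<ge> n" by (auto simp: not_less)
    have *: "A l (k i) * vac (k(i := l)) = 0" if "i < n" for i l
    proof (cases "vac (k(i := l)) = 0")
      case False
      from vac_nonzero[OF this] have im: "(k(i:=l)) ` {..<n} = {..<n}" by simp
      have "(k(i:=l)) i0 < n" using im i0 by blast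
      then have "i = i0" using i0 by (auto split: if_splits)
      moreover have "l < n" using im that by (metis fun_upd_same imageI lessThan_iff)
      ultimately show ?thesis using assms i0 by simp
    qed simp
    have "vac k = 0" using vac_nonzero(2)[of k] i0 by (metis imageI leD lessThan_iff)
    moreover have "lift A vac k = 0"
      unfolding lift_def by (intro sum.neutral ballI *) auto
    ultimately show ?thesis by simp
  qed
next
  case False
  then obtain a b where ab: "a < n" "b < n" "a \<noteq> b" "k a = k b"
    by (auto simp: inj_on_def)
  have vk: "vac k = 0"
    using alternating_dup[OF alternating_vac ab] .
  have z: "vac (k(i := l)) = 0" if "i < n" "i \<noteq> a" "i \<noteq> b" for i l
    using ab that by (intro alternating_dup[OF alternating_vac, of a b]) auto
  \<comment> \<open>If two particles share a level, only moving one of these two can give a nonzero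
    value, and the two moves cancel by antisymmetry.\<close>
  have "lift A vac k = (\<Sum>i\<in>{a,b}. \<Sum>l<N. A l (k i) * vac (k(i := l)))"
    unfolding lift_def using ab z by (intro sum.mono_neutral_right) auto
  also have "\<dots> = (\<Sum>l<N. A l (k a) * (vac (k(a := l)) + vac (k(b := l))))"
    using ab by (simp add: algebra_simps sum.distrib)
  also have "\<dots> = 0"
  proof (intro sum.neutral ballI)
    fix l
    have "k(a := l) = k(b := l) \<circ> Transposition.transpose a b"
      using ab by (auto simp: fun_eq_iff Transposition.transpose_def)
    then have "vac (k(a := l)) = - vac (k(b := l))"
      using alternating_vac ab by (simp add: alternating_def)
    then show "A l (k a) * (vac (k(a := l)) + vac (k(b := l))) = 0" by simp
  qed
  finally show ?thesis using vk by simp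
qed

text \<open>This is the exclusion principle: starting from the sea, an upper triangular matrix can
  only move a particle down to a level that is already occupied, or leave it in place.\<close>

lemma lift_id:
  assumes "alternating F" "\<And>i j. j < i \<Longrightarrow> A i j = 0"
  shows "lift A F (\<lambda>i. i) = tr A * F (\<lambda>i. i)"
proof -
  have "(\<Sum>l<N. A l i * F ((\<lambda>i. i)(i := l))) = A i i * F (\<lambda>i. i)" if "i < n" for i
  proof -
    have "(\<Sum>l<N. A l i * F ((\<lambda>i. i)(i := l))) = (\<Sum>l\<in>{i}. A l i * F ((\<lambda>i. i)(i := l)))"
    proof (intro sum.mono_neutral_right ballI)
      fix l assume l: "l \<in> {..<N} - {i}"
      show "A l i * F ((\<lambda>i. i)(i := l)) = 0"
      proof (cases "l < i")
        case True
        then have "F ((\<lambda>i. i)(i := l)) = 0"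
          using that by (intro alternating_dup[OF assms(1), of l i]) auto
        then show ?thesis by simp
      qed (use l assms(2) in auto)
    qed (use that n_le_N in auto)
    moreover have "(\<lambda>i. i)(i := i) = (\<lambda>i. i)" by auto
    ultimately show ?thesis by simp
  qed
  then show ?thesis
    by (simp add: lift_def tr_def sum_distrib_right)
qed

section \<open>Locality around level n\<close>

lemma off_block_comm:
  assumes "banded b G" "off_block s t A"
  shows "off_block (s + b) (t - b) (comm G A)"
  unfolding off_block_def
proof (intro allI impI)
  fix i j assume "comm G A i j \<noteq> 0"
  then obtain l where "G i l * A l j - A i l * G l j \<noteq> 0"
    unfolding comm_def by (meson sum.not_neutral_contains_not_neutral)
  then have "(G i l \<noteq> 0 \<and> A l j \<noteq> 0) \<or> (A i l \<noteq> 0 \<and> G l j \<noteq> 0)" by auto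
  then show "(i < s + b \<and> j < s + b) \<or> (t - b \<le> i \<and> t - b \<le> j)"
    using assms unfolding banded_def off_block_def by fastforce
qed

text \<open>Cyclicity of the trace cancels everything inside the block of filled levels; only
  products that cross level \<open>n\<close> remain.\<close>

lemma tr_comm:
  "tr (comm A B) = (\<Sum>i<n. \<Sum>l\<in>{n..<N}. A i l * B l i - B i l * A l i)"
proof -
  have spl: "(\<Sum>l<N. f l) = (\<Sum>l<n. f l) + (\<Sum>l\<in>{n..<N}. f l)" for f :: "nat \<Rightarrow> real"
    using n_le_N by (metis atLeast0LessThan sum.atLeastLessThan_concat zero_le)
  have "(\<Sum>i<n. \<Sum>l<n. A i l * B l i) = (\<Sum>i<n. \<Sum>l<n. B i l * A l i)"
    by (subst sum.swap) (simp add: mult.commute)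
  then have "(\<Sum>i<n. \<Sum>l<n. A i l * B l i - B i l * A l i) = 0"
    by (simp add: sum_subtractf)
  then show ?thesis
    by (simp add: tr_def comm_def spl sum.distrib)
qed

lemma tr_comm_off_block:
  assumes "off_block s t A" "s \<le> n" "n \<le> t"
  shows "tr (comm G A) = 0"
proof -
  have "A i l = 0 \<and> A l i = 0" if "i < n" "n \<le> l" for i l
    using assms that unfolding off_block_def by (metis leD le_trans linorder_not_less)
  then show ?thesis by (auto simp: tr_comm intro!: sum.neutral)
qed

text \<open>Moving \<open>A\<close> past one factor costs \<open>comm G A\<close>. This is again off
  the level \<open>n\<close>, with both margins smaller by \<open>b\<close>, and has trace 0, so by
  induction its lift contributes nothing. The margins \<open>m * b\<close> pay for \<open>m\<close>
  such steps.\<close>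

lemma lift_off_block:
  assumes "banded b G" "off_block s t A" "s + m * b \<le> n" "n + m * b \<le> t"
  shows "lift A ((clift c G ^^ m) vac) = (\<lambda>k. tr A * (clift c G ^^ m) vac k)"
  using assms(2-)
proof (induction m arbitrary: A s t)
  case 0
  have "A i j = 0" if "i < n" "n \<le> j" for i j
    using 0 that unfolding off_block_def by force
  then show ?case by (auto simp: lift_vac)
next
  case (Suc m)
  let ?F = "(clift c G ^^ m) vac"
  have 1: "lift A ?F = (\<lambda>k. tr A * ?F k)"
    using Suc.prems by (intro Suc.IH) auto
  have "lift (comm G A) ?F = (\<lambda>k. tr (comm G A) * ?F k)"
    using Suc.prems by (intro Suc.IH[of "s + b" "t - b"] off_block_comm[OF assms(1)]) auto
  moreover have "tr (comm G A) = 0"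
    using Suc.prems by (intro tr_comm_off_block[of s t]) auto
  ultimately have 2: "lift (comm G A) ?F k = 0" for k by simp
  show ?case
    by (rule ext) (simp add: lift_clift lift_commute[of A G] 1 2 lift_smult,
      simp add: clift_def algebra_simps)
qed

text \<open>A perturbation away from level \<open>n\<close> acts as the scalar \<open>tr E\<close>,
  which the shifted centring removes. Thus a moment of order \<open>m\<close> does not see
  it.\<close>

lemma clift_funpow_local:
  assumes "banded b G" "off_block s t E" "s + m * b \<le> n" "n + m * b \<le> t"
  shows "(clift (c + tr E) (\<lambda>i j. G i j + E i j) ^^ m) vac = (clift c G ^^ m) vac"
  using assms(3-)
proof (induction m)
  case (Suc m)
  then have "(clift (c + tr E) (\<lambda>i j. G i j + E i j) ^^ m) vac = (clift c G ^^ m) vac"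
    by auto
  moreover have "lift E ((clift c G ^^ m) vac) = (\<lambda>k. tr E * (clift c G ^^ m) vac k)"
    using Suc.prems by (intro lift_off_block[OF assms(1,2)]) auto
  ultimately show ?case
    by (auto simp: clift_def[abs_def] lift_add algebra_simps)
qed simp

text \<open>\<open>lift U\<close> is an annihilation operator for the centred lift of
  \<open>T\<close>: it kills \<open>vac\<close>, and its commutator with that lift is a scalar on
  the vectors that occur. The two triangular parts are used at opposite ends: \<open>U\<close> at
  the functional \<open>vac\<close>, \<open>B\<close> at the tuple of the sea.\<close>

lemma gaussian_recursion:
  assumes T: "\<And>i j. T i j = U i j + B i j"
    and U: "\<And>i j. i \<le> j \<Longrightarrow> U i j = 0" and B: "\<And>i j. j < i \<Longrightarrow> B i j = 0"
    and band: "banded b T" and C: "off_block s t (comm T U)"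
    and "s + m * b \<le> n" "n + m * b \<le> t"
  shows "(clift (tr T) T ^^ m) vac (\<lambda>i. i) = gaussian_moment (tr (comm T U)) m"
proof -
  let ?v = "tr (comm T U)" and ?X = "clift (tr T) T"
  have U0: "lift U vac k = 0" for k
    using U by (subst lift_vac) (auto simp: tr_def)
  \<comment> \<open>The Leibniz rule: each of the \<open>m\<close> factors is removed once, at the
    price of the scalar commutator \<open>?v\<close>.\<close>
  have step: "lift U ((?X ^^ m) vac) = (\<lambda>k. real m * ?v * (?X ^^ (m - 1)) vac k)"
    if "s + m * b \<le> n" "n + m * b \<le> t" for m
    using that
  proof (induction m)
    case (Suc m)
    let ?F = "(?X ^^ m) vac"
    have 1: "lift U ?F = (\<lambda>k. real m * ?v * (?X ^^ (m - 1)) vac k)"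
      using Suc by auto
    have 2: "lift (comm T U) ?F = (\<lambda>k. ?v * ?F k)"
      using Suc.prems by (intro lift_off_block[OF band C]) auto
    show ?case
    proof (rule ext)
      fix k
      have "lift U (?X ?F) k = clift (tr T) T (lift U ?F) k + lift (comm T U) ?F k"
        by (simp add: lift_clift lift_commute[of U T]) (simp add: clift_def)
      also have "clift (tr T) T (lift U ?F) k = real m * ?v * ?X ((?X ^^ (m - 1)) vac) k"
        unfolding 1 by (simp only: clift_smult)
      also have "\<dots> = real m * ?v * ?F k"
        by (cases m) auto
      finally show "lift U ((?X ^^ Suc m) vac) k = real (Suc m) * ?v * (?X ^^ (Suc m - 1)) vac k"
        by (simp add: 2 algebra_simps)
    qed
  qed (simp add: U0 fun_eq_iff)
  have trT: "tr T = tr B"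
    by (simp add: tr_def T U)
  \<comment> \<open>At the sea the contribution of \<open>B\<close> is the scalar
    \<open>tr B\<close>, which is exactly the centring, so the outermost factor reduces to
    \<open>lift U\<close>.\<close>
  have sc: "(?X ^^ Suc m) vac (\<lambda>i. i) = real m * ?v * (?X ^^ (m - 1)) vac (\<lambda>i. i)"
    if "s + m * b \<le> n" "n + m * b \<le> t" for m
  proof -
    let ?F = "(?X ^^ m) vac"
    have "T = (\<lambda>i j. U i j + B i j)" using T by (intro ext)
    then have "lift T ?F (\<lambda>i. i) = lift U ?F (\<lambda>i. i) + lift B ?F (\<lambda>i. i)"
      by (simp only: lift_add)
    then show ?thesis
      using lift_id[of ?F B, OF alternating_clift_funpow B] fun_cong[OF step[OF that], of "\<lambda>i. i"]
      by (simp add: clift_def trT)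
  qed
  show ?thesis
    using assms(6,7)
  proof (induction m rule: less_induct)
    case (less m)
    show ?case
    proof (cases m)
      case 0 then show ?thesis by (simp add: vac_id)
    next
      case (Suc k)
      show ?thesis
      proof (cases k)
        case 0
        then show ?thesis using sc[of 0] less.prems Suc by simp
      next
        case (Suc j)
        then show ?thesis
          using sc[of "Suc j"] less.prems \<open>m = Suc k\<close> less.IH[of j] by simp
      qed
    qed
  qed
qed

text \<open>The bound has to be free of \<open>n\<close>. An alternating function vanishes on tuples
  with a repeated level, so at most \<open>w\<close> particles sit in \<open>W\<close>, each with at
  most \<open>w\<close> targets.\<close>

lemma lift_bound:
  assumes F: "alternating F" "\<And>k. \<bar>F k\<bar> \<le> c" and W: "finite W" "card W \<le> w"
    and A: "\<And>i j. A i j \<noteq> 0 \<Longrightarrow> i \<in> W \<and> j \<in> W" "\<And>i j. \<bar>A i j\<bar> \<le> d"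
  shows "\<bar>lift A F k\<bar> \<le> real (w * w) * d * c"
proof -
  have c0: "0 \<le> c" using F(2)[of undefined] by linarith
  have d0: "0 \<le> d" using A(2)[of undefined undefined] by linarith
  show ?thesis
  proof (cases "inj_on k {..<n}")
    case False
    then obtain a b where "a < n" "b < n" "a \<noteq> b" "k a = k b"
      by (auto simp: inj_on_def)
    then have "lift A F k = 0"
      by (intro alternating_dup[OF alternating_lift[OF F(1)]])
    then show ?thesis using c0 d0 by simp
  next
    case True
    let ?I = "{i\<in>{..<n}. k i \<in> W}"
    have "lift A F k = (\<Sum>i\<in>?I. \<Sum>l\<in>{..<N} \<inter> W. A l (k i) * F (k(i := l)))"
      unfolding lift_def
    proof (rule sum.mono_neutral_cong_right)
      show "\<forall>i\<in>{..<n} - ?I. (\<Sum>l<N. A l (k i) * F (k(i := l))) = 0"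
        using A(1) by (auto intro!: sum.neutral)
      show "\<And>x. x \<in> ?I \<Longrightarrow> (\<Sum>l<N. A l (k x) * F (k(x := l))) =
         (\<Sum>l\<in>{..<N} \<inter> W. A l (k x) * F (k(x := l)))"
        using A(1) by (intro sum.mono_neutral_right) auto
    qed auto
    also have "\<bar>\<dots>\<bar> \<le> (\<Sum>i\<in>?I. \<Sum>l\<in>{..<N} \<inter> W. d * c)"
      by (intro order_trans[OF sum_abs] sum_mono) (auto simp: abs_mult intro!: mult_mono F A d0)
    also have "\<dots> = real (card ?I * card ({..<N} \<inter> W)) * (d * c)" by simp
    also have "\<dots> \<le> real (w * w) * (d * c)"
    proof (intro mult_right_mono)
      have "card ?I \<le> card W"
        using True by (intro card_inj_on_le[of k]) (auto simp: inj_on_def W)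
      moreover have "card ({..<N} \<inter> W) \<le> card W" by (intro card_mono) (auto simp: W)
      ultimately show "real (card ?I * card ({..<N} \<inter> W)) \<le> real (w * w)"
        using W(2) by (intro of_nat_mono mult_le_mono) auto
    qed (use c0 d0 in auto)
    finally show ?thesis by (simp add: mult.assoc)
  qed
qed

lemma tr_bound:
  assumes W: "finite W" "card W \<le> w"
    and A: "\<And>i j. A i j \<noteq> 0 \<Longrightarrow> i \<in> W \<and> j \<in> W" "\<And>i j. \<bar>A i j\<bar> \<le> d"
  shows "\<bar>tr A\<bar> \<le> real w * d"
proof -
  have d0: "0 \<le> d" using A(2)[of undefined undefined] by linarith
  have "tr A = (\<Sum>i\<in>{..<n}\<inter>W. A i i)"
    unfolding tr_def using A(1) by (intro sum.mono_neutral_right) auto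
  also have "\<bar>\<dots>\<bar> \<le> (\<Sum>i\<in>{..<n}\<inter>W. d)"
    by (intro order_trans[OF sum_abs] sum_mono A)
  also have "\<dots> = real (card ({..<n}\<inter>W)) * d" by simp
  also have "\<dots> \<le> real w * d"
    using W card_mono[of W "{..<n} \<inter> W"] by (intro mult_right_mono d0 of_nat_mono) auto
  finally show ?thesis .
qed

lemma clift_bound:
  assumes F: "alternating F" "\<And>k. \<bar>F k\<bar> \<le> c" and W: "finite W" "card W \<le> w"
    and A: "\<And>i j. A i j \<noteq> 0 \<Longrightarrow> i \<in> W \<and> j \<in> W" "\<And>i j. \<bar>A i j\<bar> \<le> d"
  shows "\<bar>clift (tr A) A F k\<bar> \<le> real (w * w + w) * d * c"
proof -
  have d0: "0 \<le> d" using A(2)[of undefined undefined] by linarith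
  have "\<bar>tr A * F k\<bar> \<le> real w * d * c"
    unfolding abs_mult using tr_bound[OF W A] F(2)[of k] d0 by (intro mult_mono) auto
  then show ?thesis
    using lift_bound[where A = A and k = k, OF F W A] unfolding clift_def by (simp add: algebra_simps)
qed

text \<open>Telescoping: the centred lift is linear in its matrix if the centring is its trace, so
  the outermost factor can be changed from \<open>A\<close> to \<open>B\<close> at the cost of the
  centred lift of \<open>A - B\<close>. The bounds of \<open>clift_bound\<close> do not depend on
  \<open>n\<close>.\<close>

lemma clift_funpow_continuous:
  assumes W: "finite W" "card W \<le> w"
    and A: "\<And>i j. A i j \<noteq> 0 \<Longrightarrow> i \<in> W \<and> j \<in> W" "\<And>i j. \<bar>A i j\<bar> \<le> d"
    and B: "\<And>i j. B i j \<noteq> 0 \<Longrightarrow> i \<in> W \<and> j \<in> W" "\<And>i j. \<bar>B i j\<bar> \<le> d"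
    and AB: "\<And>i j. \<bar>A i j - B i j\<bar> \<le> \<epsilon>" and d1: "1 \<le> d"
  shows "\<bar>(clift (tr A) A ^^ m) vac k - (clift (tr B) B ^^ m) vac k\<bar>
            \<le> real m * \<epsilon> * (real (w * w + w) * d) ^ m"
proof (induction m arbitrary: k)
  case (Suc m)
  let ?\<kappa> = "real (w * w + w)"
  let ?F = "(clift (tr A) A ^^ m) vac" and ?G = "(clift (tr B) B ^^ m) vac"
  let ?E = "\<lambda>i j. A i j - B i j"
  have e0: "0 \<le> \<epsilon>" using AB[of 0 0] by linarith
  have G: "\<bar>?G k\<bar> \<le> (?\<kappa> * d) ^ m" for k
  proof (induction m arbitrary: k)
    case (Suc m)
    show ?case
      using clift_bound[OF alternating_clift_funpow Suc W B(1) B(2), where k = k] by (simp add: mult_ac)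
  qed (simp add: vac_le_1)
  have trE: "tr ?E = tr A - tr B" by (simp add: tr_def sum_subtractf)
  have split: "clift (tr A) A ?F k - clift (tr B) B ?G k =
      clift (tr A) A (\<lambda>k. ?F k - ?G k) k + clift (tr ?E) ?E ?G k"
    unfolding trE by (simp add: clift_def lift_diff_right lift_diff algebra_simps)
  have 1: "\<bar>clift (tr A) A (\<lambda>k. ?F k - ?G k) k\<bar> \<le> ?\<kappa> * d * (real m * \<epsilon> * (?\<kappa> * d) ^ m)"
    by (intro clift_bound[OF _ _ W A] alternating_diff alternating_clift_funpow Suc)
  have 2: "\<bar>clift (tr ?E) ?E ?G k\<bar> \<le> ?\<kappa> * \<epsilon> * (?\<kappa> * d) ^ m"
  proof (rule clift_bound[OF _ G W _ AB])
    show "alternating ?G" by (rule alternating_clift_funpow)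
    show "i \<in> W \<and> j \<in> W" if "A i j - B i j \<noteq> 0" for i j
      using A(1)[of i j] B(1)[of i j] that by (cases "A i j = 0") auto
  qed
  \<comment> \<open>The hypothesis \<open>1 \<le> d\<close> supplies the missing factor
    \<open>d\<close>, so that both terms carry the same power.\<close>
  have "?\<kappa> * \<epsilon> * (?\<kappa> * d) ^ m \<le> ?\<kappa> * d * \<epsilon> * (?\<kappa> * d) ^ m"
    using d1 e0 mult_right_mono[OF d1, of "?\<kappa> * \<epsilon> * (?\<kappa> * d) ^ m"] by (simp add: mult_ac)
  then have "\<bar>clift (tr A) A ?F k - clift (tr B) B ?G k\<bar> \<le>
     ?\<kappa> * d * (real m * \<epsilon> * (?\<kappa> * d) ^ m) + ?\<kappa> * d * \<epsilon> * (?\<kappa> * d) ^ m"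
    unfolding split using 1 2 by linarith
  also have "\<dots> = real (Suc m) * \<epsilon> * (?\<kappa> * d) ^ Suc m"
    by (simp add: algebra_simps)
  finally show ?case by simp
qed simp


text \<open>Of the margin \<open>(m + 1) * b\<close>, one \<open>b\<close> turns "some index outside
  the window" into "both indices on the same side of \<open>n\<close>", and \<open>m * b\<close> is
  what \<open>clift_funpow_local\<close> consumes.\<close>

lemma clift_funpow_window:
  assumes "banded b A" "(m + 1) * b \<le> r" "r \<le> n"
  defines "W \<equiv> {n - r..<n + r}"
  defines "A' \<equiv> (\<lambda>i j. if i \<in> W \<and> j \<in> W then A i j else 0)"
  shows "(clift (tr A) A ^^ m) vac = (clift (tr A') A' ^^ m) vac"
proof -
  let ?E = "\<lambda>i j. A i j - A' i j"
  have "off_block (n - r + b) (n + r - b) ?E"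
    unfolding off_block_def
  proof (intro allI impI)
    fix i j assume "A i j - A' i j \<noteq> 0"
    then have "A i j \<noteq> 0" and *: "i \<notin> W \<or> j \<notin> W" by (auto simp: A'_def split: if_splits)
    then have "i \<le> j + b" "j \<le> i + b" using assms(1) by (auto simp: banded_def)
    with * assms(2,3) show "(i < n - r + b \<and> j < n - r + b) \<or> (n + r - b \<le> i \<and> n + r - b \<le> j)"
      by (auto simp: W_def)
  qed
  moreover have "banded b A'"
    using assms(1) by (auto simp: banded_def A'_def)
  moreover have "tr A = tr A' + tr ?E"
    by (simp add: tr_def sum_subtractf)
  ultimately show ?thesis
    using clift_funpow_local[of b A' "n - r + b" "n + r - b" ?E m "tr A'"] assms(2,3) by simp
qed

text \<open>Toeplitz matrices commute up to edge effects, so the commutator of \<open>T\<close> with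
  its raising part lives near the ends of \<open>{..<N}\<close>, within \<open>3 * b\<close> of
  them. The remaining \<open>m * b\<close> in the condition on \<open>r\<close> is for
  \<open>gaussian_recursion\<close>.\<close>

lemma toeplitz_moment:
  fixes \<tau> :: "int \<Rightarrow> real"
  assumes sym: "\<And>d. \<tau> (- d) = \<tau> d" and \<tau>: "\<And>d. int b < d \<Longrightarrow> \<tau> d = 0"
    and r: "(m + 3) * b \<le> r" "r \<le> n" "n + r \<le> N"
  defines "T \<equiv> (\<lambda>i j. if i < N \<and> j < N then \<tau> (int i - int j) else 0)"
  shows "(clift (tr T) T ^^ m) vac (\<lambda>i. i) = gaussian_moment (\<Sum>k=1..b. real k * (\<tau> (int k))\<^sup>2) m"
proof -
  define U where "U = (\<lambda>i j. if j < i then T i j else 0)"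
  define B where "B = (\<lambda>i j. if j < i then 0 else T i j)"
  have far: "\<tau> d = 0" if "int b < \<bar>d\<bar>" for d
    using \<tau>[of d] \<tau>[of "-d"] sym[of d] that by (cases "d \<ge> 0") auto
  have band: "banded b T"
    unfolding banded_def
  proof (intro allI impI)
    fix i j assume "T i j \<noteq> 0"
    then have "\<not> int b < \<bar>int i - int j\<bar>" using far by (auto simp: T_def split: if_splits)
    then show "i \<le> j + b \<and> j \<le> i + b" by auto
  qed
  define u where "u = (\<lambda>d. if d > 0 then \<tau> d else 0 :: real)"
  have C0: "comm T U i j = 0" if ij: "i < N" "j < N" "b \<le> i" "i + b < N" for i j
  proof -
    have T: "T i l = \<tau> (int i - int l)" "T l j = \<tau> (int l - int j)"
      "U i l = u (int i - int l)" "U l j = u (int l - int j)" if "l < N" for l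
      using that ij by (auto simp: T_def U_def u_def)
    let ?I = "{int i - int b..int i + int b}"
    let ?K = "?I \<union> {int j - int b..int j + int b}"
    have ext: "(\<Sum>l<N. f (int l)) = sum f ?I" if f: "\<And>l. int b < \<bar>int i - l\<bar> \<Longrightarrow> f l = 0" for f :: "int \<Rightarrow> real"
    proof -
      have "(\<Sum>l<N. f (int l)) = sum f (int ` {..<N})"
        by (simp add: sum.reindex)
      also have "\<dots> = sum f ?I"
      proof (intro sum.mono_neutral_right)
        show "?I \<subseteq> int ` {..<N}"
        proof
          fix x assume "x \<in> ?I"
          then have "x = int (nat x)" "nat x < N" using ij by auto
          then show "x \<in> int ` {..<N}" by (metis image_eqI lessThan_iff)
        qed
        show "\<forall>l\<in>int ` {..<N} - ?I. f l = 0"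
          by (auto intro!: f)
      qed simp
      finally show ?thesis .
    qed
    have "comm T U i j = (\<Sum>l<N. \<tau> (int i - int l) * u (int l - int j))
        - (\<Sum>l<N. u (int i - int l) * \<tau> (int l - int j))"
      by (simp add: comm_def sum_subtractf T cong: sum.cong_simp)
    also have "(\<Sum>l<N. \<tau> (int i - int l) * u (int l - int j)) = (\<Sum>l\<in>?I. \<tau> (int i - l) * u (l - int j))"
      by (rule ext) (simp add: far)
    also have "(\<Sum>l<N. u (int i - int l) * \<tau> (int l - int j)) = (\<Sum>l\<in>?I. u (int i - l) * \<tau> (l - int j))"
      by (rule ext) (simp add: far u_def)
    also have "(\<Sum>l\<in>?I. \<tau> (int i - l) * u (l - int j)) = (\<Sum>l\<in>?K. \<tau> (int i - l) * u (l - int j))"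
      by (intro sum.mono_neutral_left) (auto intro!: far)
    \<comment> \<open>Commutativity of convolution: the reflection
      \<open>l \<mapsto> i + j - l\<close> exchanges the two intervals that make up
      \<open>?K\<close> and thereby the two factors.\<close>
    also have "\<dots> = (\<Sum>l\<in>?K. u (int i - l) * \<tau> (l - int j))"
      by (rule sum.reindex_bij_witness[of _ "\<lambda>l. int i + int j - l" "\<lambda>l. int i + int j - l"])
        (auto simp: algebra_simps)
    also have "\<dots> = (\<Sum>l\<in>?I. u (int i - l) * \<tau> (l - int j))"
      by (intro sum.mono_neutral_right) (auto simp: u_def intro!: far)
    finally show ?thesis by simp
  qed
  \<comment> \<open>A nonzero entry has its row index within \<open>b\<close> of an end, and its
    indices differ by at most \<open>2 * b\<close>.\<close>
  have C: "off_block (3 * b) (N - 3 * b) (comm T U)"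
    unfolding off_block_def
  proof (intro allI impI)
    fix i j assume nz: "comm T U i j \<noteq> 0"
    then obtain l where "T i l * U l j - U i l * T l j \<noteq> 0"
      unfolding comm_def by (meson sum.not_neutral_contains_not_neutral)
    then have "T i l \<noteq> 0 \<and> T l j \<noteq> 0" by (auto simp: U_def split: if_splits)
    then have "i < N" "j < N" "i \<le> l + b" "l \<le> i + b" "l \<le> j + b" "j \<le> l + b"
      using band by (auto simp: banded_def T_def split: if_splits)
    moreover have "\<not> (b \<le> i \<and> i + b < N)" using C0[of i j] nz calculation by blast
    ultimately show "(i < 3 * b \<and> j < 3 * b) \<or> (N - 3 * b \<le> i \<and> N - 3 * b \<le> j)"
      by linarith
  qed
  have br: "b \<le> r" using r(1) by (simp add: add_mult_distrib)
  have "tr (comm T U) = (\<Sum>i<n. \<Sum>l\<in>{n..<N}. (\<tau> (int l - int i))\<^sup>2)"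
    unfolding tr_comm
  proof (intro sum.cong refl)
    fix i l assume il: "i \<in> {..<n}" "l \<in> {n..<N}"
    have "\<tau> (int i - int l) = \<tau> (int l - int i)"
      using sym[of "int i - int l"] by simp
    then show "T i l * U l i - U i l * T l i = (\<tau> (int l - int i))\<^sup>2"
      using il n_le_N by (auto simp: U_def T_def power2_eq_square)
  qed
  also have "\<dots> = (\<Sum>(i, l)\<in>{..<n} \<times> {n..<N}. (\<tau> (int l - int i))\<^sup>2)"
    by (rule sum.cartesian_product)
  also have "\<dots> = (\<Sum>(i, l)\<in>{(i, l). i < n \<and> n \<le> l \<and> l \<le> i + b}. (\<tau> (int l - int i))\<^sup>2)"
    by (intro sum.mono_neutral_right) (use r br in \<open>auto intro!: \<tau>\<close>)
  \<comment> \<open>Exactly \<open>k\<close> pairs at distance \<open>k\<close> straddle level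
    \<open>n\<close>; this is the origin of the weight \<open>k\<close> in the limit
    variance.\<close>
  also have "\<dots> = (\<Sum>(k, i)\<in>(SIGMA k:{1..b}. {n - k..<n}). (\<tau> (int k))\<^sup>2)"
    by (rule sum.reindex_bij_witness[of _ "\<lambda>(k, i). (i, i + k)" "\<lambda>(i, l). (l - i, i)"])
      (auto simp: of_nat_diff)
  also have "\<dots> = (\<Sum>k=1..b. \<Sum>i\<in>{n - k..<n}. (\<tau> (int k))\<^sup>2)"
    by (rule sum.Sigma[symmetric]) auto
  also have "\<dots> = (\<Sum>k=1..b. real k * (\<tau> (int k))\<^sup>2)"
  proof (intro sum.cong refl)
    fix k assume "k \<in> {1..b}"
    moreover have "b \<le> n" using r br by auto
    ultimately show "(\<Sum>i\<in>{n - k..<n}. (\<tau> (int k))\<^sup>2) = real k * (\<tau> (int k))\<^sup>2" by simp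
  qed
  finally have trC: "tr (comm T U) = (\<Sum>k=1..b. real k * (\<tau> (int k))\<^sup>2)" .
  show ?thesis
    unfolding trC[symmetric]
    by (rule gaussian_recursion[where B = B and b = b and s = "3 * b" and t = "N - 3 * b"])
      (use band C r in \<open>auto simp: U_def B_def algebra_simps\<close>)
qed

text \<open>Both \<open>G\<close> and the Toeplitz matrix may be cut to the same window of
  \<open>2 * r\<close> levels without changing the moment. There they are uniformly close, and
  \<open>B + 1\<close> bounds both since \<open>\<epsilon> \<le> 1\<close>.\<close>

lemma moment_bound:
  fixes \<tau> :: "int \<Rightarrow> real"
  assumes sym: "\<And>d. \<tau> (- d) = \<tau> d" and \<tau>: "\<And>d. int b < d \<Longrightarrow> \<tau> d = 0"
    and r: "(m + 3) * b \<le> r" "r \<le> n" "n + r \<le> N"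
    and G: "banded b G"
    and near: "\<And>i j. i \<in> {n - r..<n + r} \<Longrightarrow> j \<in> {n - r..<n + r} \<Longrightarrow> \<bar>G i j - \<tau> (int i - int j)\<bar> \<le> \<epsilon>"
    and bound: "\<And>d. \<bar>\<tau> d\<bar> \<le> B" and \<epsilon>: "0 \<le> \<epsilon>" "\<epsilon> \<le> 1"
  shows "\<bar>(clift (tr G) G ^^ m) vac (\<lambda>i. i) - gaussian_moment (\<Sum>k=1..b. real k * (\<tau> (int k))\<^sup>2) m\<bar>
     \<le> real m * \<epsilon> * (real ((2 * r) * (2 * r) + 2 * r) * (B + 1)) ^ m"
proof -
  define T where "T = (\<lambda>i j. if i < N \<and> j < N then \<tau> (int i - int j) else 0)"
  let ?W = "{n - r..<n + r}"
  define cut where "cut = (\<lambda>A i j. if i \<in> ?W \<and> j \<in> ?W then A i j else 0 :: real)"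
  have B0: "0 \<le> B" using bound[of 0] by linarith
  have rb: "(m + 1) * b \<le> r" using r(1) by (simp add: algebra_simps)
  have "banded b T"
    unfolding banded_def
  proof (intro allI impI)
    fix i j assume "T i j \<noteq> 0"
    then have "\<tau> (int i - int j) \<noteq> 0" "\<tau> (int j - int i) \<noteq> 0"
      using sym[of "int i - int j"] by (auto simp: T_def split: if_splits)
    then show "i \<le> j + b \<and> j \<le> i + b"
      using \<tau>[of "int i - int j"] \<tau>[of "int j - int i"] by linarith
  qed
  then have T: "(clift (tr (cut T)) (cut T) ^^ m) vac = (clift (tr T) T ^^ m) vac"
    using clift_funpow_window[of b T m r] rb r(2) by (simp add: cut_def)
  have G: "(clift (tr (cut G)) (cut G) ^^ m) vac = (clift (tr G) G ^^ m) vac"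
    using clift_funpow_window[of b G m r] G rb r(2) by (simp add: cut_def)
  have "\<bar>(clift (tr (cut G)) (cut G) ^^ m) vac (\<lambda>i. i) - (clift (tr (cut T)) (cut T) ^^ m) vac (\<lambda>i. i)\<bar>
     \<le> real m * \<epsilon> * (real ((2 * r) * (2 * r) + 2 * r) * (B + 1)) ^ m"
  proof (rule clift_funpow_continuous[where W = ?W])
    fix i j
    have 1: "\<bar>cut G i j - cut T i j\<bar> \<le> \<epsilon>" and 2: "\<bar>cut T i j\<bar> \<le> B"
      using near[of i j] r \<epsilon> bound[of "int i - int j"] B0 by (auto simp: cut_def T_def)
    then show "\<bar>cut G i j - cut T i j\<bar> \<le> \<epsilon>" "\<bar>cut T i j\<bar> \<le> B + 1" "\<bar>cut G i j\<bar> \<le> B + 1"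
      using \<epsilon> by linarith+
  qed (use B0 r in \<open>auto simp: cut_def split: if_splits\<close>)
  then show ?thesis
    unfolding T G
    using toeplitz_moment[where \<tau> = \<tau> and b = b, OF sym \<tau> r] unfolding T_def by simp
qed

end

section \<open>Determinants\<close>

lemma has_sum_times:
  fixes f :: "'a \<Rightarrow> real" and g :: "'b \<Rightarrow> real"
  assumes "(f has_sum a) A" "(g has_sum b) B"
  shows "((\<lambda>(x, y). f x * g y) has_sum (a * b)) (A \<times> B)"
proof -
  have f: "(\<lambda>x. norm (f x)) summable_on A" and g: "(\<lambda>y. norm (g y)) summable_on B"
    using assms has_sum_imp_summable summable_on_iff_abs_summable_on_real by blast+
  have "(\<lambda>z. norm (case z of (x, y) \<Rightarrow> f x * g y)) summable_on A \<times> B"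
  proof (rule nonneg_bdd_above_summable_on, simp, rule bdd_aboveI2)
    fix F assume "F \<in> {F. F \<subseteq> A \<times> B \<and> finite F}"
    then have F: "F \<subseteq> A \<times> B" "finite F" by auto
    have "(\<Sum>z\<in>F. norm (case z of (x, y) \<Rightarrow> f x * g y))
       \<le> (\<Sum>z\<in>fst ` F \<times> snd ` F. norm (case z of (x, y) \<Rightarrow> f x * g y))"
      using F by (intro sum_mono2) force+
    also have "\<dots> = (\<Sum>x\<in>fst ` F. norm (f x)) * (\<Sum>y\<in>snd ` F. norm (g y))"
      by (simp add: sum_product sum.cartesian_product abs_mult case_prod_unfold)
    also have "\<dots> \<le> infsum (\<lambda>x. norm (f x)) A * infsum (\<lambda>y. norm (g y)) B"
      using F by (intro mult_mono finite_sum_le_infsum f g sum_nonneg infsum_nonneg) auto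
    finally show "(\<Sum>z\<in>F. norm (case z of (x, y) \<Rightarrow> f x * g y))
       \<le> infsum (\<lambda>x. norm (f x)) A * infsum (\<lambda>y. norm (g y)) B" .
  qed
  then have s: "(\<lambda>(x, y). f x * g y) summable_on A \<times> B"
    by (rule abs_summable_summable)
  have "infsum (\<lambda>(x, y). f x * g y) (A \<times> B) = (\<Sum>\<^sub>\<infinity>x\<in>A. \<Sum>\<^sub>\<infinity>y\<in>B. f x * g y)"
    using infsum_Sigma'_banach[of "\<lambda>x y. f x * g y" A "\<lambda>_. B"] s by simp
  also have "\<dots> = a * b"
    using assms by (simp add: infsum_cmult_right' infsum_cmult_left' infsumI)
  finally show ?thesis
    using s by (metis has_sum_infsum)
qed

lemma has_sum_PiE:
  fixes f :: "'i \<Rightarrow> 'a \<Rightarrow> real"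
  assumes "finite I" "\<And>i. i \<in> I \<Longrightarrow> (f i has_sum a i) L"
  shows "((\<lambda>x. \<Prod>i\<in>I. f i (x i)) has_sum (\<Prod>i\<in>I. a i)) (PiE I (\<lambda>_. L))"
  using assms
proof (induction I rule: finite_induct)
  case empty
  show ?case using has_sum_finite[of "{\<lambda>_. undefined :: 'a}" "\<lambda>_. 1 :: real"] by simp
next
  case (insert i I)
  let ?u = "\<lambda>(y, x). x(i := y)"
  have inj: "inj_on ?u (L \<times> PiE I (\<lambda>_. L))"
    using inj_combinator[of i I "\<lambda>_. L"] insert.hyps by (simp add: case_prod_unfold)
  have "((\<lambda>(y, x). f i y * (\<Prod>j\<in>I. f j (x j))) has_sum (a i * (\<Prod>j\<in>I. a j))) (L \<times> PiE I (\<lambda>_. L))"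
    by (intro has_sum_times insert.IH insert.prems) auto
  moreover have "(\<lambda>x. \<Prod>j\<in>insert i I. f j (x j)) \<circ> ?u = (\<lambda>(y, x). f i y * (\<Prod>j\<in>I. f j (x j)))"
  proof (rule ext, clarify)
    fix y x
    have "(\<Prod>j\<in>I. f j ((x(i := y)) j)) = (\<Prod>j\<in>I. f j (x j))"
      using insert.hyps by (intro prod.cong) auto
    then show "((\<lambda>x. \<Prod>j\<in>insert i I. f j (x j)) \<circ> ?u) (y, x) = f i y * (\<Prod>j\<in>I. f j (x j))"
      using insert.hyps by simp
  qed
  ultimately have "((\<lambda>x. \<Prod>j\<in>insert i I. f j (x j)) \<circ> ?u has_sum (\<Prod>j\<in>insert i I. a j)) (L \<times> PiE I (\<lambda>_. L))"
    using insert.hyps by simp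
  then have "((\<lambda>x. \<Prod>j\<in>insert i I. f j (x j)) has_sum (\<Prod>j\<in>insert i I. a j)) (?u ` (L \<times> PiE I (\<lambda>_. L)))"
    by (rule has_sum_reindex[OF inj, THEN iffD2])
  moreover have "PiE (insert i I) (\<lambda>_. L) = ?u ` (L \<times> PiE I (\<lambda>_. L))"
    by (simp add: PiE_insert_eq)
  ultimately show ?case by simp
qed

lemma has_sum_abs_le:
  fixes f g :: "'a \<Rightarrow> real"
  assumes "g summable_on A" "\<And>x. x \<in> A \<Longrightarrow> \<bar>f x\<bar> \<le> g x"
  shows "f summable_on A"
  using abs_summable_summable[OF Infinite_Sum.abs_summable_on_comparison_test'[of g A f]] assms by simp

lemma has_sum_sum_fun:
  fixes f :: "'i \<Rightarrow> 'a \<Rightarrow> real"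
  assumes "finite I" "\<And>i. i \<in> I \<Longrightarrow> (f i has_sum s i) A"
  shows "((\<lambda>x. \<Sum>i\<in>I. f i x) has_sum (\<Sum>i\<in>I. s i)) A"
  using assms by (induction I rule: finite_induct) (auto intro!: has_sum_add)

text \<open>The size is a natural number, not a type, because the number of points varies; only the
  leading block of \<open>g\<close> matters.\<close>

definition detn :: "nat \<Rightarrow> (nat \<Rightarrow> nat \<Rightarrow> real) \<Rightarrow> real" where
  "detn n g = (\<Sum>p | p permutes {..<n}. of_int (sign p) * (\<Prod>i<n. g i (p i)))"

section \<open>Alternation and multilinearity of determinants\<close>

lemma detn_cong: "(\<And>i j. i < n \<Longrightarrow> j < n \<Longrightarrow> f i j = g i j) \<Longrightarrow> detn n f = detn n g"
  unfolding detn_def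
  by (intro sum.cong prod.cong arg_cong2[of _ _ _ _ "(*)"] refl) (auto dest: permutes_in_image[THEN iffD2])

lemma detn_transpose: "detn n g = (\<Sum>p | p permutes {..<n}. of_int (sign p) * (\<Prod>i<n. g (p i) i))"
proof -
  have "detn n g = (\<Sum>p | p permutes {..<n}. of_int (sign (inv p)) * (\<Prod>i<n. g i (inv p i)))"
    unfolding detn_def by (rule sum_permutations_inverse)
  also have "\<dots> = (\<Sum>p | p permutes {..<n}. of_int (sign p) * (\<Prod>i<n. g (p i) i))"
  proof (intro sum.cong refl)
    fix p :: "nat \<Rightarrow> nat" assume "p \<in> {p. p permutes {..<n}}"
    then have p: "p permutes {..<n}" by simp
    have "(\<Prod>i<n. g i (inv p i)) = (\<Prod>i<n. g (p i) (inv p (p i)))"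
      using prod.permute[OF p, of "\<lambda>i. g i (inv p i)"] by (simp add: o_def)
    then show "of_int (sign (inv p)) * (\<Prod>i<n. g i (inv p i)) = of_int (sign p) * (\<Prod>i<n. g (p i) i)"
      using p by (simp add: sign_inverse permutes_inverses(2)[OF p] permutes_imp_permutation[OF _ p])
  qed
  finally show ?thesis .
qed

lemma detn_permute_columns:
  assumes p: "p permutes {..<n}"
  shows "detn n (\<lambda>i j. g i (p j)) = of_int (sign p) * detn n g"
proof -
  have per: "permutation q" if "q permutes {..<n}" for q
    using that by (meson finite_lessThan permutation_permutes)
  have "detn n g = (\<Sum>q | q permutes {..<n}. of_int (sign (p \<circ> q)) * (\<Prod>i<n. g i ((p \<circ> q) i)))"
    unfolding detn_def by (rule setum_permutations_compose_left[OF p])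
  also have "\<dots> = (\<Sum>q | q permutes {..<n}. of_int (sign p) * (of_int (sign q) * (\<Prod>i<n. g i (p (q i)))))"
    by (intro sum.cong refl) (auto simp: sign_compose per p)
  also have "\<dots> = of_int (sign p) * detn n (\<lambda>i j. g i (p j))"
    by (simp add: detn_def sum_distrib_left)
  finally show ?thesis by (simp add: sign_def)
qed

lemma detn_permute_rows:
  assumes p: "p permutes {..<n}"
  shows "detn n (\<lambda>i j. g (p i) j) = of_int (sign p) * detn n g"
proof -
  have "detn n (\<lambda>i j. g (p i) j) = detn n (\<lambda>i j. (\<lambda>a b. g b a) i (p j))"
    by (subst detn_transpose) (simp add: detn_def)
  also have "\<dots> = of_int (sign p) * detn n (\<lambda>a b. g b a)"
    by (rule detn_permute_columns[OF p])
  also have "detn n (\<lambda>a b. g b a) = detn n g"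
    by (subst detn_transpose) (simp add: detn_def)
  finally show ?thesis .
qed

lemma detn_equal_columns:
  assumes "a < n" "b < n" "a \<noteq> b" "\<And>i. i < n \<Longrightarrow> g i a = g i b"
  shows "detn n g = 0"
proof -
  let ?t = "Transposition.transpose a b"
  have "detn n g = detn n (\<lambda>i j. g i (?t j))"
    using assms by (intro detn_cong) (auto simp: Transposition.transpose_def)
  also have "\<dots> = of_int (sign ?t) * detn n g"
    using assms by (intro detn_permute_columns permutes_swap_id) auto
  finally show ?thesis using assms by (simp add: sign_swap_id)
qed

lemma detn_equal_rows:
  assumes "a < n" "b < n" "a \<noteq> b" "\<And>j. j < n \<Longrightarrow> g a j = g b j"
  shows "detn n g = 0"
proof -
  let ?t = "Transposition.transpose a b"
  have "detn n g = detn n (\<lambda>i j. g (?t i) j)"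
    using assms by (intro detn_cong) (auto simp: Transposition.transpose_def)
  also have "\<dots> = of_int (sign ?t) * detn n g"
    using assms by (intro detn_permute_rows permutes_swap_id) auto
  finally show ?thesis using assms by (simp add: sign_swap_id)
qed

lemma detn_row_expand:
  assumes "a < n"
  shows "detn n (g(a := h)) =
    (\<Sum>p | p permutes {..<n}. of_int (sign p) * (\<Prod>i\<in>{..<n} - {a}. g i (p i)) * h (p a))"
  unfolding detn_def
proof (intro sum.cong refl)
  fix p
  have "(\<Prod>i<n. (g(a := h)) i (p i)) = h (p a) * (\<Prod>i\<in>{..<n} - {a}. (g(a := h)) i (p i))"
    using assms by (subst prod.remove[of _ a]) auto
  also have "(\<Prod>i\<in>{..<n} - {a}. (g(a := h)) i (p i)) = (\<Prod>i\<in>{..<n} - {a}. g i (p i))"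
    by (intro prod.cong) auto
  finally show "of_int (sign p) * (\<Prod>i<n. (g(a := h)) i (p i)) =
     of_int (sign p) * (\<Prod>i\<in>{..<n} - {a}. g i (p i)) * h (p a)" by simp
qed

lemma detn_row_sum:
  assumes "a < n"
  shows "detn n (g(a := (\<lambda>j. \<Sum>l\<in>S. c l * h l j))) = (\<Sum>l\<in>S. c l * detn n (g(a := h l)))"
  by (simp add: detn_row_expand[OF assms] sum_distrib_left sum_distrib_right sum.swap[of _ S] mult_ac)

lemma detn_row_add:
  assumes "a < n"
  shows "detn n (g(a := (\<lambda>j. h j + h' j))) = detn n (g(a := h)) + detn n (g(a := h'))"
  by (simp add: detn_row_expand[OF assms] algebra_simps sum.distrib)

lemma detn_zero_row: "a < n \<Longrightarrow> (\<And>j. j < n \<Longrightarrow> g a j = 0) \<Longrightarrow> detn n g = 0"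
  unfolding detn_def
  by (intro sum.neutral ballI mult_eq_0_iff[THEN iffD2] disjI2 prod_zero bexI[of _ a])
    (auto dest: permutes_in_image[THEN iffD2])

lemma detn_diagonal:
  assumes "\<And>i j. i < n \<Longrightarrow> j < n \<Longrightarrow> i \<noteq> j \<Longrightarrow> g i j = 0"
  shows "detn n g = (\<Prod>i<n. g i i)"
proof -
  have "detn n g = (\<Sum>p\<in>{id}. of_int (sign p) * (\<Prod>i<n. g i (p i)))"
    unfolding detn_def
  proof (intro sum.mono_neutral_right ballI)
    fix p assume "p \<in> {p. p permutes {..<n}} - {id :: nat \<Rightarrow> nat}"
    then have p: "p permutes {..<n}" "p \<noteq> id" by auto
    then obtain i where "p i \<noteq> i" by (auto simp: fun_eq_iff)
    moreover from this have "i < n" using p by (auto simp: permutes_def)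
    ultimately have "i \<in> {..<n}" "g i (p i) = 0"
      using assms[of i "p i"] permutes_in_image[OF p(1), of i] by auto
    then show "of_int (sign p) * (\<Prod>i<n. g i (p i)) = 0"
      using prod_zero[of "{..<n}" "\<lambda>i. g i (p i)"] by auto
  qed (auto simp: permutes_id finite_permutations)
  then show ?thesis by simp
qed

text \<open>In the term of a permutation \<open>p\<close> the row sum produces the factor
  \<open>\<Sum>a<n. c (p a)\<close>, which does not depend on \<open>p\<close>. Through this
  identity, multiplication by a linear statistic acts on determinants row by row.\<close>

lemma detn_scale_columns_sum:
  "(\<Sum>a<n. detn n (h(a := (\<lambda>j. c j * h a j)))) = (\<Sum>j<n. c j) * detn n h"
proof -
  have "(\<Sum>a<n. detn n (h(a := (\<lambda>j. c j * h a j)))) =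
     (\<Sum>a<n. \<Sum>p | p permutes {..<n}. of_int (sign p) * (\<Prod>i<n. h i (p i)) * c (p a))"
  proof (intro sum.cong refl)
    fix a assume a: "a \<in> {..<n}"
    then have "(\<Prod>i<n. h i (p i)) = h a (p a) * (\<Prod>i\<in>{..<n} - {a}. h i (p i))" for p
      by (subst prod.remove[of _ a]) auto
    with a show "detn n (h(a := (\<lambda>j. c j * h a j))) =
      (\<Sum>p | p permutes {..<n}. of_int (sign p) * (\<Prod>i<n. h i (p i)) * c (p a))"
      by (simp add: detn_row_expand mult_ac)
  qed
  also have "\<dots> = (\<Sum>p | p permutes {..<n}. of_int (sign p) * (\<Prod>i<n. h i (p i)) * (\<Sum>a<n. c (p a)))"
    by (subst sum.swap) (simp add: sum_distrib_left)
  also have "\<dots> = (\<Sum>p | p permutes {..<n}. of_int (sign p) * (\<Prod>i<n. h i (p i)) * (\<Sum>j<n. c j))"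
  proof (rule sum.cong[OF refl])
    fix p assume "p \<in> {p. p permutes {..<n}}"
    then have "(\<Sum>a<n. c (p a)) = (\<Sum>j<n. c j)"
      using sum.permute[of p "{..<n}" c] by (simp add: o_def)
    then show "of_int (sign p) * (\<Prod>i<n. h i (p i)) * (\<Sum>a<n. c (p a)) =
       of_int (sign p) * (\<Prod>i<n. h i (p i)) * (\<Sum>j<n. c j)" by simp
  qed
  also have "\<dots> = detn n h * (\<Sum>j<n. c j)"
    unfolding detn_def by (rule sum_distrib_right[symmetric])
  finally show ?thesis by (simp only: mult.commute)
qed

text \<open>Seen as a polynomial in its last variable, the determinant has degree at most
  \<open>n\<close>, vanishes at the earlier points, and has its top coefficient given by the
  induction hypothesis.\<close>

lemma vandermonde_alternant:
  fixes q :: "nat \<Rightarrow> real poly" and z :: "nat \<Rightarrow> real"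
  assumes "\<And>k. k < n \<Longrightarrow> degree (q k) = k"
  shows "detn n (\<lambda>i j. poly (q i) (z j)) = (\<Prod>k<n. lead_coeff (q k)) * (\<Prod>j<n. \<Prod>i<j. z j - z i)"
  using assms
proof (induction n)
  case 0
  show ?case by (simp add: detn_def permutes_empty)
next
  case (Suc n)
  let ?V = "\<lambda>n. (\<Prod>j<n. \<Prod>i<j. z j - z i)"
  have IH: "detn n (\<lambda>i j. poly (q i) (z j)) = (\<Prod>k<n. lead_coeff (q k)) * ?V n"
    using Suc by auto
  \<comment> \<open>Expansion along the last column: \<open>inv p n\<close> is the row that meets
    it, and \<open>C p\<close> collects the factors free of the variable.\<close>
  define C where "C = (\<lambda>p. of_int (sign p) * (\<Prod>i\<in>{..<Suc n} - {inv p n}. poly (q i) (z (p i))))"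
  define Q where "Q = (\<Sum>p | p permutes {..<Suc n}. smult (C p) (q (inv p n)))"
  have Q: "poly Q t = detn (Suc n) (\<lambda>i j. poly (q i) ((z(n := t)) j))" for t
    unfolding Q_def detn_def poly_sum
  proof (intro sum.cong refl)
    fix p assume "p \<in> {p. p permutes {..<Suc n}}"
    then have p: "p permutes {..<Suc n}" by simp
    have i: "inv p n \<in> {..<Suc n}" "p (inv p n) = n"
      using permutes_in_image[OF permutes_inv[OF p]] permutes_inverses[OF p] by auto
    have ne: "p i \<noteq> n" if "i \<noteq> inv p n" for i
      using that permutes_inverses[OF p] by metis
    have "(\<Prod>i<Suc n. poly (q i) ((z(n := t)) (p i))) =
       poly (q (inv p n)) t * (\<Prod>i\<in>{..<Suc n} - {inv p n}. poly (q i) ((z(n := t)) (p i)))"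
      using i by (subst prod.remove[of _ "inv p n"]) auto
    also have "(\<Prod>i\<in>{..<Suc n} - {inv p n}. poly (q i) ((z(n := t)) (p i))) =
       (\<Prod>i\<in>{..<Suc n} - {inv p n}. poly (q i) (z (p i)))"
      using ne by (intro prod.cong) auto
    finally show "poly (smult (C p) (q (inv p n))) t =
       of_int (sign p) * (\<Prod>i<Suc n. poly (q i) ((z(n := t)) (p i)))"
      by (simp add: C_def)
  qed
  have inv_le: "inv p n \<le> n" if "p permutes {..<Suc n}" for p
    using permutes_in_image[OF permutes_inv[OF that], of n] by simp
  have degQ: "degree Q \<le> n"
    unfolding Q_def
    by (intro degree_sum_le)
      (use inv_le Suc.prems in \<open>auto intro!: order_trans[OF degree_smult_le] simp: less_Suc_eq_le
        finite_permutations\<close>)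
  \<comment> \<open>Only permutations fixing \<open>n\<close> reach degree \<open>n\<close>, because
    any other one pairs the last column with a polynomial of lower degree.\<close>
  have "coeff Q n = (\<Sum>p | p permutes {..<Suc n}. if inv p n = n then C p * lead_coeff (q n) else 0)"
    unfolding Q_def coeff_sum
  proof (intro sum.cong refl)
    fix p assume "p \<in> {p. p permutes {..<Suc n}}"
    then have "inv p n \<le> n" using inv_le by auto
    then show "coeff (smult (C p) (q (inv p n))) n = (if inv p n = n then C p * lead_coeff (q n) else 0)"
      using Suc.prems[of n] Suc.prems[of "inv p n"] by (auto intro!: coeff_eq_0)
  qed
  also have "\<dots> = (\<Sum>p | p permutes {..<n}. C p * lead_coeff (q n))"
  proof (intro sum.mono_neutral_cong_right)
    show "finite {p. p permutes {..<Suc n}}" by (simp add: finite_permutations)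
    show "{p. p permutes {..<n}} \<subseteq> {p. p permutes {..<Suc n}}"
      by (auto intro: permutes_subset)
    show "\<forall>p\<in>{p. p permutes {..<Suc n}} - {p. p permutes {..<n}}.
       (if inv p n = n then C p * lead_coeff (q n) else 0) = 0"
    proof
      fix p assume p: "p \<in> {p. p permutes {..<Suc n}} - {p. p permutes {..<n}}"
      have "inv p n \<noteq> n"
      proof
        assume "inv p n = n"
        moreover have pS: "p permutes {..<Suc n}" using p by simp
        ultimately have pn: "p n = n" using permutes_inverses(1)[OF pS, of n] by simp
        have "p permutes {..<n}"
          by (rule permutes_superset[OF pS]) (use pn in \<open>auto simp: less_Suc_eq\<close>)
        with p show False by simp
      qed
      then show "(if inv p n = n then C p * lead_coeff (q n) else 0) = 0" by simp
    qed
    fix p assume "p \<in> {p. p permutes {..<n}}"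
    then have p: "p permutes {..<n}" by simp
    have "inv p n = n" using permutes_not_in[OF permutes_inv[OF p], of n] by simp
    then show "(if inv p n = n then C p * lead_coeff (q n) else 0) = C p * lead_coeff (q n)" by simp
  qed
  also have "\<dots> = detn n (\<lambda>i j. poly (q i) (z j)) * lead_coeff (q n)"
    unfolding detn_def sum_distrib_right
  proof (intro sum.cong refl)
    fix p assume "p \<in> {p. p permutes {..<n}}"
    then have p: "p permutes {..<n}" by simp
    have "inv p n = n" using permutes_not_in[OF permutes_inv[OF p], of n] by simp
    moreover have "{..<Suc n} - {n} = {..<n}" by auto
    ultimately show "C p * lead_coeff (q n) =
       of_int (sign p) * (\<Prod>i<n. poly (q i) (z (p i))) * lead_coeff (q n)"
      by (simp add: C_def)
  qed
  finally have coeffQ: "coeff Q n = (\<Prod>k<Suc n. lead_coeff (q k)) * ?V n"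
    by (simp add: IH)
  have root: "poly Q (z j) = 0" if "j < n" for j
    unfolding Q using that by (intro detn_equal_columns[of j _ n]) auto
  have id: "detn (Suc n) (\<lambda>i j. poly (q i) (z j)) = poly Q (z n)"
    unfolding Q by (intro detn_cong) auto
  define R where "R = (\<Prod>i<n. [:- z i, 1:])"
  have degR: "degree R = n" "lead_coeff R = 1"
    unfolding R_def by (subst degree_prod_eq_sum_degree, auto simp: lead_coeff_prod)
  have "poly Q t = coeff Q n * poly R t" for t
  \<comment> \<open>With coinciding points both sides vanish; otherwise \<open>n\<close> distinct
    roots determine \<open>Q\<close> from its top coefficient.\<close>
  proof (cases "inj_on z {..<n}")
    case False
    then obtain a b where ab: "a < n" "b < n" "a < b" "z a = z b"
      by (metis inj_onI lessThan_iff nat_neq_iff)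
    then have "(\<Prod>i<b. z b - z i) = 0"
      by (intro prod_zero bexI[of _ a]) auto
    then have "?V n = 0"
      using ab prod_zero[of "{..<n}" "\<lambda>j. \<Prod>i<j. z j - z i"] by auto
    moreover have "poly Q t = 0"
      unfolding Q using ab by (intro detn_equal_columns[of a _ b]) auto
    ultimately show ?thesis using coeffQ by simp
  next
    case True
    let ?D = "Q - smult (coeff Q n) R"
    have "?D = 0"
    proof (rule ccontr)
      assume nz: "?D \<noteq> 0"
      have "degree ?D \<le> n"
        using degQ degR degree_smult_le[of "coeff Q n" R] by (intro degree_diff_le) auto
      moreover have "coeff ?D n = 0" using degR by simp
      ultimately have "degree ?D < n"
        using nz by (metis le_neq_implies_less leading_coeff_0_iff)
      moreover have "card (z ` {..<n}) \<le> card {x. poly ?D x = 0}"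
        using root by (intro card_mono poly_roots_finite nz) (auto simp: R_def poly_prod)
      ultimately show False
        using card_image[OF True] card_poly_roots_bound[OF nz] by simp
    qed
    then have "Q = smult (coeff Q n) R" by simp
    then show ?thesis by (metis poly_smult)
  qed
  then show ?case
    by (simp add: id coeffQ R_def poly_prod mult.assoc)
qed

text \<open>The Andreief identity. Expand the first determinant, absorb the sign of its permutation
  by permuting the columns of the second, and sum coordinate by coordinate; all \<open>n!\<close>
  permutations give the same value. Coordinates are numbered from 1 and columns from 0, whence
  \<open>Suc j\<close>.\<close>

lemma andreief:
  fixes f g :: "nat \<Rightarrow> 'a \<Rightarrow> real"
  assumes "\<And>i j. i < n \<Longrightarrow> j < n \<Longrightarrow> ((\<lambda>y. f i y * g j y) has_sum M i j) L"
  shows "((\<lambda>x. detn n (\<lambda>i j. f i (x (Suc j))) * detn n (\<lambda>i j. g i (x (Suc j))))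
           has_sum (fact n * detn n M)) (PiE {1..n} (\<lambda>_. L))"
proof -
  let ?S = "{p. p permutes {..<n}}"
  have eq: "detn n (\<lambda>i j. f i (x (Suc j))) * detn n (\<lambda>i j. g i (x (Suc j))) =
     (\<Sum>p\<in>?S. \<Sum>r\<in>?S. of_int (sign r) * (\<Prod>j<n. f j (x (Suc (p j))) * g (r j) (x (Suc (p j)))))" for x
  proof -
    have "detn n (\<lambda>i j. f i (x (Suc j))) * detn n (\<lambda>i j. g i (x (Suc j))) =
      (\<Sum>p\<in>?S. (\<Prod>j<n. f j (x (Suc (p j)))) * (of_int (sign p) * detn n (\<lambda>i j. g i (x (Suc j)))))"
      unfolding detn_def[of n "\<lambda>i j. f i (x (Suc j))"] sum_distrib_right
      by (intro sum.cong refl) (simp add: mult_ac)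
    also have "\<dots> = (\<Sum>p\<in>?S. (\<Prod>j<n. f j (x (Suc (p j)))) * detn n (\<lambda>i j. g i (x (Suc (p j)))))"
      by (intro sum.cong refl)
        (simp add: detn_permute_columns[where g = "\<lambda>i j. g i (x (Suc j))"])
    finally show ?thesis
      by (simp add: detn_transpose sum_distrib_left prod.distrib mult_ac)
  qed
  have one: "((\<lambda>x. \<Prod>j<n. f j (x (Suc (p j))) * g (r j) (x (Suc (p j)))) has_sum (\<Prod>j<n. M j (r j)))
      (PiE {1..n} (\<lambda>_. L))" if p: "p permutes {..<n}" and r: "r permutes {..<n}" for p r
  proof -
    \<comment> \<open>Coordinate \<open>a\<close> is column \<open>a - 1\<close>, and
      \<open>?e a\<close> is the row that \<open>p\<close> sends there.\<close>
    let ?e = "\<lambda>a. inv p (a - 1)"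
    have bij: "bij_betw (\<lambda>j. Suc (p j)) {..<n} {1..n}"
    proof -
      have "bij_betw Suc {..<n} {1..n}"
        by (auto simp: bij_betw_def image_Suc_lessThan)
      from bij_betw_trans[OF permutes_imp_bij[OF p] this] show ?thesis
        by (simp only: o_def)
    qed
    have "((\<lambda>x. \<Prod>a\<in>{1..n}. f (?e a) (x a) * g (r (?e a)) (x a)) has_sum (\<Prod>a\<in>{1..n}. M (?e a) (r (?e a))))
      (PiE {1..n} (\<lambda>_. L))"
    proof (intro has_sum_PiE assms)
      fix a assume "a \<in> {1..n}"
      then show "?e a < n" using permutes_in_image[OF permutes_inv[OF p], of "a - 1"] by auto
      then show "r (?e a) < n" using permutes_in_image[OF r] by auto
    qed auto
    moreover have X: "(\<Prod>a\<in>{1..n}. h a) = (\<Prod>j<n. h (Suc (p j)))" for h :: "nat \<Rightarrow> real"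
      by (rule prod.reindex_bij_betw[OF bij, symmetric])
    ultimately show ?thesis
      unfolding X by (simp add: permutes_inverses[OF p])
  qed
  have "((\<lambda>x. \<Sum>p\<in>?S. \<Sum>r\<in>?S. of_int (sign r) * (\<Prod>j<n. f j (x (Suc (p j))) * g (r j) (x (Suc (p j)))))
     has_sum (\<Sum>p\<in>?S. \<Sum>r\<in>?S. of_int (sign r) * (\<Prod>j<n. M j (r j)))) (PiE {1..n} (\<lambda>_. L))"
    by (intro has_sum_sum_fun has_sum_cmult_right one) (auto simp: finite_permutations)
  moreover have "(\<Sum>p\<in>?S. \<Sum>r\<in>?S. of_int (sign r) * (\<Prod>j<n. M j (r j))) = fact n * detn n M"
    by (simp add: detn_def card_permutations)
  ultimately show ?thesis by (simp add: eq)
qed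

section \<open>Determinantal point processes\<close>

lemma (in levels) lift_has_sum:
  assumes "\<And>i l. i < n \<Longrightarrow> l < N \<Longrightarrow> ((\<lambda>x. F x (k(i := l)) * h x) has_sum (c * V (k(i := l)))) B"
  shows "((\<lambda>x. lift A (F x) k * h x) has_sum (c * lift A V k)) B"
proof -
  have "((\<lambda>x. \<Sum>i<n. \<Sum>l<N. A l (k i) * (F x (k(i := l)) * h x)) has_sum
     (\<Sum>i<n. \<Sum>l<N. A l (k i) * (c * V (k(i := l))))) B"
    by (intro has_sum_sum_fun has_sum_cmult_right assms) auto
  then show ?thesis
    by (simp add: lift_def sum_distrib_left sum_distrib_right mult_ac)
qed

text \<open>The square root of the weight is absorbed into \<open>\<phi>\<close>, so
  \<open>L\<close> carries counting measure. Orthonormality reaches up to \<open>N\<close> because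
  multiplication by a statistic leads out of the first \<open>n\<close> functions.\<close>

locale ensemble = levels +
  fixes L :: "'a set" and \<phi> :: "nat \<Rightarrow> 'a \<Rightarrow> real" and P :: "(nat \<Rightarrow> 'a) pmf"
  assumes orth: "\<And>i j. i < N \<Longrightarrow> j < N \<Longrightarrow>
      ((\<lambda>y. \<phi> i y * \<phi> j y) has_sum (if i = j then 1 else 0)) L"
    and pmf_P: "\<And>x. pmf P x = (if x \<in> PiE {1..n} (\<lambda>_. L)
      then (detn n (\<lambda>i j. \<phi> i (x (Suc j))))\<^sup>2 / fact n else 0)"
begin

definition slater :: "(nat \<Rightarrow> nat) \<Rightarrow> (nat \<Rightarrow> 'a) \<Rightarrow> real" where
  "slater k x = detn n (\<lambda>i j. \<phi> (k i) (x (Suc j)))"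

abbreviation \<Omega> :: "(nat \<Rightarrow> 'a) set" where
  "\<Omega> \<equiv> PiE {1..n} (\<lambda>_. L)"

definition stat :: "('a \<Rightarrow> real) \<Rightarrow> (nat \<Rightarrow> 'a) \<Rightarrow> real" where
  "stat u x = (\<Sum>j<n. u (x (Suc j)))"

lemma has_bochner_integral_P:
  assumes "((\<lambda>x. (slater (\<lambda>i. i) x)\<^sup>2 * h x) has_sum (fact n * e)) \<Omega>"
  shows "has_bochner_integral (measure_pmf P) h e"
proof -
  have "((\<lambda>x. 1 / fact n * ((slater (\<lambda>i. i) x)\<^sup>2 * h x)) has_sum (1 / fact n * (fact n * e))) \<Omega>"
    by (intro has_sum_cmult_right assms)
  then have "((\<lambda>x. 1 / fact n * ((slater (\<lambda>i. i) x)\<^sup>2 * h x)) has_sum e) \<Omega>" by simp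
  then have "((\<lambda>x. pmf P x * h x) has_sum e) \<Omega>"
    by (rule has_sum_cong[THEN iffD1, rotated]) (simp add: pmf_P slater_def)
  then have hs: "((\<lambda>x. pmf P x * h x) has_sum e) UNIV"
  proof (rule has_sum_cong_neutral[THEN iffD1, rotated -1])
    show "pmf P x * h x = 0" if "x \<in> UNIV - \<Omega>" for x
      using that unfolding pmf_P by simp
  qed auto
  have "(\<lambda>x. norm (pmf P x * h x)) summable_on UNIV"
    by (rule summable_on_iff_abs_summable_on_real[THEN iffD1, OF has_sum_imp_summable[OF hs]])
  then have abs: "Infinite_Set_Sum.abs_summable_on (\<lambda>x. pmf P x * h x) UNIV"
    by (simp only: abs_summable_equivalent)
  then have int: "integrable (count_space UNIV) (\<lambda>x. pmf P x *\<^sub>R h x)"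
    by (simp add: abs_summable_on_def)
  have "integrable (measure_pmf P) h"
    unfolding measure_pmf_eq_density using int
    by (subst integrable_density) auto
  moreover have "measure_pmf.expectation P h = e"
    unfolding pmf_expectation_eq_infsetsum using infsetsum_infsum[OF abs] hs
    by (simp add: infsumI)
  ultimately show ?thesis by (simp add: has_bochner_integral_iff)
qed

text \<open>By the Andreief identity the overlap of a Slater determinant with the sea is
  \<open>n!\<close> times the determinant of a 0-1 matrix, which is \<open>vac\<close>. This links
  the algebra of lifts to expectations.\<close>

lemma slater_has_sum:
  assumes "\<And>i. i < n \<Longrightarrow> k i < N"
  shows "((\<lambda>x. slater k x * slater (\<lambda>i. i) x) has_sum (fact n * vac k)) \<Omega>"
proof -
  have "((\<lambda>x. slater k x * slater (\<lambda>i. i) x) has_sum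
      (fact n * detn n (\<lambda>i j. if k i = j then 1 else 0))) \<Omega>"
    unfolding slater_def
    by (intro andreief[where g = \<phi>] orth assms) (use n_le_N in auto)
  moreover have "detn n (\<lambda>i j. if k i = j then 1 else 0) = vac k"
  proof -
    define q where "q = (\<lambda>i. if i < n then k i else i)"
    have "(\<Prod>i<n. if k i = p i then 1 else 0 :: real) = (if p = q then 1 else 0)"
      if p: "p permutes {..<n}" for p
    proof (cases "p = q")
      case False
      then obtain i where "p i \<noteq> q i" by auto
      then have "i < n" "k i \<noteq> p i"
        using permutes_not_in[OF p, of i] by (auto simp: q_def split: if_splits)
      then show ?thesis using False by auto
    qed (auto simp: q_def)
    then have "detn n (\<lambda>i j. if k i = j then 1 else 0) =
        (\<Sum>p | p permutes {..<n}. if p = q then of_int (sign p) else 0)"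
      unfolding detn_def by (intro sum.cong) auto
    also have "\<dots> = vac k"
      by (auto simp: vac_def q_def[symmetric] finite_permutations)
    finally show ?thesis .
  qed
  ultimately show ?thesis by simp
qed

lemma lift_slater:
  assumes "\<And>i. i < n \<Longrightarrow> k i + b < N" "x \<in> \<Omega>"
    and G: "\<And>j y. j + b < N \<Longrightarrow> y \<in> L \<Longrightarrow> g y * \<phi> j y = (\<Sum>l<N. G l j * \<phi> l y)"
  shows "lift G (\<lambda>k. slater k x) k = stat g x * slater k x"
proof -
  let ?h = "\<lambda>i j. \<phi> (k i) (x (Suc j))"
  have upd: "(\<lambda>a j. \<phi> ((k(i := l)) a) (x (Suc j))) = ?h(i := \<lambda>j. \<phi> l (x (Suc j)))" for i l
    by (auto simp: fun_eq_iff)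
  have "lift G (\<lambda>k. slater k x) k =
     (\<Sum>i<n. detn n (?h(i := \<lambda>j. \<Sum>l<N. G l (k i) * \<phi> l (x (Suc j)))))"
    unfolding lift_def slater_def upd
    by (intro sum.cong refl) (simp add: detn_row_sum)
  also have "\<dots> = (\<Sum>i<n. detn n (?h(i := \<lambda>j. g (x (Suc j)) * ?h i j)))"
  proof (intro sum.cong refl detn_cong)
    fix i a j assume "i \<in> {..<n}" "a < n" "j < n"
    moreover have "x (Suc j) \<in> L" using assms(2) \<open>j < n\<close> by auto
    ultimately show "(?h(i := \<lambda>j. \<Sum>l<N. G l (k i) * \<phi> l (x (Suc j)))) a j =
       (?h(i := \<lambda>j. g (x (Suc j)) * ?h i j)) a j"
      using G[of "k i" "x (Suc j)"] assms(1) by auto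
  qed
  also have "\<dots> = stat g x * slater k x"
    unfolding stat_def slater_def by (rule detn_scale_columns_sum)
  finally show ?thesis .
qed

text \<open>Each factor raises a level by at most \<open>b\<close>, so the condition
  \<open>k i + m * b < N\<close> keeps every expansion of \<open>g * \<phi>\<close> within the
  available levels.\<close>

lemma clift_slater:
  assumes band: "banded b G"
    and G: "\<And>j y. j + b < N \<Longrightarrow> y \<in> L \<Longrightarrow> g y * \<phi> j y = (\<Sum>l<N. G l j * \<phi> l y)"
    and "\<And>i. i < n \<Longrightarrow> k i + m * b < N" "x \<in> \<Omega>"
  shows "(clift c G ^^ m) (\<lambda>k. slater k x) k = (stat g x - c) ^ m * slater k x"
  using assms(3)
proof (induction m arbitrary: k)
  case (Suc m)
  let ?F = "(clift c G ^^ m) (\<lambda>k. slater k x)"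
  have "lift G ?F k = (\<Sum>i<n. \<Sum>l<N. G l (k i) * ((stat g x - c) ^ m * slater (k(i := l)) x))"
    unfolding lift_def
  proof (intro sum.cong refl)
    fix i l assume i: "i \<in> {..<n}"
    show "G l (k i) * ?F (k(i := l)) = G l (k i) * ((stat g x - c) ^ m * slater (k(i := l)) x)"
    proof (cases "G l (k i) = 0")
      case False
      then have "l \<le> k i + b" using band by (auto simp: banded_def)
      then have "?F (k(i := l)) = (stat g x - c) ^ m * slater (k(i := l)) x"
        using Suc.prems i by (intro Suc.IH) (force simp: algebra_simps)
      then show ?thesis by simp
    qed simp
  qed
  also have "\<dots> = (stat g x - c) ^ m * lift G (\<lambda>k. slater k x) k"
    by (simp add: lift_def sum_distrib_left mult_ac)
  also have "lift G (\<lambda>k. slater k x) k = stat g x * slater k x"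
    by (intro lift_slater[of k b] G assms(4)) (use Suc.prems in force)+
  finally have "lift G ?F k = (stat g x - c) ^ m * (stat g x * slater k x)" .
  moreover have "?F k = (stat g x - c) ^ m * slater k x"
  proof (rule Suc.IH)
    fix i assume "i < n"
    from Suc.prems[OF this] show "k i + m * b < N" by simp
  qed
  moreover have "(clift c G ^^ Suc m) (\<lambda>k. slater k x) k = lift G ?F k - c * ?F k"
    by (simp add: clift_def[of c G ?F k])
  ultimately show ?case by (simp add: algebra_simps)
qed simp

lemma clift_has_sum:
  assumes "\<And>i. i < n \<Longrightarrow> k i < N"
  shows "((\<lambda>x. (clift c G ^^ m) (\<lambda>k. slater k x) k * slater (\<lambda>i. i) x) has_sum
           (fact n * (clift c G ^^ m) vac k)) \<Omega>"
  using assms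
proof (induction m arbitrary: k)
  case (Suc m)
  let ?F = "\<lambda>x. (clift c G ^^ m) (\<lambda>k. slater k x)" and ?V = "(clift c G ^^ m) vac"
  have "((\<lambda>x. lift G (?F x) k * slater (\<lambda>i. i) x) has_sum (fact n * lift G ?V k)) \<Omega>"
    using Suc.prems by (intro lift_has_sum Suc.IH) auto
  moreover have "((\<lambda>x. (- c) * (?F x k * slater (\<lambda>i. i) x)) has_sum ((- c) * (fact n * ?V k))) \<Omega>"
    using Suc by (intro has_sum_cmult_right) auto
  ultimately have "((\<lambda>x. lift G (?F x) k * slater (\<lambda>i. i) x + (- c) * (?F x k * slater (\<lambda>i. i) x))
      has_sum (fact n * lift G ?V k + (- c) * (fact n * ?V k))) \<Omega>"
    by (rule has_sum_add)
  moreover have "(clift c G ^^ Suc m) F k = lift G ((clift c G ^^ m) F) k + (- c) * (clift c G ^^ m) F k"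
    for F
    by (simp add: clift_def[of c G "(clift c G ^^ m) F" k])
  ultimately show ?case by (simp only: distrib_left distrib_right mult_ac)
qed (simp del: One_nat_def add: slater_has_sum)

text \<open>The same iterated lift is evaluated twice: on Slater determinants it multiplies by the
  power of the centred statistic, and its overlap with the sea is the iterated lift of
  \<open>vac\<close>.\<close>

lemma centered_moment:
  assumes band: "banded b G" "n + m * b \<le> N"
    and G: "\<And>j y. j + b < N \<Longrightarrow> y \<in> L \<Longrightarrow> g y * \<phi> j y = (\<Sum>l<N. G l j * \<phi> l y)"
  shows "has_bochner_integral (measure_pmf P) (\<lambda>x. (stat g x - c) ^ m)
           ((clift c G ^^ m) vac (\<lambda>i. i))"
proof (rule has_bochner_integral_P)
  have "((\<lambda>x. (clift c G ^^ m) (\<lambda>k. slater k x) (\<lambda>i. i) * slater (\<lambda>i. i) x) has_sum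
           (fact n * (clift c G ^^ m) vac (\<lambda>i. i))) \<Omega>"
    using n_le_N by (intro clift_has_sum) auto
  then show "((\<lambda>x. (slater (\<lambda>i. i) x)\<^sup>2 * (stat g x - c) ^ m) has_sum
           (fact n * (clift c G ^^ m) vac (\<lambda>i. i))) \<Omega>"
  proof (rule has_sum_cong[THEN iffD1, rotated])
    fix x assume x: "x \<in> \<Omega>"
    have "(clift c G ^^ m) (\<lambda>k. slater k x) (\<lambda>i. i) = (stat g x - c) ^ m * slater (\<lambda>i. i) x"
      using band(2) by (intro clift_slater[OF band(1) G] x) auto
    then show "(clift c G ^^ m) (\<lambda>k. slater k x) (\<lambda>i. i) * slater (\<lambda>i. i) x =
        (slater (\<lambda>i. i) x)\<^sup>2 * (stat g x - c) ^ m"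
      by (simp add: power2_eq_square)
  qed
qed

section \<open>Mean and variance of general statistics\<close>

definition gram :: "('a \<Rightarrow> real) \<Rightarrow> nat \<Rightarrow> nat \<Rightarrow> real" where
  "gram u i j = infsum (\<lambda>y. u y * (\<phi> i y * \<phi> j y)) L"

lemma gram_has_sum:
  assumes "\<And>i. i < n \<Longrightarrow> (\<lambda>y. \<bar>u y\<bar> * (\<phi> i y)\<^sup>2) summable_on L" "i < n" "j < n"
  shows "((\<lambda>y. u y * (\<phi> i y * \<phi> j y)) has_sum gram u i j) L"
  unfolding gram_def
proof (rule has_sum_infsum, rule has_sum_abs_le)
  show "(\<lambda>y. \<bar>u y\<bar> * (\<phi> i y)\<^sup>2 + \<bar>u y\<bar> * (\<phi> j y)\<^sup>2) summable_on L"
    by (intro summable_on_add assms)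
  fix y
  have "\<bar>\<phi> i y * \<phi> j y\<bar> \<le> (\<phi> i y)\<^sup>2 + (\<phi> j y)\<^sup>2"
    using sum_squares_bound[of "\<bar>\<phi> i y\<bar>" "\<bar>\<phi> j y\<bar>"] abs_ge_zero[of "\<phi> i y * \<phi> j y"]
    unfolding abs_mult power2_abs by linarith
  then have "\<bar>u y\<bar> * \<bar>\<phi> i y * \<phi> j y\<bar> \<le> \<bar>u y\<bar> * ((\<phi> i y)\<^sup>2 + (\<phi> j y)\<^sup>2)"
    by (rule mult_left_mono) simp
  then show "\<bar>u y * (\<phi> i y * \<phi> j y)\<bar> \<le> \<bar>u y\<bar> * (\<phi> i y)\<^sup>2 + \<bar>u y\<bar> * (\<phi> j y)\<^sup>2"
    by (simp add: abs_mult algebra_simps)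
qed

lemma stat_slater:
  "stat u x * slater (\<lambda>i. i) x =
     (\<Sum>i<n. detn n (\<lambda>a j. (\<phi>(i := (\<lambda>y. u y * \<phi> i y))) a (x (Suc j))))"
proof -
  let ?h = "\<lambda>a j. \<phi> a (x (Suc j))"
  have "stat u x * slater (\<lambda>i. i) x = (\<Sum>i<n. detn n (?h(i := \<lambda>j. u (x (Suc j)) * ?h i j)))"
    unfolding stat_def slater_def by (rule detn_scale_columns_sum[symmetric])
  also have "\<dots> = (\<Sum>i<n. detn n (\<lambda>a j. (\<phi>(i := (\<lambda>y. u y * \<phi> i y))) a (x (Suc j))))"
    by (intro sum.cong refl detn_cong) auto
  finally show ?thesis .
qed

lemma mean_stat:
  assumes "\<And>i. i < n \<Longrightarrow> (\<lambda>y. \<bar>u y\<bar> * (\<phi> i y)\<^sup>2) summable_on L"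
  shows "has_bochner_integral (measure_pmf P) (stat u) (\<Sum>i<n. gram u i i)"
proof (rule has_bochner_integral_P)
  have "((\<lambda>x. detn n (\<lambda>a j. (\<phi>(i := (\<lambda>y. u y * \<phi> i y))) a (x (Suc j))) * slater (\<lambda>i. i) x)
      has_sum (fact n * gram u i i)) \<Omega>" if i: "i < n" for i
  proof -
    define M where "M = (\<lambda>a b. if a = i then gram u i b else if a = b then 1 else 0 :: real)"
    have "((\<lambda>x. detn n (\<lambda>a j. (\<phi>(i := (\<lambda>y. u y * \<phi> i y))) a (x (Suc j))) *
        detn n (\<lambda>a j. \<phi> a (x (Suc j)))) has_sum (fact n * detn n M)) \<Omega>"
    proof (rule andreief[where g = \<phi>])
      fix a c assume ac: "a < n" "c < n"
      show "((\<lambda>y. (\<phi>(i := (\<lambda>y. u y * \<phi> i y))) a y * \<phi> c y) has_sum M a c) L"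
        using gram_has_sum[OF assms i ac(2)] orth[of a c] ac n_le_N by (auto simp: M_def mult_ac)
    qed
    moreover have "detn n M = gram u i i"
    proof -
      have "detn n M = detn n ((\<lambda>a b. if a = b then 1 else 0)(i := (\<lambda>j. \<Sum>l\<in>{..<n}. gram u i l * (if l
        = j then 1 else 0))))"
        by (intro detn_cong) (auto simp: M_def if_distrib cong: if_cong)
      also have "\<dots> = (\<Sum>l\<in>{..<n}. gram u i l * detn n ((\<lambda>a b. if a = b then 1 else 0)(i := (\<lambda>j. if l
        = j then 1 else 0))))"
        by (rule detn_row_sum[OF i])
      also have "\<dots> = (\<Sum>l\<in>{i}. gram u i l * detn n ((\<lambda>a b. if a = b then 1 else 0)(i := (\<lambda>j. if l
        = j then 1 else 0))))"
      proof (intro sum.mono_neutral_right ballI)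
        fix l assume "l \<in> {..<n} - {i}"
        then have "detn n ((\<lambda>a b. if a = b then 1 else 0)(i := (\<lambda>j. if l = j then 1 else 0))) = 0"
          using i by (intro detn_equal_rows[of i n l]) auto
        then show "gram u i l * detn n ((\<lambda>a b. if a = b then 1 else 0)(i := (\<lambda>j. if l
          = j then 1 else 0))) = 0"
          by simp
      qed (use i in auto)
      also have "\<dots> = gram u i i * detn n (\<lambda>a b. if a = b then 1 else 0)"
        by (simp add: fun_upd_idem)
      also have "detn n (\<lambda>a b. if a = b then 1 else 0) = 1"
        by (subst detn_diagonal) auto
      finally show ?thesis by simp
    qed
    ultimately show ?thesis by (simp add: slater_def)
  qed
  then have "((\<lambda>x. \<Sum>i<n. detn n (\<lambda>a j. (\<phi>(i := (\<lambda>y. u y * \<phi> i y))) a (x (Suc j))) * slater (\<lambda>i. i) x)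
      has_sum (\<Sum>i<n. fact n * gram u i i)) \<Omega>"
    by (intro has_sum_sum_fun) auto
  then show "((\<lambda>x. (slater (\<lambda>i. i) x)\<^sup>2 * stat u x) has_sum (fact n * (\<Sum>i<n. gram u i i))) \<Omega>"
    unfolding sum_distrib_right[symmetric] stat_slater[symmetric] sum_distrib_left[symmetric]
    by (simp only: power2_eq_square mult_ac)
qed

lemma phi_square_summable: "i < n \<Longrightarrow> (\<lambda>y. (\<phi> i y)\<^sup>2) summable_on L"
  using orth[of i i] n_le_N has_sum_imp_summable[of "\<lambda>y. \<phi> i y * \<phi> i y"] by (simp add: power2_eq_square)

lemma summable_abs_of_square:
  assumes u2: "(\<lambda>y. (u y)\<^sup>2 * (\<phi> i y)\<^sup>2) summable_on L" and i: "i < n"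
  shows "(\<lambda>y. \<bar>u y\<bar> * (\<phi> i y)\<^sup>2) summable_on L"
proof (rule has_sum_abs_le)
  show "(\<lambda>y. (u y)\<^sup>2 * (\<phi> i y)\<^sup>2 + (\<phi> i y)\<^sup>2) summable_on L"
    by (intro summable_on_add u2 phi_square_summable i)
  fix y
  have "\<bar>u y\<bar> \<le> (u y)\<^sup>2 + 1"
    using sum_squares_bound[of "\<bar>u y\<bar>" 1] by simp
  then have "\<bar>u y\<bar> * (\<phi> i y)\<^sup>2 \<le> ((u y)\<^sup>2 + 1) * (\<phi> i y)\<^sup>2"
    by (rule mult_right_mono) simp
  then show "\<bar>\<bar>u y\<bar> * (\<phi> i y)\<^sup>2\<bar> \<le> (u y)\<^sup>2 * (\<phi> i y)\<^sup>2 + (\<phi> i y)\<^sup>2"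
    by (simp add: algebra_simps)
qed

text \<open>The centred statistic times the sea is a sum of determinants \<open>A i\<close> in which
  \<open>\<phi> i\<close> is replaced by \<open>\<alpha> i\<close>, the part of
  \<open>u * \<phi> i\<close> orthogonal to all filled levels. These are mutually orthogonal, so the
  variance is the sum of the squared norms of the \<open>\<alpha> i\<close>.\<close>

lemma variance_stat:
  assumes u2: "\<And>i. i < n \<Longrightarrow> (\<lambda>y. (u y)\<^sup>2 * (\<phi> i y)\<^sup>2) summable_on L"
  shows "has_bochner_integral (measure_pmf P) (\<lambda>x. (stat u x - (\<Sum>i<n. gram u i i))\<^sup>2)
           ((\<Sum>i<n. gram (\<lambda>y. (u y)\<^sup>2) i i) - (\<Sum>i<n. \<Sum>j<n. (gram u i j)\<^sup>2))"
proof (rule has_bochner_integral_P)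
  note gs = gram_has_sum[OF summable_abs_of_square[OF u2]]
  define \<alpha> where "\<alpha> = (\<lambda>i y. u y * \<phi> i y - (\<Sum>l<n. gram u i l * \<phi> l y))"
  define A where "A = (\<lambda>i x. detn n (\<lambda>a j. (\<phi>(i := \<alpha> i)) a (x (Suc j))))"
  have orth\<alpha>: "((\<lambda>y. \<alpha> i y * \<phi> j y) has_sum 0) L" if "i < n" "j < n" for i j
  proof -
    have "((\<lambda>y. u y * (\<phi> i y * \<phi> j y) + (-1) * (\<Sum>l<n. gram u i l * (\<phi> l y * \<phi> j y))) has_sum
       (gram u i j + (-1) * (\<Sum>l<n. gram u i l * (if l = j then 1 else 0)))) L"
      by (intro has_sum_add has_sum_sum_fun has_sum_cmult_right gs orth that) (use that n_le_N in auto)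
    moreover have "gram u i j + (-1) * (\<Sum>l<n. gram u i l * (if l = j then 1 else 0)) = 0"
      using that by (simp add: if_distrib cong: if_cong)
    ultimately show ?thesis
      by (simp add: \<alpha>_def algebra_simps sum_distrib_left sum_negf)
  qed
  define s where "s = (\<lambda>i. gram (\<lambda>y. (u y)\<^sup>2) i i - (\<Sum>j<n. (gram u i j)\<^sup>2))"
  have norm\<alpha>: "((\<lambda>y. \<alpha> i y * \<alpha> i y) has_sum s i) L" if i: "i < n" for i
  proof -
    have "((\<lambda>y. (u y)\<^sup>2 * (\<phi> i y * \<phi> i y)) has_sum gram (\<lambda>y. (u y)\<^sup>2) i i) L"
      using u2 i by (intro gram_has_sum) auto
    then have "((\<lambda>y. (u y)\<^sup>2 * (\<phi> i y * \<phi> i y) + (-1) * (\<Sum>l<n. gram u i l * (u y * (\<phi> i y * \<phi> l y)))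
        + (-1) * (\<Sum>l<n. gram u i l * (\<alpha> i y * \<phi> l y))) has_sum
       (gram (\<lambda>y. (u y)\<^sup>2) i i + (-1) * (\<Sum>l<n. gram u i l * gram u i l)
        + (-1) * (\<Sum>l<n. gram u i l * 0))) L"
      by (intro has_sum_add has_sum_sum_fun has_sum_cmult_right gs orth\<alpha> i) auto
    moreover have "(u y)\<^sup>2 * (\<phi> i y * \<phi> i y) + (-1) * (\<Sum>l<n. gram u i l * (u y * (\<phi> i y * \<phi> l y)))
        + (-1) * (\<Sum>l<n. gram u i l * (\<alpha> i y * \<phi> l y)) = \<alpha> i y * \<alpha> i y" for y
    proof -
      let ?S = "\<Sum>l<n. gram u i l * \<phi> l y"
      have 1: "(\<Sum>l<n. gram u i l * (u y * (\<phi> i y * \<phi> l y))) = u y * \<phi> i y * ?S"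
        by (simp add: sum_distrib_left mult_ac)
      have 2: "(\<Sum>l<n. gram u i l * (\<alpha> i y * \<phi> l y)) = \<alpha> i y * ?S"
        by (simp add: sum_distrib_left mult_ac)
      show ?thesis unfolding 1 2 by (simp add: \<alpha>_def power2_eq_square algebra_simps)
    qed
    ultimately show ?thesis by (simp add: s_def power2_eq_square)
  qed
  have AA: "((\<lambda>x. A i x * A i' x) has_sum (fact n * (if i = i' then s i else 0))) \<Omega>"
    if i: "i < n" "i' < n" for i i'
  proof -
    \<comment> \<open>For \<open>i \<noteq> i'\<close> the row \<open>i'\<close> of this overlap
      matrix is zero, since \<open>\<alpha> i'\<close> is orthogonal to every filled level.\<close>
    define M where "M = (\<lambda>a c. if a = i then (if c = i' then infsum (\<lambda>y. \<alpha> i y * \<alpha> i' y) L else 0)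
       else if c = i' then 0 else if a = c then 1 else 0 :: real)"
    have \<alpha>\<alpha>: "((\<lambda>y. \<alpha> i y * \<alpha> i' y) has_sum infsum (\<lambda>y. \<alpha> i y * \<alpha> i' y) L) L"
    proof (rule has_sum_infsum, rule has_sum_abs_le)
      show "(\<lambda>y. \<alpha> i y * \<alpha> i y + \<alpha> i' y * \<alpha> i' y) summable_on L"
        using norm\<alpha> i has_sum_imp_summable by (intro summable_on_add) blast+
      show "\<bar>\<alpha> i y * \<alpha> i' y\<bar> \<le> \<alpha> i y * \<alpha> i y + \<alpha> i' y * \<alpha> i' y" for y
        using sum_squares_bound[of "\<bar>\<alpha> i y\<bar>" "\<bar>\<alpha> i' y\<bar>"] abs_ge_zero[of "\<alpha> i y * \<alpha> i' y"]
        unfolding abs_mult power2_abs power2_eq_square by (simp only: abs_mult_self_eq)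
    qed
    have "((\<lambda>x. A i x * A i' x) has_sum (fact n * detn n M)) \<Omega>"
      unfolding A_def
    proof (rule andreief)
      fix a c assume ac: "a < n" "c < n"
      show "((\<lambda>y. (\<phi>(i := \<alpha> i)) a y * (\<phi>(i' := \<alpha> i')) c y) has_sum M a c) L"
        using \<alpha>\<alpha> orth\<alpha>[OF i(1) ac(2)] orth\<alpha>[OF i(2) ac(1)] orth[of a c] ac n_le_N
        by (auto simp: M_def mult.commute)
    qed
    moreover have "detn n M = (if i = i' then s i else 0)"
    proof (cases "i = i'")
      case True
      have "detn n M = (\<Prod>a<n. M a a)" using True by (intro detn_diagonal) (auto simp: M_def)
      also have "\<dots> = (\<Prod>a\<in>{..<n}. if a = i then s i else 1)"
        using norm\<alpha>[OF i(1)] True by (intro prod.cong) (auto simp: M_def infsumI)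
      finally show ?thesis using i True by simp
    next
      case False
      then have "detn n M = 0"
        using i by (intro detn_zero_row[of i']) (auto simp: M_def)
      then show ?thesis using False by simp
    qed
    ultimately show ?thesis by simp
  qed
  have dec: "(stat u x - (\<Sum>i<n. gram u i i)) * slater (\<lambda>i. i) x = (\<Sum>i<n. A i x)" for x
  proof -
    let ?h = "\<lambda>a j. \<phi> a (x (Suc j))"
    have "detn n (\<lambda>a j. (\<phi>(i := (\<lambda>y. u y * \<phi> i y))) a (x (Suc j))) =
        A i x + gram u i i * slater (\<lambda>i. i) x" if i: "i < n" for i
    proof -
      have "detn n (\<lambda>a j. (\<phi>(i := (\<lambda>y. u y * \<phi> i y))) a (x (Suc j))) =
         detn n (?h(i := (\<lambda>j. \<alpha> i (x (Suc j)) + (\<Sum>l<n. gram u i l * ?h l j))))"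
        by (intro detn_cong) (auto simp: \<alpha>_def)
      also have "\<dots> = detn n (?h(i := (\<lambda>j. \<alpha> i (x (Suc j))))) + (\<Sum>l<n. gram u i l * detn n (?h(i := ?h l)))"
        by (simp only: detn_row_add[OF i] detn_row_sum[OF i])
      also have "(\<Sum>l<n. gram u i l * detn n (?h(i := ?h l))) = (\<Sum>l\<in>{i}. gram u i l * detn n (?h(i := ?h l)))"
      proof (intro sum.mono_neutral_right ballI)
        fix l assume "l \<in> {..<n} - {i}"
        then have "detn n (?h(i := ?h l)) = 0"
          using i by (intro detn_equal_rows[of i n l]) auto
        then show "gram u i l * detn n (?h(i := ?h l)) = 0" by simp
      qed (use i in auto)
      also have "detn n (?h(i := (\<lambda>j. \<alpha> i (x (Suc j))))) = A i x"
        unfolding A_def by (intro detn_cong) auto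
      also have "(\<Sum>l\<in>{i}. gram u i l * detn n (?h(i := ?h l))) = gram u i i * detn n (?h(i := ?h i))"
        by (subst sum.insert) auto
      also have "?h(i := ?h i) = ?h" by (rule fun_upd_triv)
      finally show ?thesis unfolding slater_def .
    qed
    then show ?thesis
      by (simp add: left_diff_distrib stat_slater sum.distrib sum_distrib_right)
  qed
  have "((\<lambda>x. \<Sum>i<n. \<Sum>i'<n. A i x * A i' x) has_sum
      (\<Sum>i<n. \<Sum>i'<n. fact n * (if i = i' then s i else 0))) \<Omega>"
    by (intro has_sum_sum_fun AA) auto
  moreover have "(\<Sum>i<n. \<Sum>i'<n. A i x * A i' x) = (slater (\<lambda>i. i) x)\<^sup>2 * (stat u x -
    (\<Sum>i<n. gram u i i))\<^sup>2" for x
    using dec[of x] by (simp add: sum_product[symmetric] power2_eq_square mult_ac flip: dec)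
  moreover have "(\<Sum>i<n. \<Sum>i'<n. fact n * (if i = i' then s i else 0)) =
     fact n * ((\<Sum>i<n. gram (\<lambda>y. (u y)\<^sup>2) i i) - (\<Sum>i<n. \<Sum>j<n. (gram u i j)\<^sup>2))"
    by (simp add: s_def sum_subtractf sum_distrib_left[symmetric] right_diff_distrib if_distrib cong: if_cong)
  ultimately show "((\<lambda>x. (slater (\<lambda>i. i) x)\<^sup>2 * (stat u x - (\<Sum>i<n. gram u i i))\<^sup>2) has_sum
     (fact n * ((\<Sum>i<n. gram (\<lambda>y. (u y)\<^sup>2) i i) - (\<Sum>i<n. \<Sum>j<n. (gram u i j)\<^sup>2)))) \<Omega>"
    by simp
qed


definition kernel :: "'a \<Rightarrow> 'a \<Rightarrow> real" where
  "kernel x y = (\<Sum>i<n. \<phi> i x * \<phi> i y)"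

lemma kernel_has_sum:
  assumes f: "\<And>i. i < n \<Longrightarrow> (\<lambda>y. \<bar>f y\<bar> * (\<phi> i y)\<^sup>2) summable_on L"
    and g: "\<And>i. i < n \<Longrightarrow> (\<lambda>y. \<bar>g y\<bar> * (\<phi> i y)\<^sup>2) summable_on L"
  shows "((\<lambda>(x, y). f x * g y * (kernel x y)\<^sup>2) has_sum (\<Sum>i<n. \<Sum>j<n. gram f i j * gram g i j)) (L \<times> L)"
proof -
  have "((\<lambda>z. \<Sum>i<n. \<Sum>j<n. case z of (x, y) \<Rightarrow> (f x * (\<phi> i x * \<phi> j x)) * (g y * (\<phi> i y * \<phi> j y)))
      has_sum (\<Sum>i<n. \<Sum>j<n. gram f i j * gram g i j)) (L \<times> L)"
    by (intro has_sum_sum_fun has_sum_times gram_has_sum f g) auto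
  moreover have "(\<Sum>i<n. \<Sum>j<n. case z of (x, y) \<Rightarrow> (f x * (\<phi> i x * \<phi> j x)) * (g y * (\<phi> i y * \<phi> j y)))
      = (case z of (x, y) \<Rightarrow> f x * g y * (kernel x y)\<^sup>2)" for z
    by (cases z) (simp add: kernel_def power2_eq_square sum_product sum_distrib_left mult_ac)
  ultimately show ?thesis by simp
qed

lemma gram_one: "i < n \<Longrightarrow> j < n \<Longrightarrow> gram (\<lambda>_. 1) i j = (if i = j then 1 else 0)"
  unfolding gram_def using infsumI[OF orth[of i j]] n_le_N by simp

definition var_stat :: "('a \<Rightarrow> real) \<Rightarrow> real" where
  "var_stat u = (\<Sum>i<n. gram (\<lambda>y. (u y)\<^sup>2) i i) - (\<Sum>i<n. \<Sum>j<n. (gram u i j)\<^sup>2)"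

text \<open>The reproducing property: summing the squared kernel over its second argument gives its
  diagonal.\<close>

lemma kernel_has_sum_left:
  assumes f: "\<And>i. i < n \<Longrightarrow> (\<lambda>y. \<bar>f y\<bar> * (\<phi> i y)\<^sup>2) summable_on L"
  shows "((\<lambda>(x, y). f x * (kernel x y)\<^sup>2) has_sum (\<Sum>i<n. gram f i i)) (L \<times> L)"
proof -
  have "((\<lambda>(x, y). f x * 1 * (kernel x y)\<^sup>2) has_sum (\<Sum>i<n. \<Sum>j<n. gram f i j * gram (\<lambda>_. 1) i j)) (L \<times> L)"
    by (intro kernel_has_sum f) (use phi_square_summable in auto)
  moreover have "(\<Sum>i<n. \<Sum>j<n. gram f i j * gram (\<lambda>_. 1) i j) = (\<Sum>i<n. gram f i i)"
    by (simp add: gram_one if_distrib cong: if_cong)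
  ultimately show ?thesis by simp
qed

lemma kernel_commute: "kernel x y = kernel y x"
  by (simp add: kernel_def mult.commute)

lemma kernel_has_sum_right:
  assumes f: "\<And>i. i < n \<Longrightarrow> (\<lambda>y. \<bar>f y\<bar> * (\<phi> i y)\<^sup>2) summable_on L"
  shows "((\<lambda>(x, y). f y * (kernel x y)\<^sup>2) has_sum (\<Sum>i<n. gram f i i)) (L \<times> L)"
  using kernel_has_sum_left[OF f] by (subst has_sum_swap) (simp add: kernel_commute)

lemma var_stat_has_sum:
  assumes u2: "\<And>i. i < n \<Longrightarrow> (\<lambda>y. (u y)\<^sup>2 * (\<phi> i y)\<^sup>2) summable_on L"
  shows "((\<lambda>(x, y). (u x - u y)\<^sup>2 * (kernel x y)\<^sup>2) has_sum (2 * var_stat u)) (L \<times> L)"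
proof -
  note u1 = summable_abs_of_square[OF u2]
  have "((\<lambda>z. (case z of (x, y) \<Rightarrow> (u x)\<^sup>2 * (kernel x y)\<^sup>2) + (case z of (x, y) \<Rightarrow> (u y)\<^sup>2 * (kernel x y)\<^sup>2)
      + (-2) * (case z of (x, y) \<Rightarrow> u x * u y * (kernel x y)\<^sup>2)) has_sum
      ((\<Sum>i<n. gram (\<lambda>y. (u y)\<^sup>2) i i) + (\<Sum>i<n. gram (\<lambda>y. (u y)\<^sup>2) i i)
        + (-2) * (\<Sum>i<n. \<Sum>j<n. gram u i j * gram u i j))) (L \<times> L)"
    by (intro has_sum_add has_sum_cmult_right kernel_has_sum kernel_has_sum_left kernel_has_sum_right)
      (use u1 u2 in auto)
  moreover have "(case z of (x, y) \<Rightarrow> (u x)\<^sup>2 * (kernel x y)\<^sup>2) + (case z of (x, y) \<Rightarrow> (u y)\<^sup>2 * (kernel x y)\<^sup>2)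
      + (-2) * (case z of (x, y) \<Rightarrow> u x * u y * (kernel x y)\<^sup>2) =
      (case z of (x, y) \<Rightarrow> (u x - u y)\<^sup>2 * (kernel x y)\<^sup>2)" for z
    by (cases z) (simp add: power2_eq_square algebra_simps)
  ultimately show ?thesis
    by (simp add: var_stat_def power2_eq_square algebra_simps)
qed

lemma variance_eq:
  assumes u2: "\<And>i. i < n \<Longrightarrow> (\<lambda>y. (u y)\<^sup>2 * (\<phi> i y)\<^sup>2) summable_on L"
  shows "integrable (measure_pmf P) (stat u)"
    "integrable (measure_pmf P) (\<lambda>x. (stat u x - measure_pmf.expectation P (stat u))\<^sup>2)"
    "measure_pmf.expectation P (\<lambda>x. (stat u x - measure_pmf.expectation P (stat u))\<^sup>2) = var_stat u"
  using mean_stat[of u] summable_abs_of_square[OF u2] variance_stat[OF u2]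
  by (auto simp: has_bochner_integral_iff var_stat_def)

text \<open>Pairs inside \<open>S\<close> obey the Lipschitz bound. For other pairs the squared
  difference is at most twice the sum of the squares; if one point lies in \<open>S\<close>, its
  square is at most \<open>B\<^sup>2\<close> and is charged to the point outside. Summing over the
  second point then leaves expectations of one-point statistics.\<close>

lemma variance_lipschitz_bound:
  fixes S :: "'a set"
  assumes u2: "\<And>i. i < n \<Longrightarrow> (\<lambda>y. (u y)\<^sup>2 * (\<phi> i y)\<^sup>2) summable_on L"
    and v2: "\<And>i. i < n \<Longrightarrow> (\<lambda>y. (v y)\<^sup>2 * (\<phi> i y)\<^sup>2) summable_on L"
    and lip: "\<And>x y. x \<in> L \<Longrightarrow> y \<in> L \<Longrightarrow> x \<in> S \<Longrightarrow> y \<in> S \<Longrightarrow> \<bar>u x - u y\<bar> \<le> c * \<bar>v x - v y\<bar>"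
    and bnd: "\<And>x. x \<in> L \<Longrightarrow> x \<in> S \<Longrightarrow> \<bar>u x\<bar> \<le> B"
  shows "var_stat u \<le> c\<^sup>2 * var_stat v
     + 4 * measure_pmf.expectation P (stat (\<lambda>y. (u y)\<^sup>2 * indicator (- S) y))
     + 2 * B\<^sup>2 * measure_pmf.expectation P (stat (indicator (- S)))"
proof -
  let ?U = "\<lambda>y. (u y)\<^sup>2 * indicator (- S) y :: real" and ?I = "indicator (- S) :: 'a \<Rightarrow> real"
  have U: "(\<lambda>y. \<bar>?U y\<bar> * (\<phi> i y)\<^sup>2) summable_on L" if "i < n" for i
    by (rule has_sum_abs_le[OF u2[OF that]]) (auto simp: indicator_def)
  have I: "(\<lambda>y. \<bar>?I y\<bar> * (\<phi> i y)\<^sup>2) summable_on L" if "i < n" for i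
    by (rule has_sum_abs_le[OF phi_square_summable[OF that]]) (auto simp: indicator_def)
  let ?gU = "\<Sum>i<n. gram ?U i i" and ?gI = "\<Sum>i<n. gram ?I i i"
  have eU: "measure_pmf.expectation P (stat ?U) = ?gU" and eI: "measure_pmf.expectation P (stat ?I) = ?gI"
    using mean_stat[OF U] mean_stat[OF I] by (auto simp: has_bochner_integral_iff)
  have "2 * var_stat u \<le> c\<^sup>2 * (2 * var_stat v) + 4 * ?gU + 4 * ?gU + 2 * B\<^sup>2 * ?gI + 2 * B\<^sup>2 * ?gI"
  proof (rule has_sum_mono)
    show "((\<lambda>z. c\<^sup>2 * (case z of (x, y) \<Rightarrow> (v x - v y)\<^sup>2 * (kernel x y)\<^sup>2)
       + 4 * (case z of (x, y) \<Rightarrow> ?U x * (kernel x y)\<^sup>2) + 4 * (case z of (x, y) \<Rightarrow> ?U y * (kernel x y)\<^sup>2)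
       + 2 * B\<^sup>2 * (case z of (x, y) \<Rightarrow> ?I x * (kernel x y)\<^sup>2)
       + 2 * B\<^sup>2 * (case z of (x, y) \<Rightarrow> ?I y * (kernel x y)\<^sup>2)) has_sum
       (c\<^sup>2 * (2 * var_stat v) + 4 * ?gU + 4 * ?gU + 2 * B\<^sup>2 * ?gI + 2 * B\<^sup>2 * ?gI)) (L \<times> L)"
      by (intro has_sum_add has_sum_cmult_right kernel_has_sum_left kernel_has_sum_right U I
          var_stat_has_sum v2)
    show "((\<lambda>(x, y). (u x - u y)\<^sup>2 * (kernel x y)\<^sup>2) has_sum (2 * var_stat u)) (L \<times> L)"
      by (rule var_stat_has_sum[OF u2])
    fix z assume "z \<in> L \<times> L"
    then obtain x y where z: "z = (x, y)" "x \<in> L" "y \<in> L" by auto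
    have par: "(u x - u y)\<^sup>2 \<le> 2 * (u x)\<^sup>2 + 2 * (u y)\<^sup>2"
      using zero_le_power2[of "u x + u y"] by (simp add: power2_eq_square algebra_simps)
    have sq: "(u a)\<^sup>2 \<le> B\<^sup>2" if "a \<in> L" "a \<in> S" for a
      using bnd[OF that] by (metis abs_ge_zero power2_abs power_mono)
    have "(u x - u y)\<^sup>2 \<le> c\<^sup>2 * (v x - v y)\<^sup>2 + 4 * ?U x + 4 * ?U y + 2 * B\<^sup>2 * ?I x + 2 * B\<^sup>2 * ?I y"
    proof (cases "x \<in> S \<and> y \<in> S")
      case True
      have "(u x - u y)\<^sup>2 \<le> (c * \<bar>v x - v y\<bar>)\<^sup>2"
        using lip[of x y] z True by (metis abs_ge_zero power2_abs power_mono)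
      then show ?thesis using True by (simp add: power_mult_distrib)
    next
      case False
      have "0 \<le> c\<^sup>2 * (v x - v y)\<^sup>2" "0 \<le> (u x)\<^sup>2" "0 \<le> (u y)\<^sup>2" "0 \<le> B\<^sup>2" by auto
      then show ?thesis using False par sq[of x] sq[of y] z
        by (cases "x \<in> S"; cases "y \<in> S"; simp; linarith)
    qed
    then have "(u x - u y)\<^sup>2 * (kernel x y)\<^sup>2 \<le>
       (c\<^sup>2 * (v x - v y)\<^sup>2 + 4 * ?U x + 4 * ?U y + 2 * B\<^sup>2 * ?I x + 2 * B\<^sup>2 * ?I y) * (kernel x y)\<^sup>2"
      by (rule mult_right_mono) simp
    then show "(case z of (x, y) \<Rightarrow> (u x - u y)\<^sup>2 * (kernel x y)\<^sup>2) \<le>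
       c\<^sup>2 * (case z of (x, y) \<Rightarrow> (v x - v y)\<^sup>2 * (kernel x y)\<^sup>2)
       + 4 * (case z of (x, y) \<Rightarrow> ?U x * (kernel x y)\<^sup>2) + 4 * (case z of (x, y) \<Rightarrow> ?U y * (kernel x y)\<^sup>2)
       + 2 * B\<^sup>2 * (case z of (x, y) \<Rightarrow> ?I x * (kernel x y)\<^sup>2)
       + 2 * B\<^sup>2 * (case z of (x, y) \<Rightarrow> ?I y * (kernel x y)\<^sup>2)"
      unfolding z by (simp add: algebra_simps)
  qed
  then show ?thesis unfolding eU eI by simp
qed

text \<open>\<open>mean_stat\<close> presupposes summability. It is therefore applied to
  restrictions of \<open>v\<close> to finite sets, whose means are bounded by that of
  \<open>v\<close> and dominate each level separately.\<close>

lemma summable_of_finite_mean: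
  assumes v: "\<And>y. 0 \<le> v y" and fin: "(\<integral>\<^sup>+x. ennreal (stat v x) \<partial>measure_pmf P) < \<infinity>" and i: "i < n"
  shows "(\<lambda>y. v y * (\<phi> i y)\<^sup>2) summable_on L"
proof (rule nonneg_bdd_above_summable_on)
  show "bdd_above (sum (\<lambda>y. v y * (\<phi> i y)\<^sup>2) ` {F. F \<subseteq> L \<and> finite F})"
  proof (rule bdd_aboveI2)
    fix F assume "F \<in> {F. F \<subseteq> L \<and> finite F}"
    then have F: "F \<subseteq> L" "finite F" by auto
    define w where "w = (\<lambda>y. v y * indicator F y)"
    have "((\<lambda>y. \<bar>w y\<bar> * (\<phi> j y)\<^sup>2) has_sum (\<Sum>y\<in>F. \<bar>w y\<bar> * (\<phi> j y)\<^sup>2)) L" for j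
      by (rule has_sum_finite_neutralI[OF F(2,1)]) (auto simp: w_def)
    then have ws: "(\<lambda>y. \<bar>w y\<bar> * (\<phi> j y)\<^sup>2) summable_on L" for j
      by (rule has_sum_imp_summable)
    have "((\<lambda>y. w y * (\<phi> j y * \<phi> j y)) has_sum (\<Sum>y\<in>F. v y * (\<phi> j y)\<^sup>2)) L" for j
      by (rule has_sum_finite_neutralI[OF F(2,1)]) (auto simp: w_def power2_eq_square)
    then have g: "gram w j j = (\<Sum>y\<in>F. v y * (\<phi> j y)\<^sup>2)" for j
      unfolding gram_def by (rule infsumI)
    have m: "has_bochner_integral (measure_pmf P) (stat w) (\<Sum>j<n. gram w j j)"
      by (rule mean_stat[OF ws])
    have g0: "0 \<le> gram w j j" for j unfolding g by (intro sum_nonneg) (simp add: v)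
    have w0: "0 \<le> w y" "w y \<le> v y" for y using v[of y] by (auto simp: w_def indicator_def)
    have "ennreal (\<Sum>j<n. gram w j j) = (\<integral>\<^sup>+x. ennreal (stat w x) \<partial>measure_pmf P)"
      using m by (subst nn_integral_eq_integral)
        (auto simp: has_bochner_integral_iff stat_def intro!: sum_nonneg w0 AE_I2)
    also have "\<dots> \<le> (\<integral>\<^sup>+x. ennreal (stat v x) \<partial>measure_pmf P)"
      by (intro nn_integral_mono ennreal_leI) (auto simp: stat_def intro!: sum_mono w0)
    finally have "enn2real (ennreal (\<Sum>j<n. gram w j j)) \<le> enn2real (\<integral>\<^sup>+x. ennreal (stat v x) \<partial>measure_pmf P)"
      using fin by (intro enn2real_mono) auto
    moreover have "0 \<le> (\<Sum>j<n. gram w j j)" by (intro sum_nonneg g0)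
    ultimately have "(\<Sum>j<n. gram w j j) \<le> enn2real (\<integral>\<^sup>+x. ennreal (stat v x) \<partial>measure_pmf P)"
      by simp
    moreover have "gram w i i \<le> (\<Sum>j<n. gram w j j)"
      by (rule member_le_sum) (use i g0 in auto)
    ultimately show "sum (\<lambda>y. v y * (\<phi> i y)\<^sup>2) F \<le> enn2real (\<integral>\<^sup>+x. ennreal (stat v x) \<partial>measure_pmf P)"
      unfolding g by linarith
  qed
qed (simp add: v)

end

section \<open>Jacobi matrices and their limiting symbol\<close>

text \<open>The entry \<open>(l, k)\<close> of the \<open>j\<close>-th power of the infinite Jacobi
  matrix. Multiplying by the tridiagonal matrix on the left keeps every sum finite without
  truncation.\<close>

fun jacobi_power :: "(nat \<Rightarrow> real) \<Rightarrow> (nat \<Rightarrow> real) \<Rightarrow> nat \<Rightarrow> mtx" where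
  "jacobi_power a b 0 l k = (if l = k then 1 else 0)"
| "jacobi_power a b (Suc j) l k =
     (if l = 0 then 0 else a (l - 1) * jacobi_power a b j (l - 1) k)
     + b l * jacobi_power a b j l k + a l * jacobi_power a b j (l + 1) k"

definition jacobi_poly :: "(nat \<Rightarrow> real) \<Rightarrow> (nat \<Rightarrow> real) \<Rightarrow> real poly \<Rightarrow> mtx" where
  "jacobi_poly a b q l k = (\<Sum>j\<le>degree q. coeff q j * jacobi_power a b j l k)"

lemma jacobi_power_band:
  "jacobi_power a b j l k \<noteq> 0 \<Longrightarrow> l \<le> k + j \<and> k \<le> l + j"
proof (induction j arbitrary: l)
  case (Suc j)
  show ?case
  proof (rule ccontr)
    assume far: "\<not> (l \<le> k + Suc j \<and> k \<le> l + Suc j)"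
    have "jacobi_power a b j l k = 0" using Suc.IH[of l] far by fastforce
    moreover have "jacobi_power a b j (l + 1) k = 0" using Suc.IH[of "l + 1"] far by fastforce
    moreover have "l = 0 \<or> jacobi_power a b j (l - 1) k = 0" using Suc.IH[of "l - 1"] far by fastforce
    ultimately show False using Suc.prems by (auto split: if_splits)
  qed
qed (auto split: if_splits)

lemma banded_jacobi_poly: "levels.banded (degree q) (jacobi_poly a b q)"
proof -
  have "l \<le> k + degree q \<and> k \<le> l + degree q" if nz: "jacobi_poly a b q l k \<noteq> 0" for l k
  proof -
    obtain j where "j \<le> degree q" "coeff q j * jacobi_power a b j l k \<noteq> 0"
      using nz unfolding jacobi_poly_def by (metis
        (no_types, lifting) atMost_iff sum.not_neutral_contains_not_neutral)
    then show ?thesis using jacobi_power_band[of a b j l k] by auto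
  qed
  then show ?thesis by (auto simp: levels.banded_def[OF levels.intro[OF order_refl]])
qed

lemma jacobi_power_apply:
  fixes \<phi> :: "nat \<Rightarrow> real" and t :: real
  assumes rec: "\<And>i. i + 1 < N \<Longrightarrow>
      t * \<phi> i = a i * \<phi> (i + 1) + b i * \<phi> i + (if i = 0 then 0 else a (i - 1) * \<phi> (i - 1))"
  shows "k + j < N \<Longrightarrow> t ^ j * \<phi> k = (\<Sum>l<N. jacobi_power a b j l k * \<phi> l)"
proof (induction j)
  case 0
  then show ?case by (simp add: if_distrib[of "\<lambda>x. x * _"] cong: if_cong)
next
  case (Suc j)
  let ?g = "\<lambda>l. jacobi_power a b j l k"
  obtain M where M: "N = Suc M" using Suc.prems by (cases N) auto
  \<comment> \<open>The recurrence is available below the last level only; the band condition kills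
    the coefficient exactly where it is missing.\<close>
  have z: "?g l = 0" if "M \<le> l" for l
    using jacobi_power_band[of a b j l k] that Suc.prems M by fastforce
  have "t ^ Suc j * \<phi> k = (\<Sum>l<N. ?g l * (t * \<phi> l))"
    using Suc by (simp add: sum_distrib_left mult_ac)
  also have "\<dots> = (\<Sum>l<N. ?g l * (a l * \<phi> (l + 1) + b l * \<phi> l + (if l = 0 then 0 else a (l - 1) * \<phi> (l - 1))))"
  proof (intro sum.cong refl)
    fix l assume "l \<in> {..<N}"
    show "?g l * (t * \<phi> l) = ?g l * (a l * \<phi> (l + 1) + b l * \<phi> l + (if l = 0 then 0 else a (l - 1) * \<phi> (l
      - 1)))"
    proof (cases "l < M")
      case True then show ?thesis using rec[of l] M by simp
    next
      case False then show ?thesis using z[of l] by simp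
    qed
  qed
  also have "\<dots> = (\<Sum>l<N. ?g l * a l * \<phi> (Suc l)) + (\<Sum>l<N. ?g l * b l * \<phi> l)
      + (\<Sum>l<N. if l = 0 then 0 else ?g l * a (l - 1) * \<phi> (l - 1))"
    unfolding sum.distrib[symmetric] by (intro sum.cong refl) (simp add: algebra_simps)
  also have "(\<Sum>l<N. ?g l * a l * \<phi> (Suc l)) = (\<Sum>l<N. if l = 0 then 0 else ?g (l - 1) * a (l - 1) * \<phi> l)"
    unfolding M by (subst (2) sum.lessThan_Suc_shift) (simp add: z)
  also have "(\<Sum>l<N. if l = 0 then 0 else ?g l * a (l - 1) * \<phi> (l - 1)) = (\<Sum>l<N. ?g (l + 1) * a l * \<phi> l)"
    unfolding M by (subst sum.lessThan_Suc_shift) (simp add: z)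
  also have "(\<Sum>l<N. if l = 0 then 0 else ?g (l - 1) * a (l - 1) * \<phi> l) + (\<Sum>l<N. ?g l * b l * \<phi> l)
      + (\<Sum>l<N. ?g (l + 1) * a l * \<phi> l) = (\<Sum>l<N. jacobi_power a b (Suc j) l k * \<phi> l)"
    unfolding sum.distrib[symmetric] by (intro sum.cong refl) (simp add: algebra_simps)
  finally show ?case .
qed

lemma jacobi_poly_apply:
  fixes \<phi> :: "nat \<Rightarrow> real" and t :: real
  assumes rec: "\<And>i. i + 1 < N \<Longrightarrow>
      t * \<phi> i = a i * \<phi> (i + 1) + b i * \<phi> i + (if i = 0 then 0 else a (i - 1) * \<phi> (i - 1))"
    and k: "k + degree q < N"
  shows "poly q t * \<phi> k = (\<Sum>l<N. jacobi_poly a b q l k * \<phi> l)"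
proof -
  have "poly q t * \<phi> k = (\<Sum>j\<le>degree q. coeff q j * (t ^ j * \<phi> k))"
    by (simp add: poly_altdef sum_distrib_right mult.assoc)
  also have "\<dots> = (\<Sum>j\<le>degree q. coeff q j * (\<Sum>l<N. jacobi_power a b j l k * \<phi> l))"
    using k by (intro sum.cong refl) (simp add: jacobi_power_apply[where a = a and b = b, OF rec])
  also have "\<dots> = (\<Sum>l<N. jacobi_poly a b q l k * \<phi> l)"
    unfolding jacobi_poly_def sum_distrib_left sum_distrib_right
    by (subst sum.swap) (simp add: mult.assoc)
  finally show ?thesis .
qed

text \<open>The Fourier coefficients of the \<open>j\<close>-th power of 2 \<alpha> cos \<theta> +
  \<beta>, generated by the index shifts that the two exponentials of the cosine produce.\<close>

fun symbol_power :: "real \<Rightarrow> real \<Rightarrow> nat \<Rightarrow> int \<Rightarrow> real" where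
  "symbol_power \<alpha> \<beta> 0 d = (if d = 0 then 1 else 0)"
| "symbol_power \<alpha> \<beta> (Suc j) d =
     \<alpha> * symbol_power \<alpha> \<beta> j (d - 1) + \<beta> * symbol_power \<alpha> \<beta> j d + \<alpha> * symbol_power \<alpha> \<beta> j (d + 1)"

definition symbol_poly :: "real \<Rightarrow> real \<Rightarrow> real poly \<Rightarrow> int \<Rightarrow> real" where
  "symbol_poly \<alpha> \<beta> q d = (\<Sum>j\<le>degree q. coeff q j * symbol_power \<alpha> \<beta> j d)"

lemma symbol_power_uminus: "symbol_power \<alpha> \<beta> j (- d) = symbol_power \<alpha> \<beta> j d"
proof (induction j arbitrary: d)
  case (Suc j)
  have "- d - 1 = - (d + 1)" "- d + 1 = - (d - 1)" by auto
  then show ?case by (simp only: symbol_power.simps Suc)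
qed auto

lemma symbol_power_zero: "int j < d \<Longrightarrow> symbol_power \<alpha> \<beta> j d = 0"
  by (induction j arbitrary: d) auto

lemma symbol_poly_uminus: "symbol_poly \<alpha> \<beta> q (- d) = symbol_poly \<alpha> \<beta> q d"
  by (simp add: symbol_poly_def symbol_power_uminus)

lemma symbol_poly_zero: "int (degree q) < d \<Longrightarrow> symbol_poly \<alpha> \<beta> q d = 0"
  by (auto simp: symbol_poly_def intro!: sum.neutral symbol_power_zero)

text \<open>Indices are taken relative to level \<open>n\<close>. For fixed \<open>i\<close> and
  \<open>k\<close> the boundary at level 0 eventually disappears, and the recursions of
  \<open>jacobi_power\<close> and \<open>symbol_power\<close> coincide in the limit.\<close>

lemma jacobi_power_tendsto:
  fixes a b :: "nat \<Rightarrow> nat \<Rightarrow> real"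
  assumes a: "\<And>j::int. (\<lambda>n. a n (nat (j + int n))) \<longlonglongrightarrow> \<alpha>"
    and b: "\<And>j::int. (\<lambda>n. b n (nat (j + int n))) \<longlonglongrightarrow> \<beta>"
  shows "(\<lambda>n. jacobi_power (a n) (b n) j (nat (i + int n)) (nat (k + int n))) \<longlonglongrightarrow> symbol_power \<alpha> \<beta> j (i - k)"
proof (induction j arbitrary: i)
  case 0
  have "\<forall>\<^sub>F n in sequentially. jacobi_power (a n) (b n) 0 (nat (i + int n)) (nat (k + int n))
    = symbol_power \<alpha> \<beta> 0 (i - k)"
    using eventually_ge_at_top[of "nat \<bar>i\<bar> + nat \<bar>k\<bar>"] by eventually_elim auto
  then show ?case by (rule tendsto_eventually)
next
  case (Suc j)
  let ?J = "\<lambda>i n. jacobi_power (a n) (b n) j (nat (i + int n)) (nat (k + int n))"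
  have "(\<lambda>n. a n (nat ((i - 1) + int n)) * ?J (i - 1) n + b n (nat (i + int n)) * ?J i n
      + a n (nat (i + int n)) * ?J (i + 1) n) \<longlonglongrightarrow> symbol_power \<alpha> \<beta> (Suc j) (i - k)"
    using tendsto_add[OF tendsto_add[OF tendsto_mult[OF a[of "i - 1"] Suc[of "i
      - 1"]] tendsto_mult[OF b[of i] Suc[of i]]]
        tendsto_mult[OF a[of i] Suc[of "i + 1"]]]
    by (simp add: algebra_simps)
  moreover have "\<forall>\<^sub>F n in sequentially. a n (nat ((i - 1) + int n)) * ?J (i - 1) n + b n (nat (i
    + int n)) * ?J i n
      + a n (nat (i + int n)) * ?J (i + 1) n = jacobi_power (a n) (b n) (Suc j) (nat (i + int n)) (nat (k
        + int n))"
    using eventually_ge_at_top[of "nat \<bar>i\<bar> + 1"]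
  proof eventually_elim
    case (elim n)
    then have "nat (i - 1 + int n) = nat (i + int n) - 1" "nat (i + 1 + int n) = nat (i + int n)
      + 1" "nat (i + int n) \<noteq> 0"
      by auto
    then show ?case by simp
  qed
  ultimately show ?case by (rule Lim_transform_eventually)
qed

lemma jacobi_poly_tendsto:
  fixes a b :: "nat \<Rightarrow> nat \<Rightarrow> real"
  assumes a: "\<And>j::int. (\<lambda>n. a n (nat (j + int n))) \<longlonglongrightarrow> \<alpha>"
    and b: "\<And>j::int. (\<lambda>n. b n (nat (j + int n))) \<longlonglongrightarrow> \<beta>"
  shows "(\<lambda>n. jacobi_poly (a n) (b n) q (nat (i + int n)) (nat (k + int n))) \<longlonglongrightarrow> symbol_poly \<alpha> \<beta> q (i - k)"
  unfolding jacobi_poly_def symbol_poly_def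
  by (intro tendsto_sum tendsto_mult tendsto_const jacobi_power_tendsto[where a = a and b = b] assms)

definition symbol_variance :: "real \<Rightarrow> real \<Rightarrow> real poly \<Rightarrow> real" where
  "symbol_variance \<alpha> \<beta> q = (\<Sum>k=1..degree q. real k * (symbol_poly \<alpha> \<beta> q (int k))\<^sup>2)"

lemma clift_moment_tendsto:
  fixes a b :: "nat \<Rightarrow> nat \<Rightarrow> real"
  assumes a: "\<And>j::int. (\<lambda>n. a n (nat (j + int n))) \<longlonglongrightarrow> \<alpha>"
    and b: "\<And>j::int. (\<lambda>n. b n (nat (j + int n))) \<longlonglongrightarrow> \<beta>"
    and r: "(m + 3) * degree q \<le> r"
  defines "G \<equiv> \<lambda>n. jacobi_poly (a n) (b n) q"
  shows "(\<lambda>n. (levels.clift n (n + r) (levels.tr n (G n)) (G n) ^^ m) (levels.vac n) (\<lambda>i. i))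
     \<longlonglongrightarrow> gaussian_moment (symbol_variance \<alpha> \<beta> q) m"
proof (rule LIMSEQ_I)
  fix e :: real assume e: "0 < e"
  let ?\<tau> = "symbol_poly \<alpha> \<beta> q"
  define B where "B = (\<Sum>d\<le>degree q. \<bar>?\<tau> (int d)\<bar>)"
  have B: "\<bar>?\<tau> d\<bar> \<le> B" for d
  proof -
    have *: "\<bar>?\<tau> (int k)\<bar> \<le> B" for k
    proof (cases "k \<le> degree q")
      case True then show ?thesis unfolding B_def by (intro member_le_sum) auto
    next
      case False then show ?thesis by (simp add: symbol_poly_zero B_def sum_nonneg)
    qed
    show ?thesis
      using *[of "nat d"] *[of "nat (- d)"] symbol_poly_uminus[of \<alpha> \<beta> q d] by (cases "0 \<le> d") auto
  qed
  define C where "C = real m * (real ((2 * r) * (2 * r) + 2 * r) * (B + 1)) ^ m"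
  have B0: "0 \<le> B" using B[of 0] by linarith
  have C: "0 \<le> C" using B0 by (simp add: C_def)
  \<comment> \<open>The cap 1 is what \<open>moment_bound\<close> asks for; \<open>C + 1\<close>
    instead of \<open>C\<close> covers the case \<open>m = 0\<close>, where \<open>C\<close>
    vanishes.\<close>
  define \<epsilon> where "\<epsilon> = min 1 (e / (2 * (C + 1)))"
  have \<epsilon>: "0 < \<epsilon>" "\<epsilon> \<le> 1" using e C by (auto simp: \<epsilon>_def)
  have "C * \<epsilon> \<le> C * (e / (2 * (C + 1)))" using C by (intro mult_left_mono) (auto simp: \<epsilon>_def)
  also have "\<dots> = C / (2 * (C + 1)) * e" by simp
  also have "\<dots> < 1 * e" using C e by (intro mult_strict_right_mono) auto
  also have "\<dots> = e" by simp
  finally have Ce: "C * \<epsilon> < e" .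
  \<comment> \<open>A moment sees only the entries in a window whose size is independent of
    \<open>n\<close>, so finitely many pointwise limits give one uniform bound.\<close>
  have "\<forall>\<^sub>F n in sequentially. \<forall>i\<in>{- int r..<int r}. \<forall>k\<in>{- int r..<int r}.
     \<bar>G n (nat (i + int n)) (nat (k + int n)) - ?\<tau> (i - k)\<bar> < \<epsilon>"
    unfolding G_def
    by (intro eventually_ball_finite ballI order_tendstoD(2)[OF tendsto_rabs_zero[OF LIM_zero]] \<epsilon>
        jacobi_poly_tendsto a b) auto
  then have "\<forall>\<^sub>F n in sequentially. norm ((levels.clift n (n + r) (levels.tr n (G n)) (G n) ^^ m)
    (levels.vac n) (\<lambda>i. i)
      - gaussian_moment (symbol_variance \<alpha> \<beta> q) m) < e"
    using eventually_ge_at_top[of r]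
  proof eventually_elim
    case (elim n)
    interpret levels n "n + r" by unfold_locales simp
    have "\<bar>(clift (tr (G n)) (G n) ^^ m) vac (\<lambda>i. i) - gaussian_moment (symbol_variance \<alpha> \<beta> q) m\<bar>
       \<le> real m * \<epsilon> * (real ((2 * r) * (2 * r) + 2 * r) * (B + 1)) ^ m"
      unfolding symbol_variance_def
    proof (rule moment_bound)
      show "banded (degree q) (G n)" unfolding G_def by (rule banded_jacobi_poly)
      fix i j assume ij: "i \<in> {n - r..<n + r}" "j \<in> {n - r..<n + r}"
      then have "\<bar>G n (nat ((int i - int n) + int n)) (nat ((int j - int n) + int n)) - ?\<tau> ((int i
        - int n) - (int j - int n))\<bar> < \<epsilon>"
        using elim by (intro elim(1)[rule_format]) auto
      then show "\<bar>G n i j - ?\<tau> (int i - int j)\<bar> \<le> \<epsilon>" by simp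
    qed (use r elim B \<epsilon> in \<open>auto simp: symbol_poly_uminus symbol_poly_zero\<close>)
    also have "\<dots> = C * \<epsilon>" by (simp add: C_def)
    finally show ?case using Ce by simp
  qed
  then show "\<exists>no. \<forall>n\<ge>no. norm ((levels.clift n (n + r) (levels.tr n (G n)) (G n) ^^ m) (levels.vac n) (\<lambda>i. i)
      - gaussian_moment (symbol_variance \<alpha> \<beta> q) m) < e"
    by (simp add: eventually_sequentially)
qed

lemma has_integral_exp_int:
  "((\<lambda>\<theta>::real. exp (- \<i> * of_int d * of_real \<theta>)) has_integral (if d
    = 0 then 2 * of_real pi else 0)) {0..2 * pi}"
proof (cases "d = 0")
  case True
  then show ?thesis using has_integral_const_real[of "1::complex" 0 "2 * pi"] by
    (simp add: scaleR_conv_of_real)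
next
  case False
  let ?c = "- \<i> * of_int d :: complex"
  have "((\<lambda>\<theta>::real. exp (?c * of_real \<theta>)) has_integral
      (exp (?c * of_real (2 * pi)) / ?c - exp (?c * of_real 0) / ?c)) {0..2 * pi}"
  proof (rule fundamental_theorem_of_calculus)
    fix x :: real
    have "((\<lambda>z. exp (?c * z) / ?c) has_field_derivative exp (?c * of_real x)) (at (of_real x))"
      using False by (auto intro!: derivative_eq_intros)
    from has_vector_derivative_real_field[OF this]
    show "((\<lambda>\<theta>::real. exp (?c * of_real \<theta>) / ?c) has_vector_derivative exp (?c * of_real x))
      (at x within {0..2 * pi})"
      .
  qed simp
  moreover have "exp (?c * of_real (2 * pi)) = 1"
    using exp_integer_2pi[of "- of_int d"] by (simp add: mult_ac)
  ultimately show ?thesis using False by simp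
qed

text \<open>Writing 2 cos \<theta> as a sum of two exponentials turns multiplication by the symbol
  into the shifts \<open>d - 1\<close> and \<open>d + 1\<close> of
  \<open>symbol_power\<close>.\<close>

lemma has_integral_symbol_power:
  "((\<lambda>\<theta>::real. complex_of_real ((2 * \<alpha> * cos \<theta> + \<beta>) ^ j) * exp (- \<i> * of_int d * of_real \<theta>))
     has_integral (2 * of_real pi * of_real (symbol_power \<alpha> \<beta> j d))) {0..2 * pi}"
proof (induction j arbitrary: d)
  case 0
  then show ?case using has_integral_exp_int[of d] by auto
next
  case (Suc j)
  let ?f = "\<lambda>d \<theta>. complex_of_real ((2 * \<alpha> * cos \<theta> + \<beta>) ^ j) * exp (- \<i> * of_int d * of_real \<theta>)"
  have "((\<lambda>\<theta>. of_real \<alpha> * ?f (d - 1) \<theta> + of_real \<beta> * ?f d \<theta> + of_real \<alpha> * ?f (d + 1) \<theta>) has_integral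
      (of_real \<alpha> * (2 * of_real pi * of_real (symbol_power \<alpha> \<beta> j (d - 1)))
       + of_real \<beta> * (2 * of_real pi * of_real (symbol_power \<alpha> \<beta> j d))
       + of_real \<alpha> * (2 * of_real pi * of_real (symbol_power \<alpha> \<beta> j (d + 1))))) {0..2 * pi}"
    by (intro has_integral_add has_integral_mult_right Suc)
  moreover have "of_real \<alpha> * ?f (d - 1) \<theta> + of_real \<beta> * ?f d \<theta> + of_real \<alpha> * ?f (d + 1) \<theta> =
      complex_of_real ((2 * \<alpha> * cos \<theta> + \<beta>) ^ Suc j) * exp (- \<i> * of_int d * of_real \<theta>)" for \<theta> :: real
  proof -
    have c: "complex_of_real (2 * cos \<theta>) = exp (\<i> * of_real \<theta>) + exp (- \<i> * of_real \<theta>)"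
      unfolding of_real_mult cos_of_real[symmetric] cos_exp_eq by simp
    have e1: "exp (- \<i> * of_int (d - 1) * of_real \<theta>) = exp (\<i> * of_real \<theta>) * exp (- \<i> * of_int d * of_real \<theta>)"
      unfolding exp_add[symmetric] by (simp add: algebra_simps)
    have e2: "exp (- \<i> * of_int (d + 1) * of_real \<theta>) = exp (- \<i> * of_real \<theta>) * exp
      (- \<i> * of_int d * of_real \<theta>)"
      unfolding exp_add[symmetric] by (simp add: algebra_simps)
    have p: "complex_of_real ((2 * \<alpha> * cos \<theta> + \<beta>) ^ Suc j) =
       (of_real \<alpha> * complex_of_real (2 * cos \<theta>) + of_real \<beta>) * complex_of_real ((2 * \<alpha> * cos \<theta> + \<beta>) ^ j)"
      by (simp add: algebra_simps)
    show ?thesis unfolding p c e1 e2 by (simp only: algebra_simps)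
  qed
  ultimately show ?case by (simp add: algebra_simps)
qed

lemma has_integral_symbol_poly:
  "((\<lambda>\<theta>::real. complex_of_real (poly q (2 * \<alpha> * cos \<theta> + \<beta>)) * exp (- \<i> * of_int d * of_real \<theta>))
     has_integral (2 * of_real pi * of_real (symbol_poly \<alpha> \<beta> q d))) {0..2 * pi}"
proof -
  have "((\<lambda>\<theta>::real. \<Sum>j\<le>degree q. of_real (coeff q j) * (complex_of_real ((2 * \<alpha> * cos \<theta> + \<beta>) ^ j) * exp
    (- \<i> * of_int d * of_real \<theta>)))
     has_integral (\<Sum>j\<le>degree q. of_real (coeff q j) * (2 * of_real pi * of_real
       (symbol_power \<alpha> \<beta> j d)))) {0..2 * pi}"
    by (intro has_integral_sum has_integral_mult_right has_integral_symbol_power) auto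
  moreover have "(\<Sum>j\<le>degree q. of_real (coeff q j) * (complex_of_real ((2 * \<alpha> * cos \<theta> + \<beta>) ^ j) * exp
    (- \<i> * of_int d * of_real \<theta>)))
     = complex_of_real (poly q (2 * \<alpha> * cos \<theta> + \<beta>)) * exp (- \<i> * of_int d * of_real \<theta>)" for \<theta> :: real
    by (simp add: poly_altdef sum_distrib_right mult.assoc)
  moreover have "(\<Sum>j\<le>degree q. complex_of_real (coeff q j) * (2 * of_real pi * of_real
    (symbol_power \<alpha> \<beta> j d)))
     = 2 * of_real pi * of_real (symbol_poly \<alpha> \<beta> q d)"
    by (simp add: symbol_poly_def sum_distrib_left mult_ac)
  ultimately show ?thesis by simp
qed

section \<open>The method of moments\<close>

lemma gaussian_moment_odd: "gaussian_moment v (Suc (2 * j)) = 0"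
  by (induction j) auto

lemma gaussian_moment_even: "gaussian_moment v (2 * j) = (v / 2) ^ j * fact (2 * j) / fact j"
proof (induction j)
  case (Suc j)
  have "gaussian_moment v (2 * Suc j) = real (Suc (2 * j)) * v * gaussian_moment v (2 * j)"
    by simp
  also have "\<dots> = (v / 2) ^ Suc j * fact (2 * Suc j) / fact (Suc j)"
  proof -
    have aux: "(2 * x - 1) * v * (u * F / f) = (v / 2 * u) * (2 * x * (2 * x - 1) * F) / (x * f)"
      if "x \<noteq> 0" "f \<noteq> 0" for x f u F :: real
      using that by (simp add: field_simps)
    have "fact (2 * Suc j) = 2 * (real j + 1) * (2 * (real j + 1) - 1) * fact (2 * j)"
      "fact (Suc j) = (real j + 1) * fact j"
      by (simp_all add: algebra_simps)
    then show ?thesis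
      unfolding Suc using aux[of "real j + 1" "fact j" "(v / 2) ^ j" "fact (2 * j)"] by
        (simp add: add_ac mult_ac)
  qed
  finally show ?case .
qed simp

lemma gaussian_moment_series:
  fixes t v :: real
  shows "(\<Sum>k\<le>2 * J. (\<i> * t) ^ k / fact k * gaussian_moment v k) =
     (\<Sum>j\<le>J. complex_of_real ((- (t\<^sup>2 * v / 2)) ^ j / fact j))"
proof (induction J)
  case (Suc J)
  have e: "{..2 * Suc J} = insert (Suc (Suc (2 * J))) (insert (Suc (2 * J)) {..2 * J})" by auto
  have "(\<i> * complex_of_real t) ^ (2 * Suc J) = complex_of_real ((- (t\<^sup>2)) ^ Suc J)"
    unfolding power_mult by (simp add: power_mult_distrib)
  then have "(\<i> * complex_of_real t) ^ (2 * Suc J) / fact (2 * Suc J) * gaussian_moment v (2 * Suc J) =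
     complex_of_real ((- (t\<^sup>2)) ^ Suc J) / fact (2 * Suc J) * complex_of_real ((v / 2) ^ Suc J * fact
       (2 * Suc J) / fact (Suc J))"
    by (simp only: gaussian_moment_even)
  also have "\<dots> = complex_of_real ((- (t\<^sup>2)) ^ Suc J * (v / 2) ^ Suc J / fact (Suc J))"
  proof -
    have "complex_of_real a / fact m * complex_of_real (b * fact m / c) = complex_of_real (a * b / c)"
      for a b c m
      by (simp add: field_simps)
    then show ?thesis .
  qed
  also have "(- (t\<^sup>2)) ^ Suc J * (v / 2) ^ Suc J = (- (t\<^sup>2 * v / 2)) ^ Suc J"
    unfolding power_mult_distrib[symmetric] by simp
  finally have *: "(\<i> * complex_of_real t) ^ (2 * Suc J) / fact (2 * Suc J) * gaussian_moment v (2 * Suc J) =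
     complex_of_real ((- (t\<^sup>2 * v / 2)) ^ Suc J / fact (Suc J))" .
  have "(\<Sum>k\<le>2 * Suc J. (\<i> * complex_of_real t) ^ k / fact k * gaussian_moment v k) =
     (\<i> * complex_of_real t) ^ (2 * Suc J) / fact (2 * Suc J) * gaussian_moment v (2 * Suc J)
     + ((\<i> * complex_of_real t) ^ (Suc (2 * J)) / fact (Suc (2 * J)) * gaussian_moment v (Suc (2 * J))
     + (\<Sum>k\<le>2 * J. (\<i> * complex_of_real t) ^ k / fact k * gaussian_moment v k))"
    unfolding e by (simp del: gaussian_moment.simps power_Suc fact_Suc)
  also have "\<dots> = (\<Sum>j\<le>Suc J. complex_of_real ((- (t\<^sup>2 * v / 2)) ^ j / fact j))"
    unfolding Suc * gaussian_moment_odd by (simp only: sum.atMost_Suc) simp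
  finally show ?case .
qed simp

lemma exp_series_tendsto:
  fixes z :: real
  shows "(\<lambda>J. \<Sum>j\<le>J. z ^ j / fact j) \<longlonglongrightarrow> exp z" "(\<lambda>j. z ^ j / fact j) \<longlonglongrightarrow> 0"
proof -
  have "(\<lambda>n. z ^ n / fact n) sums exp z"
    using exp_converges[of z] by (simp add: divide_inverse mult.commute)
  then show "(\<lambda>J. \<Sum>j\<le>J. z ^ j / fact j) \<longlonglongrightarrow> exp z" "(\<lambda>j. z ^ j / fact j) \<longlonglongrightarrow> 0"
    by (auto simp: sums_def_le sums_summable intro: summable_LIMSEQ_zero)
qed

text \<open>Expand the characteristic function to order \<open>2 * J\<close>. The remainder is
  bounded by the last moment, which tends to the Gaussian one in \<open>n\<close>, and the Gaussian
  bound tends to 0 in \<open>J\<close>. So \<open>J\<close> is fixed first. An even order makes the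
  absolute moment an ordinary one.\<close>

lemma char_tendsto_of_moments:
  fixes X :: "nat \<Rightarrow> 'a \<Rightarrow> real" and t v :: real
  assumes int: "\<And>m. \<forall>\<^sub>F n in sequentially. integrable (measure_pmf (P n)) (\<lambda>x. X n x ^ m)"
    and lim: "\<And>m. (\<lambda>n. measure_pmf.expectation (P n) (\<lambda>x. X n x ^ m)) \<longlonglongrightarrow> gaussian_moment v m"
  shows "(\<lambda>n. char (distr (measure_pmf (P n)) borel (X n)) t) \<longlonglongrightarrow> complex_of_real (exp (- (t\<^sup>2 * v / 2)))"
proof (rule LIMSEQ_I)
  fix r :: real assume r: "0 < r"
  let ?z = "- (t\<^sup>2 * v / 2)"
  let ?S = "\<lambda>J. \<Sum>k\<le>2 * J. (\<i> * complex_of_real t) ^ k / fact k * gaussian_moment v k"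
  let ?e = "\<lambda>J. 2 * \<bar>t\<bar> ^ (2 * J) / fact (2 * J) * gaussian_moment v (2 * J)"
  note exp_series_tendsto(1)[of ?z]
  then have S: "?S \<longlonglongrightarrow> complex_of_real (exp ?z)"
    unfolding gaussian_moment_series of_real_sum[symmetric] by (rule tendsto_of_real)
  have "?e J = 2 * ((t\<^sup>2 * v / 2) ^ J / fact J)" for J
    unfolding gaussian_moment_even power_mult power2_abs
    by (simp add: field_simps power_mult_distrib power_divide)
  then have e: "?e \<longlonglongrightarrow> 0"
    using tendsto_mult_right_zero[OF exp_series_tendsto(2)[of "t\<^sup>2 * v / 2"], of 2] by simp
  have "\<forall>\<^sub>F J in sequentially. norm (?S J - complex_of_real (exp ?z)) < r / 3"
    using S r by (intro order_tendstoD(2)[OF tendsto_norm_zero[OF LIM_zero]]) auto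
  moreover have "\<forall>\<^sub>F J in sequentially. ?e J < r / 3"
    using e r by (intro order_tendstoD(2)[of _ 0]) auto
  ultimately obtain J where J: "norm (?S J - complex_of_real (exp ?z)) < r / 3" "?e J < r / 3"
    using eventually_happens[OF eventually_conj] trivial_limit_sequentially by blast
  define E where "E = (\<lambda>n k. measure_pmf.expectation (P n) (\<lambda>x. X n x ^ k))"
  have l1: "(\<lambda>n. \<Sum>k\<le>2 * J. (\<i> * complex_of_real t) ^ k / fact k * E n k) \<longlonglongrightarrow> ?S J"
    unfolding E_def by (intro tendsto_intros lim)
  have l2: "(\<lambda>n. 2 * \<bar>t\<bar> ^ (2 * J) / fact (2 * J) * E n (2 * J)) \<longlonglongrightarrow> ?e J"
    unfolding E_def by (intro tendsto_intros lim)
  have "\<forall>\<^sub>F n in sequentially. norm ((\<Sum>k\<le>2 * J. (\<i> * complex_of_real t) ^ k / fact k * E n k) - ?S J) < r / 3"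
    using l1 r by (intro order_tendstoD(2)[OF tendsto_norm_zero[OF LIM_zero]]) auto
  moreover have "\<forall>\<^sub>F n in sequentially. 2 * \<bar>t\<bar> ^ (2 * J) / fact (2 * J) * E n (2 * J) < r / 3"
    by (rule order_tendstoD(2)[OF l2 J(2)])
  moreover have "\<forall>\<^sub>F n in sequentially. \<forall>k\<in>{..2 * J}. integrable (measure_pmf (P n)) (\<lambda>x. X n x ^ k)"
    by (intro eventually_ball_finite ballI int) auto
  ultimately have "\<forall>\<^sub>F n in sequentially. norm (char (distr (measure_pmf (P n)) borel (X n)) t
    - complex_of_real (exp ?z)) < r"
  proof eventually_elim
    case (elim n)
    let ?c = "char (distr (measure_pmf (P n)) borel (X n)) t"
    let ?T = "\<Sum>k\<le>2 * J. (\<i> * complex_of_real t) ^ k / fact k * E n k"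
    have "cmod (?c - ?T) \<le> (2 * \<bar>t\<bar> ^ (2 * J) / fact (2 * J)) * measure_pmf.expectation (P n)
      (\<lambda>x. \<bar>X n x\<bar> ^ (2 * J))"
      unfolding E_def
      by (rule prob_space.char_approx1'[OF prob_space_measure_pmf _ _ refl]) (use elim in auto)
    also have "measure_pmf.expectation (P n) (\<lambda>x. \<bar>X n x\<bar> ^ (2 * J)) = E n (2 * J)"
      by (simp add: E_def power_mult)
    finally have "cmod (?c - ?T) < r / 3" using elim by linarith
    moreover have "cmod (?c - complex_of_real (exp ?z)) \<le> cmod (?c - ?T) + cmod (?T - ?S J) + cmod (?S J
      - complex_of_real (exp ?z))"
    proof -
      have "cmod (x - w) \<le> cmod (x - y) + cmod (y - z) + cmod (z - w)" for x y z w
        using norm_triangle_ineq[of "x - y" "y - w"] norm_triangle_ineq[of "y - z" "z - w"] by simp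
      then show ?thesis .
    qed
    ultimately show ?case using elim J by linarith
  qed
  then show "\<exists>no. \<forall>n\<ge>no. norm (char (distr (measure_pmf (P n)) borel (X n)) t - complex_of_real (exp ?z)) < r"
    by (simp add: eventually_sequentially)
qed

lemma real_distribution_centered_normal: "0 \<le> v \<Longrightarrow> real_distribution (centered_normal v)"
  by (cases "v = 0") (auto simp: centered_normal_def real_distribution_def real_distribution_axioms_def
      prob_space_return prob_space_normal_density)

lemma char_centered_normal:
  assumes "0 \<le> v"
  shows "char (centered_normal v) t = complex_of_real (exp (- (t\<^sup>2 * v / 2)))"
proof (cases "v = 0")
  case True
  then show ?thesis
    by (simp add: centered_normal_def char_def integral_return)
next
  case False
  define s where "s = sqrt v"
  have s: "0 < s" "s\<^sup>2 = v" using assms False by (auto simp: s_def)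
  interpret std: prob_space std_normal_distribution by (rule prob_space_normal_density) simp
  have "distributed std_normal_distribution lborel (\<lambda>x. x) std_normal_density"
    by (auto simp: distributed_def distr_id2)
  from std.normal_density_affine[OF this, of s 0]
  have "distributed std_normal_distribution lborel (\<lambda>x. s * x) (normal_density 0 s)"
    using s by simp
  then have "centered_normal v = distr std_normal_distribution lborel (\<lambda>x. s * x)"
    using False by (simp add: distributed_def centered_normal_def s_def)
  then have "char (centered_normal v) t = (CLINT x|std_normal_distribution. iexp (t * (s * x)))"
    unfolding char_def by (simp add: integral_distr)
  also have "\<dots> = char std_normal_distribution (t * s)"
    unfolding char_def by (simp add: mult.assoc)
  also have "\<dots> = complex_of_real (exp (- (t\<^sup>2 * v / 2)))"
    unfolding char_std_normal_distribution using s(2) by (simp add: power_mult_distrib)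
  finally show ?thesis .
qed

section \<open>Polynomial approximation of continuously differentiable functions\<close>

text \<open>Squaring smooths the kink of the positive part just enough for C^1; it is the building
  block of the cutoff below.\<close>

lemma has_derivative_max_square:
  fixes x :: real
  shows "((\<lambda>x. (max 0 x)\<^sup>2) has_real_derivative 2 * max 0 x) (at x)"
proof (cases x "0 :: real" rule: linorder_cases)
  case less
  have "((\<lambda>x. 0 :: real) has_real_derivative 0) (at x)" by simp
  then have "((\<lambda>x. (max 0 x)\<^sup>2) has_real_derivative 0) (at x)"
    by (rule has_field_derivative_transform_within_open[of _ _ _ "{..<0}"]) (use less in auto)
  then show ?thesis using less by simp
next
  case greater
  have "((\<lambda>x. x\<^sup>2 :: real) has_real_derivative 2 * x) (at x)"
    by (auto intro!: derivative_eq_intros)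
  then have "((\<lambda>x. (max 0 x)\<^sup>2) has_real_derivative 2 * x) (at x)"
    by (rule has_field_derivative_transform_within_open[of _ _ _ "{0<..}"]) (use greater in auto)
  then show ?thesis using greater by simp
next
  case equal
  have "(\<lambda>y::real. ((max 0 y)\<^sup>2 - (max 0 0)\<^sup>2) / (y - 0)) \<midarrow>0\<rightarrow> 0"
  proof (rule tendsto_sandwich[of "\<lambda>y. - \<bar>y\<bar>" _ _ "\<lambda>y. \<bar>y\<bar>"])
    have "\<bar>((max 0 y)\<^sup>2 - (max 0 0)\<^sup>2) / (y - 0)\<bar> \<le> \<bar>y\<bar>" for y :: real
      by (cases "y > 0") (auto simp: power2_eq_square)
    then have b: "- \<bar>y\<bar> \<le> ((max 0 y)\<^sup>2 - (max 0 0)\<^sup>2) / (y - 0)"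
      "((max 0 y)\<^sup>2 - (max 0 0)\<^sup>2) / (y - 0) \<le> \<bar>y\<bar>" for y :: real
      unfolding abs_le_iff by (simp_all only: minus_le_iff)
    show "\<forall>\<^sub>F y in at 0. - \<bar>y :: real\<bar> \<le> ((max 0 y)\<^sup>2 - (max 0 0)\<^sup>2) / (y - 0)"
      by (rule eventuallyI) (fact b)
    show "\<forall>\<^sub>F y in at 0. ((max 0 y)\<^sup>2 - (max 0 0)\<^sup>2) / (y - 0) \<le> \<bar>y :: real\<bar>"
      by (rule eventuallyI) (fact b)
    have "((\<lambda>y::real. \<bar>y\<bar>) \<longlongrightarrow> \<bar>0\<bar>) (at 0)" by (intro tendsto_intros)
    then show "((\<lambda>y::real. \<bar>y\<bar>) \<longlongrightarrow> 0) (at 0)" "((\<lambda>y::real. - \<bar>y\<bar>) \<longlongrightarrow> 0) (at 0)"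
      using tendsto_minus by fastforce+
  qed
  then show ?thesis using equal by (simp add: has_field_derivative_iff)
qed

text \<open>Bumps on finitely many balls covering \<open>S\<close> add up to a function
  \<open>\<Sigma>\<close> with a positive minimum \<open>c\<close> on \<open>S\<close>. Composing
  with a C^1 profile that is 0 at 0 and 1 from \<open>c\<close> on gives the cutoff.\<close>

lemma C1_cutoff:
  fixes S U :: "real set"
  assumes S: "compact S" and U: "open U" "S \<subseteq> U"
  obtains \<zeta> \<zeta>' V where "\<And>t. (\<zeta> has_real_derivative \<zeta>' t) (at t)" "continuous_on UNIV \<zeta>'"
    "closed V" "V \<subseteq> U" "\<And>t. t \<in> S \<Longrightarrow> \<zeta> t = 1" "\<And>t. t \<notin> V \<Longrightarrow> \<zeta> t = 0 \<and> \<zeta>' t = (0 :: real)"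
proof -
  have "\<forall>s\<in>S. \<exists>d>0. cball s d \<subseteq> U" using U by (meson open_contains_cball subsetD)
  then obtain d where d: "\<And>s. s \<in> S \<Longrightarrow> 0 < d s" "\<And>s. s \<in> S \<Longrightarrow> cball s (d s) \<subseteq> U" by metis
  have "S \<subseteq> (\<Union>s\<in>S. ball s (d s))" using d(1) by force
  then obtain F where F: "F \<subseteq> S" "finite F" "S \<subseteq> (\<Union>s\<in>F. ball s (d s))"
    using compactE_image[OF S, of S "\<lambda>s. ball s (d s)"] by (metis open_ball)
  define B where "B = (\<lambda>s t. max 0 (1 - ((t - s) / d s)\<^sup>2))"
  define \<Sigma> where "\<Sigma> = (\<lambda>t. \<Sum>s\<in>F. (B s t)\<^sup>2)"
  define \<Sigma>' where "\<Sigma>' = (\<lambda>t. \<Sum>s\<in>F. 2 * B s t * (- (2 * ((t - s) / d s) * (1 / d s))))"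
  have d\<Sigma>: "(\<Sigma> has_real_derivative \<Sigma>' t) (at t)" for t
    unfolding \<Sigma>_def \<Sigma>'_def
  proof (intro DERIV_sum)
    fix s
    assume "s \<in> F"
    then have "d s \<noteq> 0" using d(1)[of s] F(1) by auto
    then have "((\<lambda>t. 1 - ((t - s) / d s)\<^sup>2) has_real_derivative (- (2 * ((t - s) / d s) * (1 / d s)))) (at t)"
      by (auto intro!: derivative_eq_intros)
    from DERIV_chain[OF has_derivative_max_square this]
    show "((\<lambda>t. (B s t)\<^sup>2) has_real_derivative 2 * B s t * (- (2 * ((t - s) / d s) * (1 / d s)))) (at t)"
      by (simp add: B_def o_def)
  qed
  have cB: "continuous_on A (B s)" for A s unfolding B_def divide_inverse by (intro continuous_intros)
  have c\<Sigma>': "continuous_on UNIV \<Sigma>'"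
    unfolding \<Sigma>'_def divide_inverse by (intro continuous_intros cB)
  have c\<Sigma>: "continuous_on S \<Sigma>" unfolding \<Sigma>_def by (intro continuous_intros cB)
  have pos: "0 < \<Sigma> t" if "t \<in> S" for t
  proof -
    have "t \<in> (\<Union>s\<in>F. ball s (d s))" using F(3) that by blast
    then obtain s where s: "s \<in> F" "t \<in> ball s (d s)" by blast
    have "0 < d s" using d(1) F(1) s(1) by auto
    then have "\<bar>(t - s) / d s\<bar> < 1" using s(2) by (simp add: dist_real_def abs_minus_commute)
    then have "((t - s) / d s)\<^sup>2 < 1" by (simp add: abs_square_less_1)
    then have "0 < (B s t)\<^sup>2" by (simp add: B_def)
    then show ?thesis
      unfolding \<Sigma>_def using s(1) F(2) by (intro sum_pos2[of F s]) auto
  qed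
  obtain c where c: "0 < c" "\<And>t. t \<in> S \<Longrightarrow> c \<le> \<Sigma> t"
  proof (cases "S = {}")
    case False
    then obtain t0 where "t0 \<in> S" "\<forall>t\<in>S. \<Sigma> t0 \<le> \<Sigma> t"
      using continuous_attains_inf[OF S _ c\<Sigma>] by auto
    then show ?thesis using that pos by blast
  qed (use that[of 1] in auto)
  define \<zeta> where "\<zeta> = (\<lambda>t. 1 - (max 0 (1 - \<Sigma> t / c))\<^sup>2)"
  define \<zeta>' where "\<zeta>' = (\<lambda>t. 2 * max 0 (1 - \<Sigma> t / c) * (\<Sigma>' t / c))"
  define V where "V = (\<Union>s\<in>F. cball s (d s))"
  show ?thesis
  proof
    fix t
    have "((\<lambda>t. 1 - \<Sigma> t / c) has_real_derivative - (\<Sigma>' t / c)) (at t)"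
      using c(1) by (auto intro!: derivative_eq_intros d\<Sigma>)
    from DERIV_chain[OF has_derivative_max_square this]
    have "((\<lambda>t. (max 0 (1 - \<Sigma> t / c))\<^sup>2) has_real_derivative 2 * max 0 (1 - \<Sigma> t / c) * - (\<Sigma>' t / c)) (at t)"
      by (simp add: o_def)
    from DERIV_diff[OF DERIV_const this] show "(\<zeta> has_real_derivative \<zeta>' t) (at t)"
      by (simp add: \<zeta>_def[abs_def] \<zeta>'_def)
  next
    have "continuous_on UNIV \<Sigma>" using d\<Sigma> by (meson DERIV_isCont continuous_at_imp_continuous_on)
    then show "continuous_on UNIV \<zeta>'"
      unfolding \<zeta>'_def divide_inverse by (intro continuous_intros c\<Sigma>')
  next
    show "closed V" unfolding V_def by (intro closed_UN F) auto
    show "V \<subseteq> U" unfolding V_def using d(2) F(1) by blast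
  next
    fix t assume "t \<in> S"
    then show "\<zeta> t = 1" using c by (simp add: \<zeta>_def)
  next
    fix t assume t: "t \<notin> V"
    have "B s t = 0" if "s \<in> F" for s
    proof -
      have "0 < d s" using d(1) F(1) that by auto
      moreover have "d s < \<bar>t - s\<bar>" using t that by (auto simp: V_def dist_real_def abs_minus_commute not_le)
      ultimately have "1 \<le> \<bar>(t - s) / d s\<bar>" by (simp add: abs_divide)
      then have "1 \<le> ((t - s) / d s)\<^sup>2" by (metis one_le_power power2_abs)
      then show ?thesis by (simp add: B_def)
    qed
    then show "\<zeta> t = 0 \<and> \<zeta>' t = 0" using c(1) by (simp add: \<zeta>_def \<zeta>'_def \<Sigma>_def \<Sigma>'_def)
  qed
qed

text \<open>\<mu>(K) need not be connected. A global extension allows the mean value theorem on an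
  interval containing it, where polynomials are then fitted.\<close>

lemma C1_on_extend:
  assumes S: "compact S" and h: "C1_on S h"
  obtains g g' where "\<And>t. (g has_real_derivative g' t) (at t)" "continuous_on UNIV g'"
    "\<And>t. t \<in> S \<Longrightarrow> g t = h t"
proof -
  obtain U g g' where U: "open U" "S \<subseteq> U" and gh: "\<forall>t\<in>S. g t = h t"
    and g: "\<forall>t\<in>U. (g has_real_derivative g' t) (at t)" and g': "continuous_on U g'"
    using h unfolding C1_on_def by blast
  obtain \<zeta> \<zeta>' V where \<zeta>: "\<And>t. (\<zeta> has_real_derivative \<zeta>' t) (at t)" "continuous_on UNIV \<zeta>'"
    and V: "closed V" "V \<subseteq> U" and \<zeta>1: "\<And>t. t \<in> S \<Longrightarrow> \<zeta> t = 1"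
    and \<zeta>0: "\<And>t. t \<notin> V \<Longrightarrow> \<zeta> t = 0 \<and> \<zeta>' t = (0 :: real)"
    using C1_cutoff[OF S U] by metis
  define G where "G = (\<lambda>t. if t \<in> U then \<zeta> t * g t else 0)"
  define G' where "G' = (\<lambda>t. if t \<in> U then \<zeta>' t * g t + g' t * \<zeta> t else 0)"
  show ?thesis
  proof
    fix t
    show "(G has_real_derivative G' t) (at t)"
    proof (cases "t \<in> U")
      case True
      have "((\<lambda>t. \<zeta> t * g t) has_real_derivative \<zeta>' t * g t + g' t * \<zeta> t) (at t)"
        using DERIV_mult[OF \<zeta>(1) g[rule_format, OF True]] .
      then have "(G has_real_derivative \<zeta>' t * g t + g' t * \<zeta> t) (at t)"
        by (rule has_field_derivative_transform_within_open[OF _ U(1) True]) (simp add: G_def)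
      then show ?thesis using True by (simp add: G'_def)
    next
      case False
      have "((\<lambda>_. 0) has_real_derivative 0) (at t)" by simp
      then have "(G has_real_derivative 0) (at t)"
        by (rule has_field_derivative_transform_within_open[of _ _ _ "- V"])
          (use V False \<zeta>0 in \<open>auto simp: G_def\<close>)
      then show ?thesis using False by (simp add: G'_def)
    qed
  next
    have "continuous_on U g"
      using g U(1) by (meson DERIV_isCont continuous_at_imp_continuous_on)
    moreover have "continuous_on U \<zeta>"
      using \<zeta>(1) by (meson DERIV_isCont continuous_at_imp_continuous_on)
    moreover have "continuous_on U \<zeta>'" using \<zeta>(2) continuous_on_subset by blast
    ultimately have "continuous_on U (\<lambda>t. \<zeta>' t * g t + g' t * \<zeta> t)"
      using g' by (intro continuous_intros)
    then have 1: "continuous_on U G'" by (rule continuous_on_eq) (simp add: G'_def)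
    have 2: "continuous_on (- V) G'"
      by (rule continuous_on_eq[of _ "\<lambda>_. 0"]) (use \<zeta>0 in \<open>auto simp: G'_def\<close>)
    have "continuous_on (U \<union> - V) G'" using 1 2 U(1) V(1) by (intro continuous_on_open_Un) auto
    moreover have "U \<union> - V = UNIV" using V(2) by auto
    ultimately show "continuous_on UNIV G'" by simp
  next
    fix t assume "t \<in> S"
    then show "G t = h t" using U(2) gh \<zeta>1 by (auto simp: G_def)
  qed
qed

lemma lipschitz_of_derivative_bound:
  fixes g g' :: "real \<Rightarrow> real"
  assumes d: "\<And>t. t \<in> {a..b} \<Longrightarrow> (g has_real_derivative g' t) (at t)"
    and M: "\<And>t. t \<in> {a..b} \<Longrightarrow> \<bar>g' t\<bar> \<le> M" and xy: "x \<in> {a..b}" "y \<in> {a..b}"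
  shows "\<bar>g x - g y\<bar> \<le> M * \<bar>x - y\<bar>"
  using field_differentiable_bound[of "{a..b}" g g' M x y] assms
  by (auto intro: has_field_derivative_at_within)

text \<open>Approximate the derivative and integrate from 0. The tolerance
  \<open>e / (R + 1)\<close> for the derivative controls the function values on the whole interval
  as well.\<close>

lemma C1_weierstrass:
  fixes g g' :: "real \<Rightarrow> real"
  assumes g: "\<And>t. (g has_real_derivative g' t)
    (at t)" and g': "continuous_on UNIV g'" and e: "0 < e" and R: "0 \<le> R"
  obtains q :: "real poly" where "\<And>t. t \<in> {-R..R} \<Longrightarrow> \<bar>g t - poly q t\<bar> \<le> e"
    "\<And>x y. x \<in> {-R..R} \<Longrightarrow> y \<in> {-R..R} \<Longrightarrow> \<bar>(g x - poly q x) - (g y - poly q y)\<bar> \<le> e * \<bar>x - y\<bar>"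
proof -
  define d where "d = e / (R + 1)"
  have d: "0 < d" "d \<le> e" using e R by (auto simp: d_def field_simps)
  obtain p where p: "real_polynomial_function p" "\<And>t. t \<in> {-R..R} \<Longrightarrow> \<bar>g' t - p t\<bar> < d"
    using Stone_Weierstrass_real_polynomial_function[of "{-R..R}" g' d] d
      continuous_on_subset[OF g', of "{-R..R}"] by auto
  obtain a m where p_eq: "p = (\<lambda>x. \<Sum>i\<le>m. a i * x ^ i)"
    using p(1) real_polynomial_function_iff_sum by blast
  define q where "q = [:g 0:] + (\<Sum>i\<le>m. monom (a i / real (Suc i)) (Suc i))"
  have dq: "(poly q has_real_derivative p t) (at t)" for t
  proof -
    have q: "poly q = (\<lambda>t. g 0 + (\<Sum>i\<le>m. a i / real (Suc i) * t ^ Suc i))"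
      by (auto simp: q_def poly_sum poly_monom)
    have "((\<lambda>t. a i / real (Suc i) * t ^ Suc i) has_real_derivative a i * t ^ i) (at t)" for i
      by (rule derivative_eq_intros refl | simp)+
    then have "((\<lambda>t. g 0 + (\<Sum>i\<le>m. a i / real (Suc i) * t ^ Suc i)) has_real_derivative 0 +
      (\<Sum>i\<le>m. a i * t ^ i)) (at t)"
      by (intro DERIV_add DERIV_const DERIV_sum)
    then show ?thesis by (simp add: q p_eq)
  qed
  have der: "((\<lambda>t. g t - poly q t) has_real_derivative g' t - p t) (at t)" for t
    by (intro DERIV_diff g dq)
  have lip: "\<bar>(g x - poly q x) - (g y - poly q y)\<bar> \<le> d * \<bar>x - y\<bar>" if "x \<in> {-R..R}" "y \<in> {-R..R}" for x y
    by (rule lipschitz_of_derivative_bound[OF der _ that]) (use p(2) in force)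
  show ?thesis
  proof
    fix t assume t: "t \<in> {-R..R}"
    have "poly q 0 = g 0" by (simp add: q_def poly_sum poly_monom)
    then have "\<bar>g t - poly q t\<bar> \<le> d * \<bar>t\<bar>" using lip[OF t, of 0] R by simp
    also have "\<dots> \<le> d * (R + 1)" using t d by (intro mult_left_mono) auto
    also have "\<dots> = e" using R by (simp add: d_def)
    finally show "\<bar>g t - poly q t\<bar> \<le> e" .
  next
    fix x y assume "x \<in> {-R..R}" "y \<in> {-R..R}"
    from lip[OF this] show "\<bar>(g x - poly q x) - (g y - poly q y)\<bar> \<le> e * \<bar>x - y\<bar>"
      using d by (meson abs_ge_zero mult_right_mono order_trans)
  qed
qed

section \<open>Lipschitz bounds for polynomials\<close>

lemma poly_bounded_interval:
  obtains M where "0 < M" "\<And>x. x \<in> {-R..R} \<Longrightarrow> \<bar>poly q x\<bar> \<le> (M :: real)"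
proof -
  have "bounded (poly q ` {-R..R})"
    by (intro compact_imp_bounded compact_continuous_image continuous_intros) auto
  then obtain M where "0 < M" "\<forall>y\<in>poly q ` {-R..R}. norm y \<le> M" by (metis bounded_pos)
  then show ?thesis using that by auto
qed

lemma poly_lipschitz_interval:
  obtains M where "0 < M" "\<And>x y. x \<in> {-R..R} \<Longrightarrow> y \<in> {-R..R} \<Longrightarrow> \<bar>poly q x - poly q y\<bar> \<le> M * \<bar>x - y :: real\<bar>"
proof -
  obtain M where M: "0 < M" "\<And>x. x \<in> {-R..R} \<Longrightarrow> \<bar>poly (pderiv q) x\<bar> \<le> M"
    using poly_bounded_interval by blast
  show ?thesis
    by (rule that[OF M(1)], rule lipschitz_of_derivative_bound[OF poly_DERIV M(2)])
qed

text \<open>In the application \<open>v\<close> is a value of \<mu>_n and \<open>v + e\<close> one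
  of \<mu>. Exchanging \<open>e\<close> for \<open>e'\<close> costs the Lipschitz constant of
  \<open>q\<close>; for a common shift \<open>e'\<close> the derivative of the increment is of order
  \<eta> because \<open>q'\<close> is Lipschitz.\<close>

lemma poly_shift_lipschitz:
  fixes q :: "real poly"
  obtains C where "0 < C"
    "\<And>\<eta> v v' e e'. \<bar>v\<bar> \<le> R \<Longrightarrow> \<bar>v'\<bar> \<le> R \<Longrightarrow> \<bar>e\<bar> \<le> \<eta> \<Longrightarrow> \<bar>e'\<bar> \<le> \<eta> \<Longrightarrow> \<eta> \<le> 1 \<Longrightarrow> \<bar>e - e'\<bar> \<le> \<eta> * \<bar>v - v'\<bar> \<Longrightarrow>
       \<bar>(poly q (v + e) - poly q v) - (poly q (v' + e') - poly q v')\<bar> \<le> C * \<eta> * \<bar>v - v'\<bar>"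
proof -
  obtain M1 where M1: "0 < M1" "\<And>x y. x \<in> {-(R+1)..R+1} \<Longrightarrow> y \<in> {-(R+1)..R+1} \<Longrightarrow> \<bar>poly q x - poly q y\<bar>
    \<le> M1 * \<bar>x - y\<bar>"
    using poly_lipschitz_interval by blast
  obtain M2 where M2: "0 < M2" "\<And>x y. x \<in> {-(R+1)..R+1} \<Longrightarrow> y \<in> {-(R+1)..R+1} \<Longrightarrow> \<bar>poly (pderiv q) x - poly
    (pderiv q) y\<bar> \<le> M2 * \<bar>x - y\<bar>"
    using poly_lipschitz_interval by blast
  show ?thesis
  proof (rule that[of "M1 + M2"])
    fix \<eta> v v' e e' assume a: "\<bar>v\<bar> \<le> R" "\<bar>v'\<bar> \<le> R" "\<bar>e\<bar> \<le> \<eta>" "\<bar>e'\<bar> \<le> \<eta>" "\<eta> \<le> 1" "\<bar>e - e'\<bar> \<le> \<eta> * \<bar>v - v'\<bar>"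
    have "\<bar>poly q (v + e) - poly q (v + e')\<bar> \<le> M1 * \<bar>(v + e) - (v + e')\<bar>"
      by (rule M1(2)) (use a in auto)
    also have "\<dots> \<le> M1 * (\<eta> * \<bar>v - v'\<bar>)" using a(6) M1(1) by (intro mult_left_mono) auto
    finally have 1: "\<bar>poly q (v + e) - poly q (v + e')\<bar> \<le> M1 * (\<eta> * \<bar>v - v'\<bar>)" .
    have der: "((\<lambda>s. poly q (s + e') - poly q s) has_real_derivative poly (pderiv q) (s + e') - poly
      (pderiv q) s) (at s)" for s
      by (auto intro!: derivative_eq_intros)
    have 2: "\<bar>(poly q (v + e') - poly q v) - (poly q (v' + e') - poly q v')\<bar> \<le> (M2 * \<eta>) * \<bar>v - v'\<bar>"
    proof (rule lipschitz_of_derivative_bound[OF der, of "-R" R])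
      fix s assume s: "s \<in> {-R..R}"
      have "\<bar>poly (pderiv q) (s + e') - poly (pderiv q) s\<bar> \<le> M2 * \<bar>s + e' - s\<bar>"
        by (rule M2(2)) (use a s in auto)
      also have "\<dots> \<le> M2 * \<eta>" using a M2(1) by (intro mult_left_mono) auto
      finally show "\<bar>poly (pderiv q) (s + e') - poly (pderiv q) s\<bar> \<le> M2 * \<eta>" .
    qed (use a in auto)
    show "\<bar>(poly q (v + e) - poly q v) - (poly q (v' + e') - poly q v')\<bar> \<le> (M1 + M2) * \<eta> * \<bar>v - v'\<bar>"
      using 1 2 by (simp add: algebra_simps)
  qed (use M1 M2 in auto)
qed

section \<open>Sequences of orthogonal polynomial ensembles\<close>

lemma support_at_least_mono: "support_at_least w N \<Longrightarrow> k \<le> N \<Longrightarrow> support_at_least w k"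
  by (auto simp: support_at_least_def)

lemma rescale_lattice: "1 \<le> n \<Longrightarrow> rescale \<nu> n (of_int y / real n) = \<nu> y"
  by (simp add: rescale_def)

lemma has_sum_lattice:
  fixes f :: "real \<Rightarrow> real"
  assumes "1 \<le> n"
  shows "(f has_sum s) (lattice n) \<longleftrightarrow> ((\<lambda>y::int. f (of_int y / real n)) has_sum s) UNIV"
proof -
  have "inj (\<lambda>y::int. of_int y / real n)" using assms by (auto simp: inj_on_def)
  from has_sum_reindex[OF this, of f s] show ?thesis by (simp add: lattice_def o_def)
qed

text \<open>The squared Vandermonde product times the weights is, up to a constant, the squared
  determinant of the orthonormal functions \<open>p k * sqrt w\<close>.\<close>

lemma ensemble_of_law:
  fixes \<nu> w :: "int \<Rightarrow> real"
  assumes n: "1 \<le> n" "n \<le> N" and w0: "\<And>y. 0 \<le> w y" and law: "is_ensemble_law \<nu> w n P"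
    and coeffs: "recurrence_coeffs \<nu> w a b" and supp: "support_at_least w N"
  obtains \<phi> where "ensemble n N (lattice n) \<phi> P"
    "\<And>i y. i + 1 < N \<Longrightarrow> rescale \<nu> n y * \<phi> i y =
       a i * \<phi> (i + 1) y + b i * \<phi> i y + (if i = 0 then 0 else a (i - 1) * \<phi> (i - 1) y)"
proof -
  obtain p :: "nat \<Rightarrow> real poly" where
    p1: "\<And>k. support_at_least w (k + 1) \<Longrightarrow> degree (p k) = k \<and> lead_coeff (p k) > 0"
    and p2: "\<And>k l. support_at_least w (k + 1) \<Longrightarrow> support_at_least w (l + 1) \<Longrightarrow>
           ((\<lambda>y. poly (p k) (\<nu> y) * poly (p l) (\<nu> y) * w y) has_sum (if k = l then 1 else 0)) UNIV"
    and p3: "\<And>j y. support_at_least w (j + 2) \<Longrightarrow>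
            \<nu> y * poly (p j) (\<nu> y) = a j * poly (p (j + 1)) (\<nu> y) + b j * poly (p j) (\<nu> y)
                  + (if j = 0 then 0 else a (j - 1) * poly (p (j - 1)) (\<nu> y))"
    using coeffs unfolding recurrence_coeffs_def by blast
  have sup: "support_at_least w (k + 1)" if "k < N" for k
    using support_at_least_mono[OF supp] that by auto
  define \<phi> where "\<phi> = (\<lambda>k x. poly (p k) (rescale \<nu> n x) * sqrt (rescale w n x))"
  have w0': "0 \<le> rescale w n x" for x by (simp add: rescale_def w0)
  have orth: "((\<lambda>y. \<phi> i y * \<phi> j y) has_sum (if i = j then 1 else 0)) (lattice n)" if "i < N" "j < N" for i j
    unfolding has_sum_lattice[OF n(1)]
  proof -
    have "\<phi> i (of_int y / real n) * \<phi> j (of_int y / real n) = poly (p i) (\<nu> y) * poly (p j) (\<nu> y) * w y" for y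
    proof -
      have "\<phi> i (of_int y / real n) * \<phi> j (of_int y / real n) =
          poly (p i) (\<nu> y) * poly (p j) (\<nu> y) * (sqrt (w y) * sqrt (w y))"
        unfolding \<phi>_def rescale_lattice[OF n(1)] by (simp only: mult_ac)
      then show ?thesis by (simp add: w0)
    qed
    then show "((\<lambda>y. \<phi> i (of_int y / real n) * \<phi> j (of_int y / real n)) has_sum (if i
      = j then 1 else 0)) UNIV"
      using p2[OF sup sup, OF that] by simp
  qed
  let ?S = "\<lambda>x. detn n (\<lambda>i j. \<phi> i (x (Suc j)))"
  let ?\<Omega> = "PiE {1..n} (\<lambda>_. lattice n)"
  define \<kappa> where "\<kappa> = (\<Prod>k<n. lead_coeff (p k))\<^sup>2"
  have deg: "degree (p k) = k" and lead: "0 < lead_coeff (p k)" if "k < n" for k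
    using p1[OF sup, of k] that n by auto
  have \<kappa>: "0 < \<kappa>"
    unfolding \<kappa>_def using lead by (intro zero_less_power prod_pos) auto
  have S2: "(?S x)\<^sup>2 = \<kappa> * ensemble_weight \<nu> w n x" if x: "x \<in> ?\<Omega>" for x
  proof -
    let ?z = "\<lambda>j. rescale \<nu> n (x (Suc j))" and ?s = "\<lambda>j. sqrt (rescale w n (x (Suc j)))"
    have "?S x = detn n (\<lambda>i j. poly (p i) (?z j)) * (\<Prod>j<n. ?s j)"
    proof -
      have "(\<Prod>i<n. \<phi> i (x (Suc (q i)))) = (\<Prod>i<n. poly (p i) (?z (q i))) * (\<Prod>j<n. ?s j)"
        if q: "q permutes {..<n}" for q
        using prod.permute[OF q, of ?s] by (simp add: \<phi>_def prod.distrib o_def)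
      then show ?thesis
        unfolding detn_def sum_distrib_right by (intro sum.cong refl) simp
    qed
    also have "detn n (\<lambda>i j. poly (p i) (?z j)) = (\<Prod>k<n. lead_coeff (p k)) * (\<Prod>j<n. \<Prod>i<j. ?z j - ?z i)"
      by (rule vandermonde_alternant[OF deg])
    finally have "(?S x)\<^sup>2 = \<kappa> * ((\<Prod>j<n. \<Prod>i<j. (?z j - ?z i)\<^sup>2) * (\<Prod>j<n. rescale w n (x (Suc j))))"
      by (simp add: \<kappa>_def power_mult_distrib prod_power_distrib w0')
    moreover have "(\<Prod>j\<in>{1..n}. \<Prod>i\<in>{1..<j}. (rescale \<nu> n (x i) - rescale \<nu> n (x j))\<^sup>2)
       = (\<Prod>j<n. \<Prod>i<j. (?z j - ?z i)\<^sup>2)"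
    proof -
      have "(\<Prod>j\<in>{1..n}. \<Prod>i\<in>{1..<j}. (rescale \<nu> n (x i) - rescale \<nu> n (x j))\<^sup>2) =
         (\<Prod>j<n. \<Prod>i\<in>{1..<Suc j}. (rescale \<nu> n (x i) - ?z j)\<^sup>2)"
        by (rule prod.reindex_bij_witness[of _ Suc "\<lambda>j. j - 1"]) auto
      also have "\<dots> = (\<Prod>j<n. \<Prod>i<j. (?z j - ?z i)\<^sup>2)"
      proof (rule prod.cong[OF refl])
        fix j
        show "(\<Prod>i\<in>{1..<Suc j}. (rescale \<nu> n (x i) - ?z j)\<^sup>2) = (\<Prod>i<j. (?z j - ?z i)\<^sup>2)"
          by (rule prod.reindex_bij_witness[of _ Suc "\<lambda>j. j - 1"]) (auto simp: power2_commute)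
      qed
      finally show ?thesis .
    qed
    moreover have "(\<Prod>j\<in>{1..n}. rescale w n (x j)) = (\<Prod>j<n. rescale w n (x (Suc j)))"
      by (rule prod.reindex_bij_witness[of _ Suc "\<lambda>j. j - 1"]) auto
    ultimately show ?thesis
      using x by (simp add: ensemble_weight_def)
  qed
  obtain c where c: "\<And>x. pmf P x = c * ensemble_weight \<nu> w n x"
    using law by (auto simp: is_ensemble_law_def)
  have total: "((\<lambda>x. (?S x)\<^sup>2) has_sum fact n) ?\<Omega>"
  proof -
    have "((\<lambda>x. ?S x * ?S x) has_sum (fact n * detn n (\<lambda>i j. if i = j then 1 else 0))) ?\<Omega>"
      by (rule andreief[where f = \<phi> and g = \<phi>]) (use orth n in auto)
    moreover have "detn n (\<lambda>i j. if i = j then 1 else 0) = 1"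
      by (subst detn_diagonal) auto
    ultimately show ?thesis by (simp add: power2_eq_square)
  qed
  have pmf_S: "pmf P x = c / \<kappa> * (?S x)\<^sup>2" if "x \<in> ?\<Omega>" for x
    using S2[OF that] c \<kappa> by simp
  have pmf_0: "pmf P x = 0" if "x \<notin> ?\<Omega>" for x
    using c that by (simp add: ensemble_weight_def)
  have "(pmf P has_sum 1) UNIV"
  proof -
    have "Infinite_Set_Sum.abs_summable_on (pmf P) UNIV" by (rule pmf_abs_summable)
    then show ?thesis
      using infsetsum_infsum[of "pmf P" UNIV] infsetsum_pmf_eq_1[of P UNIV]
      by (metis UNIV_I abs_summable_equivalent abs_summable_summable has_sum_infsum subsetI)
  qed
  \<comment> \<open>The total mass is computed twice, as 1 and by the Andreief identity; this
    determines the unknown normalising constant.\<close>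
  then have "(pmf P has_sum 1) ?\<Omega>"
    by (rule has_sum_cong_neutral[THEN iffD1, rotated -1]) (use pmf_0 in auto)
  moreover have "(pmf P has_sum (c / \<kappa> * fact n)) ?\<Omega>"
    using has_sum_cmult_right[OF total, of "c / \<kappa>"]
    by (rule has_sum_cong[THEN iffD1, rotated]) (use pmf_S in auto)
  ultimately have "c / \<kappa> * fact n = 1" using has_sum_unique by blast
  then have cn: "c / \<kappa> = 1 / fact n" by (rule eq_divide_imp[OF fact_nonzero])
  show ?thesis
  proof
    show "ensemble n N (lattice n) \<phi> P"
    proof
      show "n \<le> N" by (rule n)
      show "((\<lambda>y. \<phi> i y * \<phi> j y) has_sum (if i = j then 1 else 0)) (lattice n)" if "i < N" "j < N" for i j
        by (rule orth[OF that])
      show "pmf P x = (if x \<in> ?\<Omega> then (?S x)\<^sup>2 / fact n else 0)" for x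
        using pmf_S[of x] pmf_0[of x] cn by auto
    qed
    fix i y assume "i + 1 < N"
    then have "support_at_least w (i + 2)" using support_at_least_mono[OF supp] by auto
    from p3[OF this, of "\<lfloor>real n * y\<rfloor>"]
    have "sqrt (rescale w n y) * (rescale \<nu> n y * poly (p i) (rescale \<nu> n y)) =
       sqrt (rescale w n y) * (a i * poly (p (i + 1)) (rescale \<nu> n y) + b i * poly (p i) (rescale \<nu> n y)
                  + (if i = 0 then 0 else a (i - 1) * poly (p (i - 1)) (rescale \<nu> n y)))"
      by (simp add: rescale_def)
    then show "rescale \<nu> n y * \<phi> i y =
       a i * \<phi> (i + 1) y + b i * \<phi> i y + (if i = 0 then 0 else a (i - 1) * \<phi> (i - 1) y)"
      by (simp add: \<phi>_def algebra_simps split: if_splits)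
  qed
qed

section \<open>Polynomial statistics of a single ensemble\<close>

context ensemble begin

lemma poly_stat:
  assumes rec: "\<And>i y. i + 1 < N \<Longrightarrow> v y * \<phi> i y =
       a i * \<phi> (i + 1) y + b i * \<phi> i y + (if i = 0 then 0 else a (i - 1) * \<phi> (i - 1) y)"
  defines "G \<equiv> jacobi_poly a b"
  shows poly_stat_moment: "n + m * degree q \<le> N \<Longrightarrow>
      has_bochner_integral (measure_pmf P) (\<lambda>x. (stat (\<lambda>y. poly q (v y)) x - tr (G q)) ^ m)
        ((clift (tr (G q)) (G q) ^^ m) vac (\<lambda>i. i))"
    and poly_stat_mean: "n + degree q \<le> N \<Longrightarrow>
      has_bochner_integral (measure_pmf P) (stat (\<lambda>y. poly q (v y))) (tr (G q))"
    and poly_square_summable: "i + degree q < N \<Longrightarrow>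
      (\<lambda>y. (poly q (v y))\<^sup>2 * (\<phi> i y)\<^sup>2) summable_on L"
    and gram_poly: "i + degree q < N \<Longrightarrow> gram (\<lambda>y. poly q (v y)) i i = G q i i"
proof -
  have app: "poly q (v y) * \<phi> j y = (\<Sum>l<N. G q l j * \<phi> l y)" if "j + degree q < N" for j q y
    unfolding G_def using that by (intro jacobi_poly_apply rec)
  show mom: "has_bochner_integral (measure_pmf P) (\<lambda>x. (stat (\<lambda>y. poly q (v y)) x - tr (G q)) ^ m)
        ((clift (tr (G q)) (G q) ^^ m) vac (\<lambda>i. i))" if "n + m * degree q \<le> N" for m q
    by (rule centered_moment[where b = "degree q"])
      (use that app in \<open>auto simp: G_def banded_jacobi_poly\<close>)
  show "has_bochner_integral (measure_pmf P) (stat (\<lambda>y. poly q (v y))) (tr (G q))" if "n + degree q \<le> N"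
  proof -
    \<comment> \<open>The mean is the first moment: centred at \<open>tr (G q)\<close> it vanishes
      by \<open>lift_vac_id\<close>.\<close>
    have "has_bochner_integral (measure_pmf P) (\<lambda>x. (stat (\<lambda>y. poly q (v y)) x - tr (G q)) ^ 1 + tr (G q))
        ((clift (tr (G q)) (G q) ^^ 1) vac (\<lambda>i. i) + tr (G q))"
    proof (rule has_bochner_integral_add[OF mom])
      show "has_bochner_integral (measure_pmf P) (\<lambda>x. tr (G q)) (tr (G q))"
        by (simp add: has_bochner_integral_iff)
    qed (use that in simp)
    then show ?thesis by (simp add: clift_def lift_vac_id vac_id)
  qed
  show "(\<lambda>y. (poly q (v y))\<^sup>2 * (\<phi> i y)\<^sup>2) summable_on L" if i: "i + degree q < N"
  proof -
    have "((\<lambda>y. \<Sum>l<N. \<Sum>l'<N. (G q l i * G q l' i) * (\<phi> l y * \<phi> l' y)) has_sum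
        (\<Sum>l<N. \<Sum>l'<N. (G q l i * G q l' i) * (if l = l' then 1 else 0))) L"
      by (intro has_sum_sum_fun has_sum_cmult_right orth) auto
    moreover have "(\<Sum>l<N. \<Sum>l'<N. (G q l i * G q l' i) * (\<phi> l y * \<phi> l' y)) = (poly q (v y))\<^sup>2 * (\<phi> i y)\<^sup>2"
      for y
      unfolding power_mult_distrib[symmetric] app[OF i]
      by (simp add: power2_eq_square sum_product mult_ac)
    ultimately show ?thesis using has_sum_imp_summable by fastforce
  qed
  show "gram (\<lambda>y. poly q (v y)) i i = G q i i" if i: "i + degree q < N"
  proof -
    have "((\<lambda>y. \<Sum>l<N. G q l i * (\<phi> l y * \<phi> i y)) has_sum (\<Sum>l<N. G q l i * (if l = i then 1 else 0))) L"
      by (intro has_sum_sum_fun has_sum_cmult_right orth) (use i in auto)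
    moreover have "(\<Sum>l<N. G q l i * (\<phi> l y * \<phi> i y)) = poly q (v y) * (\<phi> i y * \<phi> i y)" for y
      using app[OF i, of y] by (simp add: sum_distrib_right mult.assoc[symmetric])
    moreover have "(\<Sum>l<N. G q l i * (if l = i then 1 else 0)) = G q i i"
      using i by (simp add: if_distrib cong: if_cong)
    ultimately show ?thesis unfolding gram_def by (simp add: infsumI)
  qed
qed

end

lemma (in ensemble) stat_eq: "stat u x = (\<Sum>j=1..n. u (x j))"
  by (simp add: stat_def sum.atLeast1_atMost_eq)

lemma linear_stat_eq:
  fixes L :: "real set"
  assumes "ensemble n N L \<phi> P" shows "linear_stat n u = ensemble.stat n u"
  by (rule ext) (simp only: linear_stat_def ensemble.stat_eq[OF assms])

lemma lip_constD:
  assumes "lip_const I E f < ennreal \<eta>" "x \<in> E \<inter> I" "y \<in> E \<inter> I"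
  shows "\<bar>f x - f y\<bar> \<le> \<eta> * \<bar>x - y\<bar>"
proof (cases "x = y")
  case False
  have "ennreal \<bar>(f x - f y) / (x - y)\<bar> \<le> lip_const I E f"
    unfolding lip_const_def using assms False by (intro SUP_upper2[of "(x, y)"]) auto
  also have "\<dots> < ennreal \<eta>" by (rule assms)
  finally have "\<bar>(f x - f y) / (x - y)\<bar> < \<eta>" by (simp add: ennreal_less_iff)
  then show ?thesis using False by (simp add: abs_divide divide_less_eq)
qed simp

lemma linear_stat_mono: "(\<And>x. u x \<le> v x) \<Longrightarrow> linear_stat n u x \<le> linear_stat n v x"
  by (auto simp: linear_stat_def intro: sum_mono)

lemma linear_stat_nonneg: "(\<And>x. 0 \<le> u x) \<Longrightarrow> 0 \<le> linear_stat n u x"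
  by (auto simp: linear_stat_def intro: sum_nonneg)

lemma linear_stat_add: "linear_stat n (\<lambda>y. u y + v y) x = linear_stat n u x + linear_stat n v x"
  by (simp add: linear_stat_def sum.distrib)

lemma linear_stat_cmult: "linear_stat n (\<lambda>y. c * u y) x = c * linear_stat n u x"
  by (simp add: linear_stat_def sum_distrib_left)

lemma linear_stat_sum: "linear_stat n (\<lambda>y. \<Sum>j\<in>J. c j * u j y) x = (\<Sum>j\<in>J. c j * linear_stat n (u j) x)"
  unfolding linear_stat_def by (subst sum.swap) (simp add: sum_distrib_left)

text \<open>\<open>tail_mu\<close> is a nonnegative integral, so its convergence includes eventual
  integrability. \<open>coeffs_exist\<close> provides any fixed number of levels above
  \<open>n\<close>, as many as the degree and moment order at hand demand.\<close>

locale ensemble_sequence =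
  fixes \<nu> w :: "nat \<Rightarrow> int \<Rightarrow> real"
    and P :: "nat \<Rightarrow> (nat \<Rightarrow> real) pmf"
    and a b :: "nat \<Rightarrow> nat \<Rightarrow> real"
    and \<mu> :: "real \<Rightarrow> real"
    and K :: "real set"
    and \<alpha> \<beta> :: real
  assumes nu_inj: "\<And>n. n \<ge> 1 \<Longrightarrow> inj (\<nu> n)"
    and w_nonneg: "\<And>n y. n \<ge> 1 \<Longrightarrow> w n y \<ge> 0"
    and law: "\<And>n. n \<ge> 1 \<Longrightarrow> is_ensemble_law (\<nu> n) (w n) n (P n)"
    and coeffs: "\<And>n. n \<ge> 1 \<Longrightarrow> recurrence_coeffs (\<nu> n) (w n) (a n) (b n)"
    and mu_K_compact: "compact (\<mu> ` K)"
    and tail: "\<And>k::nat.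
      (\<lambda>n. measure_pmf.expectation (P n)
             (linear_stat n (\<lambda>x. \<bar>rescale (\<nu> n) n x\<bar> ^ k * indicator (- K) x))) \<longlonglongrightarrow> 0"
    and tail_mu: "\<And>k::nat.
      (\<lambda>n. \<integral>\<^sup>+ x. ennreal (linear_stat n (\<lambda>t. \<bar>\<mu> t\<bar> ^ k * indicator (- K) t) x)
             \<partial>measure_pmf (P n)) \<longlonglongrightarrow> 0"
    and mu_conv:
      "(\<lambda>n. SUP x\<in>lattice n \<inter> K. ennreal \<bar>rescale (\<nu> n) n x - \<mu> x\<bar>) \<longlonglongrightarrow> 0"
    and mu_conv_lipschitz:
      "(\<lambda>n. lip_const (rescale (\<nu> n) n ` lattice n) (rescale (\<nu> n) n ` (lattice n \<inter> K))
              (\<lambda>t. (\<mu> \<circ> rescale_inv (\<nu> n) n) t - t)) \<longlonglongrightarrow> 0"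
    and coeffs_exist: "\<And>m::nat. \<forall>\<^sub>F n in sequentially. support_at_least (w n) (n + m)"
    and a_lim: "\<And>j::int. (\<lambda>n. a n (nat (j + int n))) \<longlonglongrightarrow> \<alpha>"
    and b_lim: "\<And>j::int. (\<lambda>n. b n (nat (j + int n))) \<longlonglongrightarrow> \<beta>"
begin

definition V :: "nat \<Rightarrow> real \<Rightarrow> real" where
  "V n = rescale (\<nu> n) n"

abbreviation expect :: "nat \<Rightarrow> ((nat \<Rightarrow> real) \<Rightarrow> real) \<Rightarrow> real" where
  "expect n \<equiv> measure_pmf.expectation (P n)"

abbreviation pstat :: "nat \<Rightarrow> real poly \<Rightarrow> (nat \<Rightarrow> real) \<Rightarrow> real" where
  "pstat n q \<equiv> linear_stat n (\<lambda>y. poly q (V n y))"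

definition ensemble_at :: "nat \<Rightarrow> nat \<Rightarrow> (nat \<Rightarrow> real \<Rightarrow> real) \<Rightarrow> bool" where
  "ensemble_at r n \<phi> \<longleftrightarrow> ensemble n (n + r) (lattice n) \<phi> (P n) \<and>
     (\<forall>i y. i + 1 < n + r \<longrightarrow> V n y * \<phi> i y =
       a n i * \<phi> (i + 1) y + b n i * \<phi> i y + (if i = 0 then 0 else a n (i - 1) * \<phi> (i - 1) y))"

lemma eventually_ensemble_at: "\<forall>\<^sub>F n in sequentially. 1 \<le> n \<and> (\<exists>\<phi>. ensemble_at r n \<phi>)"
  using coeffs_exist[of r] eventually_ge_at_top[of 1]
proof eventually_elim
  case (elim n)
  obtain \<phi> where "ensemble n (n + r) (lattice n) \<phi> (P n)"
    "\<And>i y. i + 1 < n + r \<Longrightarrow> rescale (\<nu> n) n y * \<phi> i y =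
       a n i * \<phi> (i + 1) y + b n i * \<phi> i y + (if i = 0 then 0 else a n (i - 1) * \<phi> (i - 1) y)"
    using ensemble_of_law[of n "n + r" "w n" "\<nu> n" "P n" "a n" "b n"]
      elim w_nonneg law coeffs by auto
  then show ?case using elim by (auto simp: ensemble_at_def V_def)
qed

lemma poly_moment:
  shows poly_moment_integrable:
      "\<forall>\<^sub>F n in sequentially. integrable (measure_pmf (P n)) (\<lambda>x. (pstat n q x - expect n (pstat n q)) ^ m)"
    and poly_moment_tendsto:
      "(\<lambda>n. expect n (\<lambda>x. (pstat n q x - expect n (pstat n q)) ^ m))
         \<longlonglongrightarrow> gaussian_moment (symbol_variance \<alpha> \<beta> q) m"
proof -
  define r where "r = (m + 3) * degree q"
  let ?G = "\<lambda>n. jacobi_poly (a n) (b n) q"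
  let ?M = "\<lambda>n. (levels.clift n (n + r) (levels.tr n (?G n)) (?G n) ^^ m) (levels.vac n) (\<lambda>i. i)"
  have ev: "\<forall>\<^sub>F n in sequentially. integrable (measure_pmf (P n)) (pstat n q) \<and>
      has_bochner_integral (measure_pmf (P n)) (\<lambda>x. (pstat n q x - expect n (pstat n q)) ^ m) (?M n)"
    using eventually_ensemble_at[of r]
  proof eventually_elim
    case (elim n)
    then obtain \<phi> where \<phi>: "ensemble_at r n \<phi>" by auto
    then interpret ensemble n "n + r" "lattice n" \<phi> "P n" by (simp add: ensemble_at_def)
    have rec: "V n y * \<phi> i y = a n i * \<phi> (i + 1) y + b n i * \<phi> i y
        + (if i = 0 then 0 else a n (i - 1) * \<phi> (i - 1) y)" if "i + 1 < n + r" for i y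
      using \<phi> that by (simp add: ensemble_at_def)
    have r: "degree q \<le> r" "m * degree q \<le> r" by (auto simp: r_def add_mult_distrib)
    have st: "pstat n q = stat (\<lambda>y. poly q (V n y))"
      using linear_stat_eq ensemble_axioms by blast
    have mean: "has_bochner_integral (measure_pmf (P n)) (stat (\<lambda>y. poly q (V n y))) (tr (?G n))"
      using r by (intro poly_stat_mean[OF rec]) auto
    have "has_bochner_integral (measure_pmf (P n)) (\<lambda>x. (stat (\<lambda>y. poly q (V n y)) x - tr (?G n)) ^ m) (?M n)"
      using r by (intro poly_stat_moment[OF rec]) auto
    then show ?case
      unfolding st using mean by (simp add: has_bochner_integral_iff)
  qed
  then show "\<forall>\<^sub>F n in sequentially. integrable (measure_pmf (P n)) (\<lambda>x. (pstat n q x - expect n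
    (pstat n q)) ^ m)"
    by (auto elim!: eventually_mono simp: has_bochner_integral_iff)
  have "?M \<longlonglongrightarrow> gaussian_moment (symbol_variance \<alpha> \<beta> q) m"
    by (intro clift_moment_tendsto a_lim b_lim) (simp add: r_def)
  then show "(\<lambda>n. expect n (\<lambda>x. (pstat n q x - expect n (pstat n q)) ^ m))
         \<longlonglongrightarrow> gaussian_moment (symbol_variance \<alpha> \<beta> q) m"
    by (rule Lim_transform_eventually)
      (use ev in \<open>auto elim!: eventually_mono simp: has_bochner_integral_iff\<close>)
qed

lemma poly_variance_tendsto:
  "(\<lambda>n. expect n (\<lambda>x. (pstat n q x - expect n (pstat n q))\<^sup>2)) \<longlonglongrightarrow> symbol_variance \<alpha> \<beta> q"
  using poly_moment_tendsto[of q 2] by (simp add: numeral_2_eq_2)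

text \<open>\<open>tail\<close> is stated with Bochner integrals, which are 0 for non-integrable
  functions, so it gives information only together with integrability. This follows from square
  summability of polynomials against each level.\<close>

lemma power_tail_integrable:
  "\<forall>\<^sub>F n in sequentially. integrable (measure_pmf (P n)) (linear_stat n (\<lambda>x. \<bar>V n x\<bar> ^ k * indicator
    (- K) x))"
  using eventually_ensemble_at[of "k + 1"]
proof eventually_elim
  case (elim n)
  then obtain \<phi> where \<phi>: "ensemble_at (k + 1) n \<phi>" by auto
  then interpret ensemble n "n + (k + 1)" "lattice n" \<phi> "P n" by (simp add: ensemble_at_def)
  have rec: "V n y * \<phi> i y = a n i * \<phi> (i + 1) y + b n i * \<phi> i y
      + (if i = 0 then 0 else a n (i - 1) * \<phi> (i - 1) y)" if "i + 1 < n + (k + 1)" for i y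
    using \<phi> that by (simp add: ensemble_at_def)
  have "(\<lambda>y. \<bar>\<bar>V n y\<bar> ^ k * indicator (- K) y\<bar> * (\<phi> i y)\<^sup>2) summable_on lattice n" if i: "i < n" for i
  proof (rule has_sum_abs_le)
    have "(\<lambda>y. (poly (monom 1 k) (V n y))\<^sup>2 * (\<phi> i y)\<^sup>2) summable_on lattice n"
      by (rule poly_square_summable[OF rec]) (use i in \<open>auto simp: degree_monom_eq\<close>)
    then show "(\<lambda>y. (poly (monom 1 k) (V n y))\<^sup>2 * (\<phi> i y)\<^sup>2 + (\<phi> i y)\<^sup>2) summable_on lattice n"
      by (intro summable_on_add phi_square_summable i)
    fix y
    have "\<bar>V n y\<bar> ^ k \<le> (\<bar>V n y\<bar> ^ k)\<^sup>2 + 1"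
      using sum_squares_bound[of "\<bar>V n y\<bar> ^ k" 1] zero_le_power[OF abs_ge_zero, of "V n y" k]
      unfolding mult_1_right power_one by linarith
    then have "\<bar>\<bar>V n y\<bar> ^ k * indicator (- K) y\<bar> \<le> (poly (monom 1 k) (V n y))\<^sup>2 + 1"
      by (auto simp: indicator_def poly_monom power_even_abs power_mult[symmetric] mult.commute[of k])
    then have "\<bar>\<bar>V n y\<bar> ^ k * indicator (- K) y\<bar> * (\<phi> i y)\<^sup>2 \<le> ((poly (monom 1 k) (V n y))\<^sup>2 + 1) * (\<phi> i y)\<^sup>2"
      by (rule mult_right_mono) simp
    then show "\<bar>\<bar>\<bar>V n y\<bar> ^ k * indicator (- K) y\<bar> * (\<phi> i y)\<^sup>2\<bar>
      \<le> (poly (monom 1 k) (V n y))\<^sup>2 * (\<phi> i y)\<^sup>2 + (\<phi> i y)\<^sup>2"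
      by (simp add: algebra_simps abs_mult)
  qed
  then have "has_bochner_integral (measure_pmf (P n)) (stat (\<lambda>x. \<bar>V n x\<bar> ^ k * indicator (- K) x))
      (\<Sum>i<n. gram (\<lambda>x. \<bar>V n x\<bar> ^ k * indicator (- K) x) i i)"
    by (rule mean_stat)
  then show ?case
    using linear_stat_eq[OF ensemble_axioms] by (simp add: has_bochner_integral_iff)
qed

lemma poly_tail:
  shows poly_tail_integrable: "\<forall>\<^sub>F n in sequentially. integrable (measure_pmf (P n))
      (linear_stat n (\<lambda>x. \<bar>poly q (V n x)\<bar> * indicator (- K) x))"
    and poly_tail_tendsto:
      "(\<lambda>n. expect n (linear_stat n (\<lambda>x. \<bar>poly q (V n x)\<bar> * indicator (- K) x))) \<longlonglongrightarrow> 0"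
proof -
  let ?T = "\<lambda>n j. linear_stat n (\<lambda>x. \<bar>V n x\<bar> ^ j * indicator (- K) x)"
  have bound: "linear_stat n (\<lambda>x. \<bar>poly q (V n x)\<bar> * indicator (- K) x) x
      \<le> (\<Sum>j\<le>degree q. \<bar>coeff q j\<bar> * ?T n j x)" for n x
    unfolding linear_stat_sum[symmetric]
  proof (rule linear_stat_mono)
    fix y
    have "\<bar>poly q (V n y)\<bar> \<le> (\<Sum>j\<le>degree q. \<bar>coeff q j\<bar> * \<bar>V n y\<bar> ^ j)"
      unfolding poly_altdef by (rule order_trans[OF sum_abs]) (simp add: abs_mult power_abs)
    then show "\<bar>poly q (V n y)\<bar> * indicator (- K) y
       \<le> (\<Sum>j\<le>degree q. \<bar>coeff q j\<bar> * (\<bar>V n y\<bar> ^ j * indicator (- K) y))"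
      by (auto simp: indicator_def)
  qed
  have nonneg: "0 \<le> linear_stat n (\<lambda>x. \<bar>poly q (V n x)\<bar> * indicator (- K) x) x" for n x
    by (rule linear_stat_nonneg) simp
  have ev: "\<forall>\<^sub>F n in sequentially. \<forall>j\<in>{..degree q}. integrable (measure_pmf (P n)) (?T n j)"
    by (intro eventually_ball_finite ballI power_tail_integrable) auto
  then show int: "\<forall>\<^sub>F n in sequentially. integrable (measure_pmf (P n))
      (linear_stat n (\<lambda>x. \<bar>poly q (V n x)\<bar> * indicator (- K) x))"
  proof eventually_elim
    case (elim n)
    show ?case
    proof (rule Bochner_Integration.integrable_bound)
      show "integrable (measure_pmf (P n)) (\<lambda>x. \<Sum>j\<le>degree q. \<bar>coeff q j\<bar> * ?T n j x)"
        using elim by (intro Bochner_Integration.integrable_sum integrable_mult_right) auto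
      show "AE x in measure_pmf (P n). norm (linear_stat n (\<lambda>x. \<bar>poly q (V n x)\<bar> * indicator (- K) x) x)
        \<le> norm (\<Sum>j\<le>degree q. \<bar>coeff q j\<bar> * ?T n j x)"
        unfolding real_norm_def abs_of_nonneg[OF nonneg]
        by (rule AE_I2) (rule order_trans[OF bound abs_ge_self])
    qed simp
  qed
  show "(\<lambda>n. expect n (linear_stat n (\<lambda>x. \<bar>poly q (V n x)\<bar> * indicator (- K) x))) \<longlonglongrightarrow> 0"
  proof (rule tendsto_sandwich[OF _ _ tendsto_const])
    show "\<forall>\<^sub>F n in sequentially. 0 \<le> expect n (linear_stat n (\<lambda>x. \<bar>poly q (V n x)\<bar> * indicator (- K) x))"
      by (intro always_eventually allI integral_nonneg_AE AE_I2 nonneg)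
    have "(\<lambda>n. \<Sum>j\<le>degree q. \<bar>coeff q j\<bar> * expect n (?T n j)) \<longlonglongrightarrow> (\<Sum>j\<le>degree q. \<bar>coeff q j\<bar> * 0)"
      unfolding V_def by (intro tendsto_intros tail)
    then show "(\<lambda>n. \<Sum>j\<le>degree q. \<bar>coeff q j\<bar> * expect n (?T n j)) \<longlonglongrightarrow> 0" by simp
    show "\<forall>\<^sub>F n in sequentially. expect n (linear_stat n (\<lambda>x. \<bar>poly q (V n x)\<bar> * indicator (- K) x))
       \<le> (\<Sum>j\<le>degree q. \<bar>coeff q j\<bar> * expect n (?T n j))"
      using ev int
    proof eventually_elim
      case (elim n)
      have "expect n (linear_stat n (\<lambda>x. \<bar>poly q (V n x)\<bar> * indicator (- K) x))
         \<le> expect n (\<lambda>x. \<Sum>j\<le>degree q. \<bar>coeff q j\<bar> * ?T n j x)"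
        using elim by (intro integral_mono bound Bochner_Integration.integrable_sum
          integrable_mult_right) auto
      also have "\<dots> = (\<Sum>j\<le>degree q. \<bar>coeff q j\<bar> * expect n (?T n j))"
        using elim by (subst Bochner_Integration.integral_sum) auto
      finally show ?case .
    qed
  qed
qed

lemma mu_tail:
  shows mu_tail_finite: "\<forall>\<^sub>F n in sequentially.
      (\<integral>\<^sup>+ x. ennreal (linear_stat n (\<lambda>t. \<bar>\<mu> t\<bar> ^ k * indicator (- K) t) x) \<partial>measure_pmf (P n)) < \<infinity>"
    and mu_tail_integrable: "\<forall>\<^sub>F n in sequentially. integrable (measure_pmf (P n))
      (linear_stat n (\<lambda>t. \<bar>\<mu> t\<bar> ^ k * indicator (- K) t))"
    and mu_tail_tendsto:
      "(\<lambda>n. expect n (linear_stat n (\<lambda>t. \<bar>\<mu> t\<bar> ^ k * indicator (- K) t))) \<longlonglongrightarrow> 0"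
proof -
  let ?T = "\<lambda>n. linear_stat n (\<lambda>t. \<bar>\<mu> t\<bar> ^ k * indicator (- K) t)"
  have nonneg: "0 \<le> ?T n x" for n x by (rule linear_stat_nonneg) simp
  show ev: "\<forall>\<^sub>F n in sequentially. (\<integral>\<^sup>+ x. ennreal (?T n x) \<partial>measure_pmf (P n)) < \<infinity>"
    by (rule order_tendstoD(2)[OF tail_mu]) simp
  then show "\<forall>\<^sub>F n in sequentially. integrable (measure_pmf (P n)) (?T n)"
    by eventually_elim (rule integrableI_nonneg, auto simp: nonneg)
  have "expect n (?T n) = enn2real (\<integral>\<^sup>+ x. ennreal (?T n x) \<partial>measure_pmf (P n))" for n
    by (rule integral_eq_nn_integral) (auto simp: nonneg)
  moreover have "(\<lambda>n. enn2real (\<integral>\<^sup>+ x. ennreal (?T n x) \<partial>measure_pmf (P n))) \<longlonglongrightarrow> 0"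
    by (rule tendsto_enn2real) (use tail_mu in auto)
  ultimately show "(\<lambda>n. expect n (?T n)) \<longlonglongrightarrow> 0" by simp
qed

section \<open>Comparison of \<mu> with its discretizations on K\<close>

lemma inj_V:
  assumes "1 \<le> n" shows "inj_on (V n) (lattice n)"
proof -
  have "inj (\<nu> n)" using assms by (rule nu_inj)
  then show ?thesis
    unfolding V_def lattice_def using assms
    by (intro inj_on_imageI) (auto simp: inj_on_def rescale_lattice)
qed

lemma mu_close:
  assumes "0 < \<eta>"
  shows "\<forall>\<^sub>F n in sequentially. \<forall>x\<in>lattice n \<inter> K. \<bar>V n x - \<mu> x\<bar> \<le> \<eta>"
proof -
  have "\<forall>\<^sub>F n in sequentially. (SUP x\<in>lattice n \<inter> K. ennreal \<bar>V n x - \<mu> x\<bar>) < ennreal \<eta>"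
    using order_tendstoD(2)[OF mu_conv, of "ennreal \<eta>"] assms by (simp add: V_def)
  then show ?thesis
  proof eventually_elim
    case (elim n)
    show ?case
    proof
      fix x assume "x \<in> lattice n \<inter> K"
      then have "ennreal \<bar>V n x - \<mu> x\<bar> \<le> (SUP x\<in>lattice n \<inter> K. ennreal \<bar>V n x - \<mu> x\<bar>)"
        by (intro SUP_upper) auto
      then have "ennreal \<bar>V n x - \<mu> x\<bar> < ennreal \<eta>" using elim by (rule le_less_trans)
      then show "\<bar>V n x - \<mu> x\<bar> \<le> \<eta>" by (simp add: ennreal_less_iff)
    qed
  qed
qed

lemma mu_close_lipschitz:
  assumes "0 < \<eta>"
  shows "\<forall>\<^sub>F n in sequentially. \<forall>x\<in>lattice n \<inter> K. \<forall>y\<in>lattice n \<inter> K.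
     \<bar>(\<mu> x - V n x) - (\<mu> y - V n y)\<bar> \<le> \<eta> * \<bar>V n x - V n y\<bar>"
proof -
  have "\<forall>\<^sub>F n in sequentially. lip_const (V n ` lattice n) (V n ` (lattice n \<inter> K))
              (\<lambda>t. (\<mu> \<circ> rescale_inv (\<nu> n) n) t - t) < ennreal \<eta>"
    using order_tendstoD(2)[OF mu_conv_lipschitz, of "ennreal \<eta>"] assms by (simp add: V_def)
  then show ?thesis using eventually_ge_at_top[of 1]
  proof eventually_elim
    case (elim n)
    have inv: "rescale_inv (\<nu> n) n (V n x) = x" if "x \<in> lattice n" for x
      using inv_into_f_f[OF inj_V[OF elim(2)] that] by (simp add: rescale_inv_def V_def)
    show ?case
    proof (intro ballI)
      fix x y assume xy: "x \<in> lattice n \<inter> K" "y \<in> lattice n \<inter> K"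
      show "\<bar>(\<mu> x - V n x) - (\<mu> y - V n y)\<bar> \<le> \<eta> * \<bar>V n x - V n y\<bar>"
        using lip_constD[OF elim(1), of "V n x" "V n y"] xy by (auto simp: inv)
    qed
  qed
qed

text \<open>The limiting variance of the linear statistic of \<mu>_n itself, the yardstick of the
  Lipschitz bounds.\<close>

definition var_unit :: real where
  "var_unit = symbol_variance \<alpha> \<beta> [:0, 1:]"

lemma var_unit_nonneg: "0 \<le> var_unit"
  by (auto simp: var_unit_def symbol_variance_def intro!: sum_nonneg)

lemma mu_K_bound:
  obtains R where "0 < R" "\<And>x. x \<in> K \<Longrightarrow> \<bar>\<mu> x\<bar> \<le> R"
  using compact_imp_bounded[OF mu_K_compact] unfolding bounded_pos by auto

text \<open>Split the difference at \<open>poly q (\<mu> x)\<close>. The part \<open>h - q\<close>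
  at \<mu> inherits \<delta>, up to the factor \<open>1 + \<eta>\<close> for passing from \<mu> to
  \<open>V n\<close>; replacing \<mu> by \<open>V n\<close> inside \<open>q\<close> is
  \<open>poly_shift_lipschitz\<close>.\<close>

lemma difference_lipschitz:
  assumes lip: "\<And>s t. s \<in> \<mu> ` K \<Longrightarrow> t \<in> \<mu> ` K \<Longrightarrow> \<bar>(h s - poly q s) - (h t - poly q t)\<bar> \<le> \<delta> * \<bar>s - t\<bar>"
    and \<delta>: "0 \<le> \<delta>"
  shows "\<exists>C>0. \<forall>\<eta>. 0 < \<eta> \<longrightarrow> \<eta> \<le> 1 \<longrightarrow> (\<forall>\<^sub>F n in sequentially.
     \<forall>x\<in>lattice n \<inter> K. \<forall>y\<in>lattice n \<inter> K.
       \<bar>(h (\<mu> x) - poly q (V n x)) - (h (\<mu> y) - poly q (V n y))\<bar> \<le> (\<delta> * (1 + \<eta>) + C * \<eta>) * \<bar>V n x - V n y\<bar>)"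
proof -
  obtain R where R: "0 < R" "\<And>x. x \<in> K \<Longrightarrow> \<bar>\<mu> x\<bar> \<le> R" using mu_K_bound by blast
  obtain C where C: "0 < C"
    "\<And>\<eta> v v' e e'. \<bar>v\<bar> \<le> R + 1 \<Longrightarrow> \<bar>v'\<bar> \<le> R + 1 \<Longrightarrow> \<bar>e\<bar> \<le> \<eta> \<Longrightarrow> \<bar>e'\<bar> \<le> \<eta> \<Longrightarrow> \<eta> \<le> 1 \<Longrightarrow> \<bar>e - e'\<bar> \<le> \<eta> * \<bar>v - v'\<bar> \<Longrightarrow>
       \<bar>(poly q (v + e) - poly q v) - (poly q (v' + e') - poly q v')\<bar> \<le> C * \<eta> * \<bar>v - v'\<bar>"
    by (rule poly_shift_lipschitz) (rule that)
  show ?thesis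
  proof (intro exI[of _ C] conjI C(1) allI impI)
    fix \<eta> :: real assume \<eta>: "0 < \<eta>" "\<eta> \<le> 1"
    show "\<forall>\<^sub>F n in sequentially. \<forall>x\<in>lattice n \<inter> K. \<forall>y\<in>lattice n \<inter> K.
       \<bar>(h (\<mu> x) - poly q (V n x)) - (h (\<mu> y) - poly q (V n y))\<bar> \<le> (\<delta> * (1 + \<eta>) + C * \<eta>) * \<bar>V n x - V n y\<bar>"
      using mu_close[OF \<eta>(1)] mu_close_lipschitz[OF \<eta>(1)]
    proof eventually_elim
      case (elim n)
      show ?case
      proof (intro ballI)
        fix x y assume xy: "x \<in> lattice n \<inter> K" "y \<in> lattice n \<inter> K"
        have cl: "\<bar>V n x - \<mu> x\<bar> \<le> \<eta>" "\<bar>V n y - \<mu> y\<bar> \<le> \<eta>" using elim xy by auto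
        have li: "\<bar>(\<mu> x - V n x) - (\<mu> y - V n y)\<bar> \<le> \<eta> * \<bar>V n x - V n y\<bar>" using elim xy by auto
        have "\<bar>V n x\<bar> \<le> R + 1" "\<bar>V n y\<bar> \<le> R + 1"
          using R(2)[of x] R(2)[of y] cl xy \<eta> by auto
        then have 1: "\<bar>(poly q (V n x + (\<mu> x - V n x)) - poly q (V n x)) - (poly q (V n y + (\<mu> y
          - V n y)) - poly q (V n y))\<bar>
            \<le> C * \<eta> * \<bar>V n x - V n y\<bar>"
          using cl li \<eta> by (intro C(2)) auto
        have "\<bar>(h (\<mu> x) - poly q (\<mu> x)) - (h (\<mu> y) - poly q (\<mu> y))\<bar> \<le> \<delta> * \<bar>\<mu> x - \<mu> y\<bar>"
          using xy by (intro lip) auto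
        also have "\<bar>\<mu> x - \<mu> y\<bar> \<le> (1 + \<eta>) * \<bar>V n x - V n y\<bar>"
          using li by (simp add: algebra_simps)
        then have "\<delta> * \<bar>\<mu> x - \<mu> y\<bar> \<le> \<delta> * ((1 + \<eta>) * \<bar>V n x - V n y\<bar>)"
          using \<delta> by (rule mult_left_mono)
        finally have 2: "\<bar>(h (\<mu> x) - poly q (\<mu> x)) - (h (\<mu> y) - poly q (\<mu> y))\<bar> \<le> \<delta> * ((1 + \<eta>) * \<bar>V n x
          - V n y\<bar>)" .
        show "\<bar>(h (\<mu> x) - poly q (V n x)) - (h (\<mu> y) - poly q (V n y))\<bar> \<le> (\<delta> * (1 + \<eta>) + C * \<eta>) * \<bar>V n x
          - V n y\<bar>"
          using 1 2 by (simp add: algebra_simps)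
      qed
    qed
  qed
qed

text \<open>The comparison of a general statistic with a polynomial one. On \<open>K\<close> it
  rests on \<open>difference_lipschitz\<close>; off \<open>K\<close>, the growth bound and the two
  tail conditions make the contribution vanish in the limit.\<close>

lemma variance_bound_eventually:
  fixes f h :: "real \<Rightarrow> real"
  assumes fh: "\<And>x. f x = h (\<mu> x)"
    and Bh: "\<And>t. t \<in> \<mu> ` K \<Longrightarrow> \<bar>h t\<bar> \<le> Bh"
    and growth: "\<And>t. t \<in> range \<mu> \<Longrightarrow> \<bar>h t\<bar> \<le> C0 * (1 + \<bar>t\<bar> ^ m)"
    and lip: "\<And>s t. s \<in> \<mu> ` K \<Longrightarrow> t \<in> \<mu> ` K \<Longrightarrow> \<bar>(h s - poly q s) - (h t - poly q t)\<bar> \<le> \<delta> * \<bar>s - t\<bar>"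
    and \<delta>: "0 \<le> \<delta>" and \<eta>: "0 < \<eta>"
  defines "Z \<equiv> \<lambda>n x. (linear_stat n f x - expect n (linear_stat n f)) - (pstat n q x - expect n (pstat n q))"
  shows "\<forall>\<^sub>F n in sequentially. integrable (measure_pmf (P n)) (linear_stat n f) \<and>
     integrable (measure_pmf (P n)) (pstat n q) \<and>
     integrable (measure_pmf (P n)) (\<lambda>x. (Z n x)\<^sup>2) \<and> expect n (\<lambda>x. (Z n x)\<^sup>2) \<le> \<delta>\<^sup>2 * var_unit + \<eta>"
proof -
  obtain C where C: "0 < C" "\<And>\<eta>. 0 < \<eta> \<Longrightarrow> \<eta> \<le> 1 \<Longrightarrow> \<forall>\<^sub>F n in sequentially.
     \<forall>x\<in>lattice n \<inter> K. \<forall>y\<in>lattice n \<inter> K.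
       \<bar>(h (\<mu> x) - poly q (V n x)) - (h (\<mu> y) - poly q (V n y))\<bar> \<le> (\<delta> * (1 + \<eta>) + C * \<eta>) * \<bar>V n x - V n y\<bar>"
    using difference_lipschitz[where h = h and q = q, OF lip \<delta>] by blast
  obtain R where R: "0 < R" "\<And>x. x \<in> K \<Longrightarrow> \<bar>\<mu> x\<bar> \<le> R" using mu_K_bound by blast
  obtain Mq where Mq: "0 < Mq" "\<And>x. x \<in> {-(R+1)..R+1} \<Longrightarrow> \<bar>poly q x\<bar> \<le> Mq"
    using poly_bounded_interval by blast
  define B where "B = \<bar>Bh\<bar> + Mq"
  let ?I = "\<lambda>n. linear_stat n (indicator (- K))"
  let ?Tm = "\<lambda>n k. linear_stat n (\<lambda>t. \<bar>\<mu> t\<bar> ^ k * indicator (- K) t)"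
  let ?Tq = "\<lambda>n. linear_stat n (\<lambda>x. \<bar>poly (q * q) (V n x)\<bar> * indicator (- K) x)"
  define u where "u = (\<lambda>n x. f x - poly q (V n x))"
  let ?U = "\<lambda>n. linear_stat n (\<lambda>y. (u n y)\<^sup>2 * indicator (- K) y)"
  \<comment> \<open>Dominates the tail of the squared difference, using \<open>f\<^sup>2 \<le> 2 *
    C0\<^sup>2 * (1 + \<bar>\<mu>\<bar> ^ (2 * m))\<close> and
    \<open>(f - q)\<^sup>2 \<le> 2 * f\<^sup>2 + 2 * q\<^sup>2\<close>.\<close>
  define W where "W = (\<lambda>n. 4 * C0\<^sup>2 * (expect n (?Tm n 0) + expect n (?Tm n (2 * m))) + 2 * expect n (?Tq n))"
  have W0: "W \<longlonglongrightarrow> 0"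
  proof -
    have "W \<longlonglongrightarrow> 4 * C0\<^sup>2 * (0 + 0) + 2 * 0"
      unfolding W_def by (intro tendsto_intros mu_tail_tendsto poly_tail_tendsto)
    then show ?thesis by simp
  qed
  have I0: "(\<lambda>n. expect n (?I n)) \<longlonglongrightarrow> 0" using mu_tail_tendsto[of 0] by simp
  \<comment> \<open>All errors share one tolerance \<open>e\<close>. The total bound is continuous
    in \<open>e\<close> with value \<open>\<delta>\<^sup>2 * var_unit\<close> at 0, so some
    \<open>e\<close> keeps it within \<eta>.\<close>
  have "((\<lambda>e. (\<delta> * (1 + e) + C * e)\<^sup>2 * (var_unit + e) + 4 * e + 2 * B\<^sup>2 * e) \<longlongrightarrow>
      (\<delta> * (1 + 0) + C * 0)\<^sup>2 * (var_unit + 0) + 4 * 0 + 2 * B\<^sup>2 * 0) (at_right 0)"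
    by (intro tendsto_intros)
  then have "\<forall>\<^sub>F e in at_right 0. (\<delta> * (1 + e) + C * e)\<^sup>2 * (var_unit + e) + 4 * e
    + 2 * B\<^sup>2 * e < \<delta>\<^sup>2 * var_unit + \<eta>"
    using \<eta> by (intro order_tendstoD(2)) auto
  moreover have "\<forall>\<^sub>F e in at_right (0::real). e \<in> {0<..<1}"
    by (rule eventually_at_right_real) simp
  ultimately obtain e where e: "0 < e" "e \<le> 1"
    "(\<delta> * (1 + e) + C * e)\<^sup>2 * (var_unit + e) + 4 * e + 2 * B\<^sup>2 * e < \<delta>\<^sup>2 * var_unit + \<eta>"
    using eventually_happens[OF eventually_conj, of _ "at_right (0::real)"] trivial_limit_at_right_real
    by (metis (no_types, lifting) greaterThanLessThan_iff less_imp_le)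
  have evW: "\<forall>\<^sub>F n in sequentially. W n < e" by (rule order_tendstoD(2)[OF W0 e(1)])
  have evI: "\<forall>\<^sub>F n in sequentially. expect n (?I n) < e" by (rule order_tendstoD(2)[OF I0 e(1)])
  have evV: "\<forall>\<^sub>F n in sequentially. expect n (\<lambda>x. (pstat n [:0, 1:] x - expect n
    (pstat n [:0, 1:]))\<^sup>2) < var_unit + e"
    using e(1) by (intro order_tendstoD(2)[OF poly_variance_tendsto]) (simp add: var_unit_def)
  show ?thesis
    using eventually_ensemble_at[of "degree q + 2"] C(2)[OF e(1,2)] mu_close[OF e(1)] evW evI evV
      mu_tail_finite[of 0] mu_tail_finite[of "2 * m"] mu_tail_integrable[of 0] mu_tail_integrable[of "2 * m"]
      poly_tail_integrable[of "q * q"]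
  proof eventually_elim
    case (elim n)
    let ?r = "degree q + 2"
    from elim(1) obtain \<phi> where \<phi>: "ensemble_at ?r n \<phi>" by auto
    then interpret ensemble n "n + ?r" "lattice n" \<phi> "P n" by (simp add: ensemble_at_def)
    have rec: "V n y * \<phi> i y = a n i * \<phi> (i + 1) y + b n i * \<phi> i y
        + (if i = 0 then 0 else a n (i - 1) * \<phi> (i - 1) y)" if "i + 1 < n + ?r" for i y
      using \<phi> that by (simp add: ensemble_at_def)
    note ls = linear_stat_eq[OF ensemble_axioms]
    have q2: "(\<lambda>y. (poly q (V n y))\<^sup>2 * (\<phi> i y)\<^sup>2) summable_on lattice n" if "i < n" for i
      by (rule poly_square_summable[OF rec]) (use that in auto)
    have v2: "(\<lambda>y. (poly [:0, 1:] (V n y))\<^sup>2 * (\<phi> i y)\<^sup>2) summable_on lattice n" if "i < n" for i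
      by (rule poly_square_summable[OF rec]) (use that in auto)
    have ms: "(\<lambda>y. (\<bar>\<mu> y\<bar> ^ k * indicator (- K) y) * (\<phi> i y)\<^sup>2) summable_on lattice n"
      if "i < n" "k = 0 \<or> k = 2 * m" for i k
    proof (rule summable_of_finite_mean)
      show "(\<integral>\<^sup>+x. ennreal (stat (\<lambda>y. \<bar>\<mu> y\<bar> ^ k * indicator (- K) y) x) \<partial>measure_pmf (P n)) < \<infinity>"
        using that(2) elim(7,8) unfolding ls by metis
    qed (use that in auto)
    have fpt: "(f y)\<^sup>2 \<le> 2 * C0\<^sup>2 * (1 + \<bar>\<mu> y\<bar> ^ (2 * m))" for y
    proof -
      have "\<bar>f y\<bar> \<le> C0 * (1 + \<bar>\<mu> y\<bar> ^ m)" unfolding fh by (rule growth) simp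
      then have "(f y)\<^sup>2 \<le> (C0 * (1 + \<bar>\<mu> y\<bar> ^ m))\<^sup>2"
        by (metis abs_ge_zero power2_abs power_mono)
      also have "\<dots> = C0\<^sup>2 * (1 + \<bar>\<mu> y\<bar> ^ m)\<^sup>2" by (simp add: power_mult_distrib)
      also have "\<dots> \<le> C0\<^sup>2 * (2 * (1 + (\<bar>\<mu> y\<bar> ^ m)\<^sup>2))"
        using sum_squares_bound[of 1 "\<bar>\<mu> y\<bar> ^ m"] by (intro mult_left_mono) (auto simp: power2_sum)
      also have "(\<bar>\<mu> y\<bar> ^ m)\<^sup>2 = \<bar>\<mu> y\<bar> ^ (2 * m)"
        by (simp only: power_mult[symmetric] mult.commute)
      finally show ?thesis by (simp only: mult.assoc mult.left_commute)
    qed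
    have fbd: "(f y)\<^sup>2 \<le> Bh\<^sup>2" if "y \<in> K" for y
      using Bh[of "\<mu> y"] that unfolding fh by (metis abs_ge_zero image_eqI power2_abs power_mono)
    have f2: "(\<lambda>y. (f y)\<^sup>2 * (\<phi> i y)\<^sup>2) summable_on lattice n" if i: "i < n" for i
    proof (rule has_sum_abs_le)
      show "(\<lambda>y. Bh\<^sup>2 * (\<phi> i y)\<^sup>2 + 2 * C0\<^sup>2 * ((\<bar>\<mu> y\<bar> ^ 0 * indicator (- K) y) * (\<phi> i y)\<^sup>2)
          + 2 * C0\<^sup>2 * ((\<bar>\<mu> y\<bar> ^ (2 * m) * indicator (- K) y) * (\<phi> i y)\<^sup>2)) summable_on lattice n"
        by (intro summable_on_add summable_on_cmult_right phi_square_summable ms i) auto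
      fix y
      have "(f y)\<^sup>2 \<le> Bh\<^sup>2 + 2 * C0\<^sup>2 * (\<bar>\<mu> y\<bar> ^ 0 * indicator (- K) y) + 2 * C0\<^sup>2 * (\<bar>\<mu> y\<bar> ^
        (2 * m) * indicator (- K) y)"
        using fpt[of y] fbd[of y] by (cases "y \<in> K") (auto simp: algebra_simps intro: order_trans)
      then have "(f y)\<^sup>2 * (\<phi> i y)\<^sup>2 \<le> (Bh\<^sup>2 + 2 * C0\<^sup>2 * (\<bar>\<mu> y\<bar> ^ 0 * indicator (- K) y) + 2 * C0\<^sup>2 *
        (\<bar>\<mu> y\<bar> ^ (2 * m) * indicator (- K) y)) * (\<phi> i y)\<^sup>2"
        by (rule mult_right_mono) simp
      then show "\<bar>(f y)\<^sup>2 * (\<phi> i y)\<^sup>2\<bar> \<le> Bh\<^sup>2 * (\<phi> i y)\<^sup>2 + 2 * C0\<^sup>2 * ((\<bar>\<mu> y\<bar> ^ 0 * indicator (- K) y) *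
        (\<phi> i y)\<^sup>2)
          + 2 * C0\<^sup>2 * ((\<bar>\<mu> y\<bar> ^ (2 * m) * indicator (- K) y) * (\<phi> i y)\<^sup>2)"
        by (simp add: algebra_simps)
    qed
    have par: "(u n y)\<^sup>2 \<le> 2 * (f y)\<^sup>2 + 2 * (poly q (V n y))\<^sup>2" for y
      unfolding u_def using zero_le_power2[of "f y + poly q (V n y)"] by
        (simp add: power2_eq_square algebra_simps)
    have u2: "(\<lambda>y. (u n y)\<^sup>2 * (\<phi> i y)\<^sup>2) summable_on lattice n" if i: "i < n" for i
    proof (rule has_sum_abs_le)
      show "(\<lambda>y. 2 * ((f y)\<^sup>2 * (\<phi> i y)\<^sup>2) + 2 * ((poly q (V n y))\<^sup>2 * (\<phi> i y)\<^sup>2)) summable_on lattice n"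
        by (intro summable_on_add summable_on_cmult_right f2 q2 i)
      fix y
      show "\<bar>(u n y)\<^sup>2 * (\<phi> i y)\<^sup>2\<bar> \<le> 2 * ((f y)\<^sup>2 * (\<phi> i y)\<^sup>2) + 2 * ((poly q (V n y))\<^sup>2 * (\<phi> i y)\<^sup>2)"
        using mult_right_mono[OF par[of y], of "(\<phi> i y)\<^sup>2"] by (simp add: algebra_simps)
    qed
    note vu = variance_eq[OF u2] and vf = variance_eq[OF f2] and vq = variance_eq[OF q2] and vv
      = variance_eq[OF v2]
    have su: "stat (u n) x = stat f x - stat (\<lambda>y. poly q (V n y)) x" for x
      unfolding u_def stat_def by (simp add: sum_subtractf)
    have eu: "expect n (stat (u n)) = expect n (stat f) - expect n (stat (\<lambda>y. poly q (V n y)))"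
      unfolding su[abs_def] using vf(1) vq(1) by simp
    have Z: "Z n x = stat (u n) x - expect n (stat (u n))" for x
      unfolding Z_def ls su eu by simp
    have U: "expect n (?U n) \<le> W n"
    proof -
      have "expect n (?U n) \<le> expect n (\<lambda>x. 4 * C0\<^sup>2 * (?Tm n 0 x + ?Tm n (2 * m) x) + 2 * ?Tq n x)"
      \<comment> \<open>In this form of monotonicity, integrability and nonnegativity concern the
        upper bound.\<close>
      proof (rule integral_mono_AE')
        show "integrable (measure_pmf (P n)) (\<lambda>x. 4 * C0\<^sup>2 * (?Tm n 0 x + ?Tm n (2 * m) x) + 2 * ?Tq n x)"
          using elim(9,10,11) by (intro Bochner_Integration.integrable_add integrable_mult_right)
        show "AE x in measure_pmf (P n). ?U n x \<le> 4 * C0\<^sup>2 * (?Tm n 0 x + ?Tm n (2 * m) x) + 2 * ?Tq n x"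
        proof (rule AE_I2)
          fix x
          have "?U n x \<le> linear_stat n (\<lambda>y. 4 * C0\<^sup>2 * (\<bar>\<mu> y\<bar> ^ 0 * indicator (- K) y + \<bar>\<mu> y\<bar> ^
            (2 * m) * indicator (- K) y)
              + 2 * (\<bar>poly (q * q) (V n y)\<bar> * indicator (- K) y)) x"
          proof (rule linear_stat_mono)
            fix y
            have "(u n y)\<^sup>2 \<le> 4 * C0\<^sup>2 * (1 + \<bar>\<mu> y\<bar> ^ (2 * m)) + 2 * \<bar>poly (q * q) (V n y)\<bar>"
              using par[of y] fpt[of y] by (simp add: power2_eq_square abs_mult)
            then show "(u n y)\<^sup>2 * indicator (- K) y \<le> 4 * C0\<^sup>2 * (\<bar>\<mu> y\<bar> ^ 0 * indicator (- K) y
              + \<bar>\<mu> y\<bar> ^ (2 * m) * indicator (- K) y)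
              + 2 * (\<bar>poly (q * q) (V n y)\<bar> * indicator (- K) y)"
              by (cases "y \<in> K") auto
          qed
          then show "?U n x \<le> 4 * C0\<^sup>2 * (?Tm n 0 x + ?Tm n (2 * m) x) + 2 * ?Tq n x"
            unfolding linear_stat_add linear_stat_cmult .
        qed
        have *: "0 \<le> ?Tm n k x" "0 \<le> ?Tq n x" for k x by (rule linear_stat_nonneg, simp)+
        show "AE x in measure_pmf (P n). 0 \<le> 4 * C0\<^sup>2 * (?Tm n 0 x + ?Tm n (2 * m) x) + 2 * ?Tq n x"
          by (intro AE_I2 add_nonneg_nonneg mult_nonneg_nonneg *) auto
      qed
      also have "\<dots> = W n"
        unfolding W_def using elim(9,10,11) by simp
      finally show ?thesis .
    qed
    have bnd: "\<bar>u n y\<bar> \<le> B" if "y \<in> lattice n" "y \<in> K" for y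
    proof -
      have "\<bar>V n y - \<mu> y\<bar> \<le> e" using elim(3) that by auto
      then have "V n y \<in> {-(R+1)..R+1}" using R(2)[OF that(2)] e(2) by auto
      then have "\<bar>poly q (V n y)\<bar> \<le> Mq" by (rule Mq(2))
      moreover have "\<bar>f y\<bar> \<le> \<bar>Bh\<bar>" using Bh[of "\<mu> y"] that unfolding fh by auto
      ultimately show ?thesis unfolding u_def B_def by linarith
    qed
    have "var_stat (u n) \<le> (\<delta> * (1 + e) + C * e)\<^sup>2 * var_stat (\<lambda>y. poly [:0, 1:] (V n y))
      + 4 * expect n (stat (\<lambda>y. (u n y)\<^sup>2 * indicator (- K) y)) + 2 * B\<^sup>2 * expect n (stat (indicator (- K)))"
    proof (rule variance_lipschitz_bound[OF u2 v2])
      show "\<bar>u n x - u n y\<bar> \<le> (\<delta> * (1 + e) + C * e) * \<bar>poly [:0, 1:] (V n x) - poly [:0, 1:] (V n y)\<bar>"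
        if "x \<in> lattice n" "y \<in> lattice n" "x \<in> K" "y \<in> K" for x y
        using elim(2) that by (simp add: u_def fh)
    qed (use bnd in auto)
    also have "\<dots> \<le> (\<delta> * (1 + e) + C * e)\<^sup>2 * (var_unit + e) + 4 * e + 2 * B\<^sup>2 * e"
    proof (intro add_mono mult_left_mono)
      show "var_stat (\<lambda>y. poly [:0, 1:] (V n y)) \<le> var_unit + e"
        using elim(6) vv(3) unfolding ls by simp
      show "expect n (stat (\<lambda>y. (u n y)\<^sup>2 * indicator (- K) y)) \<le> e"
        using U elim(4) unfolding ls by simp
      show "expect n (stat (indicator (- K))) \<le> e" using elim(5) unfolding ls by simp
    qed auto
    finally have "var_stat (u n) \<le> \<delta>\<^sup>2 * var_unit + \<eta>" using e(3) by linarith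
    then show ?case
      using vf(1) vq(1) vu(2,3) unfolding Z ls by simp
  qed
qed

end

section \<open>The range of the limiting symbol\<close>

lemma continuous_poly_approx:
  fixes \<psi> :: "real \<Rightarrow> real"
  assumes "continuous_on {-R..R} \<psi>" "0 < e"
  obtains q :: "real poly" where "\<And>t. t \<in> {-R..R} \<Longrightarrow> \<bar>\<psi> t - poly q t\<bar> < e"
proof -
  obtain p where p: "real_polynomial_function p" "\<And>t. t \<in> {-R..R} \<Longrightarrow> \<bar>\<psi> t - p t\<bar> < e"
    using Stone_Weierstrass_real_polynomial_function[of "{-R..R}" \<psi> e] assms by auto
  obtain a m where p_eq: "p = (\<lambda>x. \<Sum>i\<le>m. a i * x ^ i)"
    using p(1) real_polynomial_function_iff_sum by blast
  have "poly (\<Sum>i\<le>m. monom (a i) i) t = p t" for t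
    by (simp add: p_eq poly_sum poly_monom)
  then show ?thesis using that p(2) by metis
qed

lemma integral_symbol_poly:
  "((\<lambda>\<theta>. poly q (2 * \<alpha> * cos \<theta> + \<beta>)) has_integral (2 * pi * symbol_poly \<alpha> \<beta> q 0)) {0..2 * pi}"
  using has_integral_linear[OF has_integral_symbol_poly[of q \<alpha> \<beta> 0] bounded_linear_Re]
  by (simp add: o_def)

context ensemble_sequence begin

text \<open>The weights \<open>\<phi>\<^bsub>n-1\<^esub>\<^sup>2\<close> form a probability mass function which by the tail condition concentrates
  on \<open>K\<close>, while its moments converge to those of \<open>2 \<alpha> cos \<theta> + \<beta>\<close> for uniform \<open>\<theta>\<close>.\<close>

lemma symbol_mean_bound:
  assumes q: "\<And>x. x \<in> K \<Longrightarrow> \<forall>v. \<bar>v - \<mu> x\<bar> \<le> \<rho> \<longrightarrow> \<bar>poly q v\<bar> \<le> \<epsilon>" and \<rho>: "0 < \<rho>" and \<epsilon>: "0 \<le> \<epsilon>"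
  shows "\<bar>symbol_poly \<alpha> \<beta> q 0\<bar> \<le> \<epsilon>"
proof (rule LIMSEQ_le)
  let ?G = "\<lambda>n. jacobi_poly (a n) (b n) q (nat (- 1 + int n)) (nat (- 1 + int n))"
  let ?T = "\<lambda>n. linear_stat n (\<lambda>x. \<bar>poly q (V n x)\<bar> * indicator (- K) x)"
  have "?G \<longlonglongrightarrow> symbol_poly \<alpha> \<beta> q (- 1 - (- 1))"
    by (intro jacobi_poly_tendsto[where i = "-1" and k = "-1"] a_lim b_lim)
  then show "(\<lambda>n. \<bar>?G n\<bar>) \<longlonglongrightarrow> \<bar>symbol_poly \<alpha> \<beta> q 0\<bar>"
    by (intro tendsto_rabs) simp
  have "(\<lambda>n. \<epsilon> + expect n (?T n)) \<longlonglongrightarrow> \<epsilon> + 0"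
    by (intro tendsto_intros poly_tail_tendsto)
  then show "(\<lambda>n. \<epsilon> + expect n (?T n)) \<longlonglongrightarrow> \<epsilon>" by simp
  have "\<forall>\<^sub>F n in sequentially. \<bar>?G n\<bar> \<le> \<epsilon> + expect n (?T n)"
    using eventually_ensemble_at[of "degree q + 1"] mu_close[OF \<rho>]
  proof eventually_elim
    case (elim n)
    let ?r = "degree q + 1"
    from elim(1) obtain \<phi> where \<phi>: "ensemble_at ?r n \<phi>" and n: "1 \<le> n" by auto
    from \<phi> interpret ensemble n "n + ?r" "lattice n" \<phi> "P n" by (simp add: ensemble_at_def)
    have rec: "V n y * \<phi> i y = a n i * \<phi> (i + 1) y + b n i * \<phi> i y
        + (if i = 0 then 0 else a n (i - 1) * \<phi> (i - 1) y)" if "i + 1 < n + ?r" for i y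
      using \<phi> that by (simp add: ensemble_at_def)
    let ?i = "n - 1"
    let ?u = "\<lambda>y. \<bar>poly q (V n y)\<bar> * indicator (- K) y"
    have i: "?i < n" "nat (- 1 + int n) = ?i" using n by auto
    have q1: "(\<lambda>y. \<bar>poly q (V n y)\<bar> * (\<phi> i y)\<^sup>2) summable_on lattice n" if "i < n" for i
      by (rule summable_abs_of_square[OF poly_square_summable[OF rec]]) (use that in auto)
    have u1: "(\<lambda>y. \<bar>?u y\<bar> * (\<phi> i y)\<^sup>2) summable_on lattice n" if "i < n" for i
      by (rule has_sum_abs_le[OF q1[OF that]]) (auto simp: indicator_def)
    have mean: "expect n (?T n) = (\<Sum>i<n. gram ?u i i)"
      using mean_stat[OF u1] linear_stat_eq[OF ensemble_axioms] by (simp add: has_bochner_integral_iff)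
    have gs: "((\<lambda>y. ?u y * (\<phi> i y * \<phi> i y)) has_sum gram ?u i i) (lattice n)" if "i < n" for i
      by (rule gram_has_sum[OF u1]) (use that in auto)
    have gnn: "0 \<le> gram ?u i i" if "i < n" for i
      by (rule has_sum_nonneg[OF gs[OF that]]) auto
    have "?G n = gram (\<lambda>y. poly q (V n y)) ?i ?i"
      unfolding i(2) by (rule gram_poly[OF rec, symmetric]) (use i n in auto)
    also have "\<bar>\<dots>\<bar> \<le> \<epsilon> + gram ?u ?i ?i"
    proof -
      have G: "((\<lambda>y. poly q (V n y) * (\<phi> ?i y * \<phi> ?i y)) has_sum gram (\<lambda>y. poly q (V n y)) ?i ?i) (lattice n)"
        by (rule gram_has_sum[OF q1]) (use i in auto)
      have "((\<lambda>y. \<phi> ?i y * \<phi> ?i y) has_sum 1) (lattice n)"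
        using orth[of ?i ?i] i by simp
      from has_sum_add[OF has_sum_cmult_right[OF this, of \<epsilon>] gs[OF i(1)]]
      have E: "((\<lambda>y. \<epsilon> * (\<phi> ?i y * \<phi> ?i y) + ?u y * (\<phi> ?i y * \<phi> ?i y)) has_sum (\<epsilon> + gram ?u ?i ?i))
        (lattice n)"
        by simp
      have pt: "\<bar>poly q (V n y) * (\<phi> ?i y * \<phi> ?i y)\<bar> \<le> \<epsilon> * (\<phi> ?i y * \<phi> ?i y) + ?u y * (\<phi> ?i y * \<phi> ?i y)"
        if y: "y \<in> lattice n" for y
      proof -
        have "\<bar>poly q (V n y)\<bar> \<le> \<epsilon> + ?u y"
        proof (cases "y \<in> K")
          case True
          then have "\<bar>V n y - \<mu> y\<bar> \<le> \<rho>" using elim(2) y by auto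
          then show ?thesis using q[OF True] True by auto
        qed (use \<epsilon> in auto)
        then have "\<bar>poly q (V n y)\<bar> * (\<phi> ?i y * \<phi> ?i y) \<le> (\<epsilon> + ?u y) * (\<phi> ?i y * \<phi> ?i y)"
          by (rule mult_right_mono) simp
        then show ?thesis by (simp add: abs_mult distrib_right)
      qed
      have "gram (\<lambda>y. poly q (V n y)) ?i ?i \<le> \<epsilon> + gram ?u ?i ?i"
        by (rule has_sum_mono[OF G E]) (use pt in \<open>auto simp: abs_le_iff\<close>)
      moreover have "- gram (\<lambda>y. poly q (V n y)) ?i ?i \<le> \<epsilon> + gram ?u ?i ?i"
        using has_sum_cmult_right[OF G, of "- 1"]
        by (intro has_sum_mono[OF _ E, of "\<lambda>y. - 1 * (poly q (V n y) * (\<phi> ?i y * \<phi> ?i y))"])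
          (use pt in \<open>auto simp: abs_le_iff\<close>)
      ultimately show ?thesis by linarith
    qed
    \<comment> \<open>The tail expectation is a sum of nonnegative terms over all filled levels, so
      it dominates the term of level \<open>n - 1\<close>.\<close>
    also have "gram ?u ?i ?i \<le> (\<Sum>i<n. gram ?u i i)"
      by (rule member_le_sum) (use i gnn in auto)
    finally show ?case unfolding mean by simp
  qed
  then show "\<exists>N. \<forall>n\<ge>N. \<bar>?G n\<bar> \<le> \<epsilon> + expect n (?T n)"
    by (simp add: eventually_sequentially)
qed

text \<open>If a value of the symbol missed the compact set \<mu>(K), a bump around it would vanish
  near \<mu>(K). Polynomial approximation and \<open>symbol_mean_bound\<close> would then make its
  mean over \<theta> zero, although the bump is positive at that value.\<close>

lemma support_interval: "2 * \<alpha> * cos \<theta>0 + \<beta> \<in> \<mu> ` K"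
proof (rule ccontr)
  let ?t = "\<lambda>\<theta>. 2 * \<alpha> * cos \<theta> + \<beta>"
  assume notin: "?t \<theta>0 \<notin> \<mu> ` K"
  obtain \<theta>1 where \<theta>1: "\<theta>1 \<in> {0..2 * pi}" "cos \<theta>1 = cos \<theta>0"
    using sincos_total_2pi_le[of "cos \<theta>0" "sin \<theta>0"] by (auto simp: add.commute)
  have "open (- \<mu> ` K)" using mu_K_compact by (simp add: compact_imp_closed open_Compl)
  then obtain \<rho>' where \<rho>': "0 < \<rho>'" "ball (?t \<theta>0) \<rho>' \<subseteq> - \<mu> ` K"
    using notin open_contains_ball by (metis ComplI)
  \<comment> \<open>Half the radius, so that the bump of radius \<rho> is still 0 within \<rho> of
    \<mu>(K); the cap 1 keeps that neighbourhood inside the interval \<open>{-R..R}\<close>.\<close>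
  define \<rho> where "\<rho> = min 1 (\<rho>' / 2)"
  have \<rho>: "0 < \<rho>" "\<rho> \<le> 1" using \<rho>' by (auto simp: \<rho>_def)
  have far: "2 * \<rho> \<le> \<bar>?t \<theta>0 - \<mu> x\<bar>" if "x \<in> K" for x
  proof -
    have "\<mu> x \<notin> ball (?t \<theta>0) \<rho>'" using \<rho>'(2) that by auto
    then show ?thesis by (simp add: dist_real_def \<rho>_def)
  qed
  define \<psi> where "\<psi> = (\<lambda>t. max 0 (\<rho> - \<bar>t - ?t \<theta>0\<bar>))"
  have \<psi>c: "continuous_on A \<psi>" for A unfolding \<psi>_def by (intro continuous_intros)
  obtain R0 where R0: "0 < R0" "\<And>x. x \<in> K \<Longrightarrow> \<bar>\<mu> x\<bar> \<le> R0"
    using compact_imp_bounded[OF mu_K_compact] unfolding bounded_pos by auto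
  define R where "R = R0 + 1 + 2 * \<bar>\<alpha>\<bar> + \<bar>\<beta>\<bar>"
  have tR: "?t \<theta> \<in> {-R..R}" for \<theta>
  proof -
    have "\<bar>\<alpha> * cos \<theta>\<bar> \<le> \<bar>\<alpha>\<bar>" unfolding abs_mult by (rule mult_left_le) auto
    then show ?thesis using R0(1) by (auto simp: R_def)
  qed
  let ?I = "integral {0..2 * pi} (\<lambda>\<theta>. \<psi> (?t \<theta>))"
  have int: "(\<lambda>\<theta>. \<psi> (?t \<theta>)) integrable_on {0..2 * pi}"
    unfolding \<psi>_def by (intro integrable_continuous_interval continuous_intros)
  have small: "?I \<le> 4 * pi * e" if e: "0 < e" for e
  proof -
    obtain q :: "real poly" where q: "\<And>t. t \<in> {-R..R} \<Longrightarrow> \<bar>\<psi> t - poly q t\<bar> < e"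
      using continuous_poly_approx[OF \<psi>c e] by metis
    have "\<bar>symbol_poly \<alpha> \<beta> q 0\<bar> \<le> e"
    proof (rule symbol_mean_bound[of \<rho>])
      fix x assume x: "x \<in> K"
      show "\<forall>v. \<bar>v - \<mu> x\<bar> \<le> \<rho> \<longrightarrow> \<bar>poly q v\<bar> \<le> e"
      proof (intro allI impI)
        fix v assume v: "\<bar>v - \<mu> x\<bar> \<le> \<rho>"
        then have "\<psi> v = 0" using far[OF x] by (simp add: \<psi>_def)
        moreover have "v \<in> {-R..R}" using v R0(2)[OF x] \<rho> by (auto simp: R_def)
        ultimately show "\<bar>poly q v\<bar> \<le> e" using q[of v] by simp
      qed
    qed (use \<rho> e in auto)
    then have s: "symbol_poly \<alpha> \<beta> q 0 \<le> e" by simp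
    have "?I \<le> 2 * pi * symbol_poly \<alpha> \<beta> q 0 + 2 * pi * e"
    proof (rule has_integral_le[OF integrable_integral[OF int]])
      show "((\<lambda>\<theta>. poly q (?t \<theta>) + e) has_integral (2 * pi * symbol_poly \<alpha> \<beta> q 0 + 2 * pi * e)) {0..2 * pi}"
        using has_integral_add[OF integral_symbol_poly[of q \<alpha> \<beta>]
          has_integral_const_real[of e 0 "2 * pi"]] by simp
      show "\<psi> (?t \<theta>) \<le> poly q (?t \<theta>) + e" for \<theta> using q[OF tR, of \<theta>] by linarith
    qed
    also have "\<dots> \<le> 2 * pi * e + 2 * pi * e" using s by simp
    finally show ?thesis by simp
  qed
  have "?I \<le> 0"
  proof (rule ccontr)
    assume "\<not> ?I \<le> 0"
    \<comment> \<open>With this choice of the tolerance the bound reads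
      \<open>?I \<le> ?I / 2\<close>.\<close>
    then show False using small[of "?I / (8 * pi)"] by (simp add: field_simps)
  qed
  moreover have "0 \<le> ?I" by (rule integral_nonneg[OF int]) (simp add: \<psi>_def)
  ultimately have "?I = 0" by simp
  then have "\<forall>\<theta>\<in>{0..2 * pi}. \<psi> (?t \<theta>) = 0"
    by (subst (asm) integral_eq_0_iff) (auto simp: \<psi>_def intro!: continuous_intros)
  then have "\<psi> (?t \<theta>1) = 0" using \<theta>1 by blast
  then show False using \<rho> \<theta>1 by (simp add: \<psi>_def)
qed

end

section \<open>The limit theorem\<close>

text \<open>The imaginary exponential is 1-Lipschitz, and
  \<open>\<bar>d\<bar> \<le> (d\<^sup>2 / \<kappa> + \<kappa>) / 2\<close> turns the second moment
  bound into a first moment bound, in place of the Cauchy-Schwarz inequality.\<close>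

lemma char_difference_bound:
  fixes X Y :: "'a \<Rightarrow> real"
  assumes int: "integrable (measure_pmf P) (\<lambda>x. (X x - Y x)\<^sup>2)"
    and le: "measure_pmf.expectation P (\<lambda>x. (X x - Y x)\<^sup>2) \<le> \<kappa>\<^sup>2" and \<kappa>: "0 < \<kappa>"
  shows "cmod (char (distr (measure_pmf P) borel X) t - char (distr (measure_pmf P) borel Y) t) \<le> \<bar>t\<bar> * \<kappa>"
proof -
  have abs_le: "\<bar>d\<bar> \<le> (d\<^sup>2 / \<kappa> + \<kappa>) / 2" for d :: real
  proof -
    have "0 \<le> (\<bar>d\<bar> - \<kappa>)\<^sup>2" by simp
    then have "2 * \<bar>d\<bar> * \<kappa> \<le> d\<^sup>2 + \<kappa>\<^sup>2" by (simp add: power2_diff)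
    then show ?thesis using \<kappa> by (simp add: field_simps power2_eq_square)
  qed
  have int_abs: "integrable (measure_pmf P) (\<lambda>x. \<bar>X x - Y x\<bar>)"
  proof (rule Bochner_Integration.integrable_bound)
    show "integrable (measure_pmf P) (\<lambda>x. ((X x - Y x)\<^sup>2 / \<kappa> + \<kappa>) / 2)"
      by (intro integrable_divide Bochner_Integration.integrable_add int) simp
    show "AE x in measure_pmf P. norm \<bar>X x - Y x\<bar> \<le> norm (((X x - Y x)\<^sup>2 / \<kappa> + \<kappa>) / 2)"
      by (rule AE_I2) (use abs_le in \<open>metis abs_ge_self abs_idempotent order_trans real_norm_def\<close>)
  qed simp
  have "measure_pmf.expectation P (\<lambda>x. \<bar>X x - Y x\<bar>) \<le> measure_pmf.expectation P (\<lambda>x. ((X x - Y x)\<^sup>2 / \<kappa>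
    + \<kappa>) / 2)"
    by (intro integral_mono int_abs integrable_divide Bochner_Integration.integrable_add int abs_le) simp
  also have "\<dots> = (measure_pmf.expectation P (\<lambda>x. (X x - Y x)\<^sup>2) / \<kappa> + \<kappa>) / 2"
    using int by simp
  also have "\<dots> \<le> (\<kappa>\<^sup>2 / \<kappa> + \<kappa>) / 2"
    using le \<kappa> by (intro divide_right_mono add_right_mono) auto
  also have "\<dots> = \<kappa>" using \<kappa> by (simp add: power2_eq_square)
  finally have E: "measure_pmf.expectation P (\<lambda>x. \<bar>X x - Y x\<bar>) \<le> \<kappa>" .
  have lip: "cmod (iexp (t * X x) - iexp (t * Y x)) \<le> \<bar>t\<bar> * \<bar>X x - Y x\<bar>" for x
  proof -
    have "iexp (t * X x) - iexp (t * Y x) = iexp (t * Y x) * (iexp (t * X x - t * Y x) - 1)"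
      by (simp add: exp_diff right_diff_distrib)
    then have "cmod (iexp (t * X x) - iexp (t * Y x)) = cmod (iexp (t * X x - t * Y x) - 1)"
      by (simp only: norm_mult norm_exp_i_times mult_1)
    also have "\<dots> \<le> \<bar>t * X x - t * Y x\<bar>"
      using iexp_approx1[of "t * X x - t * Y x" 0] by simp
    finally show ?thesis by (simp add: right_diff_distrib[symmetric] abs_mult)
  qed
  have iX: "integrable (measure_pmf P) (\<lambda>x. iexp (t * Z x))" for Z :: "'a \<Rightarrow> real"
    by (rule measure_pmf.integrable_const_bound[where B = 1]) auto
  have "char (distr (measure_pmf P) borel X) t - char (distr (measure_pmf P) borel Y) t =
      measure_pmf.expectation P (\<lambda>x. iexp (t * X x) - iexp (t * Y x))"
    unfolding char_def using iX by (simp add: integral_distr)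
  also have "cmod \<dots> \<le> measure_pmf.expectation P (\<lambda>x. cmod (iexp (t * X x) - iexp (t * Y x)))"
    by (rule integral_norm_bound)
  also have "\<dots> \<le> measure_pmf.expectation P (\<lambda>x. \<bar>t\<bar> * \<bar>X x - Y x\<bar>)"
    by (intro integral_mono lip integrable_norm Bochner_Integration.integrable_diff iX
      integrable_mult_right int_abs)
  also have "\<dots> \<le> \<bar>t\<bar> * \<kappa>" using E by (simp add: mult_left_mono)
  finally show ?thesis .
qed

text \<open>\<open>symbol_poly\<close> sums up to the degree, which may drop under subtraction.
  Uniqueness of the integral avoids comparing the ranges.\<close>

lemma symbol_poly_diff: "symbol_poly \<alpha> \<beta> (p - q) d = symbol_poly \<alpha> \<beta> p d - symbol_poly \<alpha> \<beta> q d"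
proof -
  have "((\<lambda>\<theta>::real. complex_of_real (poly (p - q) (2 * \<alpha> * cos \<theta> + \<beta>)) * exp (- \<i> * of_int d * of_real \<theta>))
     has_integral (2 * of_real pi * of_real (symbol_poly \<alpha> \<beta> p d) - 2 * of_real pi * of_real
       (symbol_poly \<alpha> \<beta> q d))) {0..2 * pi}"
    using has_integral_diff[OF has_integral_symbol_poly[of p \<alpha> \<beta> d] has_integral_symbol_poly[of q \<alpha> \<beta> d]]
    by (simp add: left_diff_distrib)
  from has_integral_unique[OF has_integral_symbol_poly[of "p - q" \<alpha> \<beta> d] this]
  have "complex_of_real (2 * pi * symbol_poly \<alpha> \<beta> (p - q) d) =
      complex_of_real (2 * pi * (symbol_poly \<alpha> \<beta> p d - symbol_poly \<alpha> \<beta> q d))"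
    by (simp add: right_diff_distrib)
  then show ?thesis by (simp only: of_real_eq_iff) simp
qed

lemma symbol_variance_eq:
  assumes "degree q \<le> M"
  shows "(\<Sum>k=1..M. real k * (symbol_poly \<alpha> \<beta> q (int k))\<^sup>2) = symbol_variance \<alpha> \<beta> q"
  unfolding symbol_variance_def
  by (intro sum.mono_neutral_right) (use assms in \<open>auto simp: symbol_poly_zero\<close>)

lemma symbol_variance_ge:
  "(\<Sum>k=1..M. real k * (symbol_poly \<alpha> \<beta> q (int k))\<^sup>2) \<le> symbol_variance \<alpha> \<beta> q"
proof -
  have "(\<Sum>k=1..M. real k * (symbol_poly \<alpha> \<beta> q (int k))\<^sup>2)
      \<le> (\<Sum>k=1..max M (degree q). real k * (symbol_poly \<alpha> \<beta> q (int k))\<^sup>2)"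
    by (intro sum_mono2) auto
  also have "\<dots> = symbol_variance \<alpha> \<beta> q" by (rule symbol_variance_eq) simp
  finally show ?thesis .
qed

text \<open>The cross term \<open>2 * x * y\<close> is split by a weighted mean inequality. The free
  weight \<open>m\<close> is later tied to the accuracy of approximation so that both terms tend to
  0.\<close>

lemma square_difference_bound:
  fixes x y z m :: real
  assumes "\<bar>y - z\<bar> \<le> x" "0 \<le> y" "0 \<le> z" "0 < m"
  shows "\<bar>y\<^sup>2 - z\<^sup>2\<bar> \<le> (m + 1) * x\<^sup>2 + y\<^sup>2 / m"
proof -
  have x: "0 \<le> x" using assms by linarith
  have "\<bar>y\<^sup>2 - z\<^sup>2\<bar> = \<bar>y - z\<bar> * (y + z)"
    using assms by (simp add: power2_eq_square square_diff_square_factored abs_mult mult.commute)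
  also have "\<dots> \<le> x * (2 * y + x)" using assms x by (intro mult_mono) auto
  also have "\<dots> = x\<^sup>2 + 2 * x * y" by (simp add: power2_eq_square algebra_simps)
  also have "2 * x * y \<le> m * x\<^sup>2 + y\<^sup>2 / m"
  proof -
    have "0 \<le> (m * x - y)\<^sup>2 / m" using assms by simp
    also have "\<dots> = m * x\<^sup>2 + y\<^sup>2 / m - 2 * x * y"
      using assms by (simp add: power2_eq_square field_simps)
    finally show ?thesis by simp
  qed
  finally show ?thesis by (simp add: algebra_simps)
qed

context ensemble_sequence begin

text \<open>\<open>variance_bound_eventually\<close> with test function 0 bounds the variance of a
  polynomial statistic for large n; its limit is the symbol variance.\<close>

lemma symbol_variance_lipschitz:
  assumes lip: "\<And>s t. s \<in> \<mu> ` K \<Longrightarrow> t \<in> \<mu> ` K \<Longrightarrow> \<bar>poly q s - poly q t\<bar> \<le> \<delta> * \<bar>s - t\<bar>" and \<delta>: "0 \<le> \<delta>"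
  shows "symbol_variance \<alpha> \<beta> q \<le> \<delta>\<^sup>2 * var_unit"
proof (rule field_le_epsilon)
  fix \<eta> :: real assume \<eta>: "0 < \<eta>"
  have "\<forall>\<^sub>F n in sequentially. expect n (\<lambda>x. (pstat n q x - expect n (pstat n q))\<^sup>2) \<le> \<delta>\<^sup>2 * var_unit + \<eta>"
  proof -
    have z: "linear_stat n (\<lambda>_. 0) = (\<lambda>_. 0)" for n by (simp add: linear_stat_def fun_eq_iff)
    have sq: "(0 - 0 - (x - y))\<^sup>2 = (x - y)\<^sup>2" for x y :: real by (simp add: power2_commute)
    have lip': "\<bar>(0 - poly q s) - (0 - poly q t)\<bar> \<le> \<delta> * \<bar>s - t\<bar>" if "s \<in> \<mu> ` K" "t \<in> \<mu> ` K" for s t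
      using lip[OF that] by simp
    show ?thesis
      using variance_bound_eventually[of "\<lambda>_. 0" "\<lambda>_. 0" 0 0 0 q \<delta> \<eta>, OF _ _ _ lip' \<delta> \<eta>]
      unfolding z integral_zero sq by (auto elim: eventually_mono)
  qed
  then show "symbol_variance \<alpha> \<beta> q \<le> \<delta>\<^sup>2 * var_unit + \<eta>"
    by (intro tendsto_upperbound[OF poly_variance_tendsto]) auto
qed

lemma fourier_coeff_approx:
  assumes h: "continuous_on (\<mu> ` K) h" and e: "0 \<le> e"
    and app: "\<And>t. t \<in> \<mu> ` K \<Longrightarrow> \<bar>h t - poly q t\<bar> \<le> e"
  shows "cmod (fourier_coeff \<alpha> \<beta> h k - of_real (symbol_poly \<alpha> \<beta> q (int k))) \<le> e"
proof -
  let ?t = "\<lambda>\<theta>. 2 * \<alpha> * cos \<theta> + \<beta>"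
  let ?e = "\<lambda>\<theta>::real. exp (- \<i> * of_nat k * of_real \<theta>)"
  let ?I = "integral {0..2 * pi} (\<lambda>\<theta>. complex_of_real (h (?t \<theta>)) * ?e \<theta>)"
  have "continuous_on {0..2 * pi} (\<lambda>\<theta>. h (?t \<theta>))"
    by (rule continuous_on_compose2[OF h]) (auto intro!: continuous_intros support_interval)
  then have "(\<lambda>\<theta>. complex_of_real (h (?t \<theta>)) * ?e \<theta>) integrable_on {0..2 * pi}"
    by (intro integrable_continuous_interval continuous_intros)
  then have "((\<lambda>\<theta>. complex_of_real (h (?t \<theta>)) * ?e \<theta> - complex_of_real (poly q (?t \<theta>)) * ?e \<theta>) has_integral
      (?I - 2 * of_real pi * of_real (symbol_poly \<alpha> \<beta> q (int k)))) {0..2 * pi}"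
    using has_integral_symbol_poly[of q \<alpha> \<beta> "int k"]
    by (intro has_integral_diff integrable_integral) auto
  then have "cmod (?I - 2 * of_real pi * of_real (symbol_poly \<alpha> \<beta> q (int k))) \<le> e * measure lborel
    (cbox 0 (2 * pi))"
  proof (intro has_integral_bound[where f = "\<lambda>\<theta>. complex_of_real (h (?t \<theta>)) * ?e \<theta> - complex_of_real
    (poly q (?t \<theta>)) * ?e \<theta>"] e)
    fix \<theta> :: real
    have "cmod (complex_of_real (h (?t \<theta>)) * ?e \<theta> - complex_of_real (poly q (?t \<theta>)) * ?e \<theta>) =
       cmod (complex_of_real (h (?t \<theta>) - poly q (?t \<theta>)) * ?e \<theta>)"
      by (simp add: left_diff_distrib)
    also have "\<dots> = \<bar>h (?t \<theta>) - poly q (?t \<theta>)\<bar>"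
      unfolding norm_mult norm_of_real by (simp add: norm_exp_eq_Re)
    also have "\<dots> \<le> e" by (rule app[OF support_interval])
    finally show "cmod (complex_of_real (h (?t \<theta>)) * ?e \<theta> - complex_of_real (poly q (?t \<theta>)) * ?e \<theta>) \<le> e" .
  qed (auto simp: cbox_interval)
  then have *: "cmod (?I - 2 * of_real pi * of_real (symbol_poly \<alpha> \<beta> q (int k))) \<le> 2 * pi * e"
    by (simp add: mult.commute)
  have "fourier_coeff \<alpha> \<beta> h k - of_real (symbol_poly \<alpha> \<beta> q (int k)) =
      (?I - 2 * of_real pi * of_real (symbol_poly \<alpha> \<beta> q (int k))) / of_real (2 * pi)"
    unfolding fourier_coeff_def by (simp add: diff_divide_distrib)
  then have "cmod (fourier_coeff \<alpha> \<beta> h k - of_real (symbol_poly \<alpha> \<beta> q (int k))) =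
      cmod (?I - 2 * of_real pi * of_real (symbol_poly \<alpha> \<beta> q (int k))) / (2 * pi)"
    by (simp only: norm_divide norm_of_real) simp
  also have "\<dots> \<le> 2 * pi * e / (2 * pi)" by (rule divide_right_mono[OF *]) simp
  finally show ?thesis by simp
qed

text \<open>The weighted square sum is a quadratic form in the Fourier coefficients.
  \<open>symbol_variance_lipschitz\<close> makes the approximants Cauchy for it, because differences
  of approximants have small Lipschitz constants.\<close>

lemma limit_variance:
  fixes q :: "nat \<Rightarrow> real poly"
  assumes h: "continuous_on (\<mu> ` K) h"
    and app: "\<And>m t. t \<in> \<mu> ` K \<Longrightarrow> \<bar>h t - poly (q m) t\<bar> \<le> 1 / (real m + 1)"
    and lip: "\<And>m s t. s \<in> \<mu> ` K \<Longrightarrow> t \<in> \<mu> ` K \<Longrightarrow>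
       \<bar>(h s - poly (q m) s) - (h t - poly (q m) t)\<bar> \<le> 1 / (real m + 1) * \<bar>s - t\<bar>"
  shows "(\<lambda>m. symbol_variance \<alpha> \<beta> (q m)) \<longlonglongrightarrow>
     (\<Sum>\<^sub>\<infinity>k\<in>{1..}. real k * (cmod (fourier_coeff \<alpha> \<beta> h k))\<^sup>2)"
proof -
  let ?c = "fourier_coeff \<alpha> \<beta> h"
  let ?e = "\<lambda>m. 1 / (real m + 1)"
  define s where "s = (\<lambda>m k. symbol_poly \<alpha> \<beta> (q m) (int k))"
  define \<sigma> where "\<sigma> = (\<lambda>m. symbol_variance \<alpha> \<beta> (q m))"
  have e0: "?e \<longlonglongrightarrow> 0"
    using LIMSEQ_inverse_real_of_nat by (simp add: inverse_eq_divide add.commute)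
  have cs: "cmod (?c k - of_real (s m k)) \<le> ?e m" for m k
    unfolding s_def by (rule fourier_coeff_approx[OF h _ app]) auto
  have lims: "(\<lambda>m. of_real (s m k)) \<longlonglongrightarrow> ?c k" for k
    by (rule Lim_transform_bound[OF _ e0, where f = "\<lambda>m. of_real (s m k) - ?c k", THEN LIM_zero_cancel])
      (use cs[of k] in \<open>auto simp: norm_minus_commute\<close>)
  \<comment> \<open>Finite partial sums allow the limit in the second approximant \<open>l\<close>;
    the bound is uniform in \<open>M\<close>.\<close>
  have D: "(\<Sum>k=1..M. real k * (cmod (?c k - of_real (s m k)))\<^sup>2) \<le> (?e m)\<^sup>2 * var_unit" for M m
  proof (rule LIMSEQ_le)
    show "(\<lambda>l. \<Sum>k=1..M. real k * (cmod (of_real (s l k) - of_real (s m k)))\<^sup>2) \<longlonglongrightarrow>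
       (\<Sum>k=1..M. real k * (cmod (?c k - of_real (s m k)))\<^sup>2)"
      by (intro tendsto_intros lims)
    have "(\<lambda>l. (?e l + ?e m)\<^sup>2 * var_unit) \<longlonglongrightarrow> (0 + ?e m)\<^sup>2 * var_unit"
      by (intro tendsto_intros e0)
    then show "(\<lambda>l. (?e l + ?e m)\<^sup>2 * var_unit) \<longlonglongrightarrow> (?e m)\<^sup>2 * var_unit" by simp
    have "(\<Sum>k=1..M. real k * (cmod (of_real (s l k) - of_real (s m k)))\<^sup>2) \<le> (?e l + ?e m)\<^sup>2 * var_unit" for l
    proof -
      have "(\<Sum>k=1..M. real k * (cmod (of_real (s l k) - of_real (s m k)))\<^sup>2) =
          (\<Sum>k=1..M. real k * (symbol_poly \<alpha> \<beta> (q l - q m) (int k))\<^sup>2)"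
        by (simp add: s_def symbol_poly_diff of_real_diff[symmetric] del: of_real_diff)
      also have "\<dots> \<le> symbol_variance \<alpha> \<beta> (q l - q m)" by (rule symbol_variance_ge)
      also have "\<dots> \<le> (?e l + ?e m)\<^sup>2 * var_unit"
      proof (rule symbol_variance_lipschitz)
        fix x y assume "x \<in> \<mu> ` K" "y \<in> \<mu> ` K"
        from lip[OF this, of l] lip[OF this, of m]
        show "\<bar>poly (q l - q m) x - poly (q l - q m) y\<bar> \<le> (?e l + ?e m) * \<bar>x - y\<bar>"
          unfolding distrib_right poly_diff by linarith
      qed simp
      finally show ?thesis .
    qed
    then show "\<exists>N. \<forall>l\<ge>N. (\<Sum>k=1..M. real k * (cmod (of_real (s l k) - of_real (s m k)))\<^sup>2) \<le> (?e l
      + ?e m)\<^sup>2 * var_unit"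
      by blast
  qed
  let ?f = "\<lambda>k. real k * (cmod (?c k))\<^sup>2"
  have fM: "sum ?f {1..M} \<le> 2 * \<sigma> 0 + 2 * var_unit" for M
  proof -
    have "sum ?f {1..M} \<le> (\<Sum>k=1..M. 2 * (real k * (s 0 k)\<^sup>2) + 2 * (real k * (cmod (?c k - of_real
      (s 0 k)))\<^sup>2))"
    proof (rule sum_mono)
      fix k
      have "cmod (?c k) \<le> \<bar>s 0 k\<bar> + cmod (?c k - of_real (s 0 k))"
        using norm_triangle_ineq[of "of_real (s 0 k)" "?c k - of_real (s 0 k)"] by simp
      then have "(cmod (?c k))\<^sup>2 \<le> (\<bar>s 0 k\<bar> + cmod (?c k - of_real (s 0 k)))\<^sup>2" by (rule power_mono) simp
      also have "\<dots> \<le> 2 * (s 0 k)\<^sup>2 + 2 * (cmod (?c k - of_real (s 0 k)))\<^sup>2"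
        using sum_squares_bound[of "\<bar>s 0 k\<bar>" "cmod (?c k - of_real (s 0 k))"] by (simp add: power2_sum)
      finally have "real k * (cmod (?c k))\<^sup>2 \<le> real k * (2 * (s 0 k)\<^sup>2 + 2 * (cmod (?c k - of_real
        (s 0 k)))\<^sup>2)"
        by (rule mult_left_mono) simp
      then show "?f k \<le> 2 * (real k * (s 0 k)\<^sup>2) + 2 * (real k * (cmod (?c k - of_real (s 0 k)))\<^sup>2)"
        by (simp add: algebra_simps)
    qed
    also have "\<dots> = 2 * (\<Sum>k=1..M. real k * (s 0 k)\<^sup>2) + 2 * (\<Sum>k=1..M. real k * (cmod (?c k - of_real
      (s 0 k)))\<^sup>2)"
      by (simp add: sum.distrib sum_distrib_left)
    also have "\<dots> \<le> 2 * \<sigma> 0 + 2 * var_unit"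
      using symbol_variance_ge[of \<alpha> \<beta> "q 0" M] D[where M = M and m = 0] unfolding s_def \<sigma>_def by simp
    finally show ?thesis .
  qed
  have f0: "0 \<le> ?f k" for k by simp
  have summ: "?f summable_on {1..}"
  proof (rule nonneg_bdd_above_summable_on)
    show "bdd_above (sum ?f ` {F. F \<subseteq> {1..} \<and> finite F})"
    proof (rule bdd_aboveI2)
      fix F :: "nat set" assume "F \<in> {F. F \<subseteq> {1..} \<and> finite F}"
      then have F: "F \<subseteq> {1..}" "finite F" by auto
      then have "F \<subseteq> {1..Max (insert 0 F)}" by auto
      then have "sum ?f F \<le> sum ?f {1..Max (insert 0 F)}" by (intro sum_mono2) auto
      then show "sum ?f F \<le> 2 * \<sigma> 0 + 2 * var_unit" using fM by (rule order_trans)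
    qed
  qed simp
  let ?v = "infsum ?f {1..}"
  have lim: "(\<lambda>M. sum ?f {1..M}) \<longlonglongrightarrow> ?v"
  proof -
    have "filterlim (\<lambda>M. {1..M::nat}) (finite_subsets_at_top {1..}) sequentially"
    proof (rule filterlim_finite_subsets_at_top[THEN iffD2], intro allI impI)
      fix X :: "nat set" assume X: "finite X \<and> X \<subseteq> {1..}"
      have "\<forall>M\<ge>Max (insert 0 X). finite {1..M} \<and> X \<subseteq> {1..M} \<and> {1..M} \<subseteq> {1..}"
        using X by (auto intro: order_trans[OF Max_ge])
      then show "\<forall>\<^sub>F M in sequentially. finite {1..M} \<and> X \<subseteq> {1..M} \<and> {1..M} \<subseteq> {1..}"
        by (auto simp: eventually_sequentially)
    qed
    with has_sum_infsum[OF summ] show ?thesis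
      unfolding has_sum_def by (rule filterlim_compose)
  qed
  \<comment> \<open>The weight \<open>real m + 1\<close> in \<open>square_difference_bound\<close>
    balances the two errors: the first is of order \<open>m\<close> times
    \<open>(?e m)\<^sup>2\<close>, the second of order \<open>1 / m\<close>.\<close>
  have "\<bar>?v - \<sigma> m\<bar> \<le> (real m + 2) * ((?e m)\<^sup>2 * var_unit) + ?v / (real m + 1)" for m
  proof (rule LIMSEQ_le)
    show "(\<lambda>M. \<bar>sum ?f {1..M} - \<sigma> m\<bar>) \<longlonglongrightarrow> \<bar>?v - \<sigma> m\<bar>" by (intro tendsto_intros lim)
    show "(\<lambda>M. (real m + 2) * ((?e m)\<^sup>2 * var_unit) + sum ?f {1..M} / (real m + 1)) \<longlonglongrightarrow>
       (real m + 2) * ((?e m)\<^sup>2 * var_unit) + ?v / (real m + 1)" by (intro tendsto_intros lim) auto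
    have "\<bar>sum ?f {1..M} - \<sigma> m\<bar> \<le> (real m + 2) * ((?e m)\<^sup>2 * var_unit) + sum ?f {1..M} / (real m + 1)"
      if M: "degree (q m) \<le> M" for M
    proof -
      have eq: "sum ?f {1..M} - \<sigma> m = (\<Sum>k=1..M. real k * ((cmod (?c k))\<^sup>2 - \<bar>s m k\<bar>\<^sup>2))"
        using symbol_variance_eq[OF M, of \<alpha> \<beta>] by (simp add: s_def \<sigma>_def right_diff_distrib sum_subtractf)
      have "\<bar>sum ?f {1..M} - \<sigma> m\<bar> \<le> (\<Sum>k=1..M. real k * ((real m + 2) * (cmod (?c k - of_real (s m k)))\<^sup>2
        + (cmod (?c k))\<^sup>2 / (real m + 1)))"
        unfolding eq
      proof (rule order_trans[OF sum_abs], rule sum_mono)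
        fix k
        have "\<bar>cmod (?c k) - \<bar>s m k\<bar>\<bar> \<le> cmod (?c k - of_real (s m k))"
          using norm_triangle_ineq3[of "?c k" "of_real (s m k)"] by simp
        from square_difference_bound[OF this, of "real m + 1"]
        have "\<bar>(cmod (?c k))\<^sup>2 - \<bar>s m k\<bar>\<^sup>2\<bar> \<le> (real m + 2) * (cmod (?c k - of_real (s m k)))\<^sup>2 + (cmod
          (?c k))\<^sup>2 / (real m + 1)"
          by (simp add: add.assoc)
        then show "\<bar>real k * ((cmod (?c k))\<^sup>2 - \<bar>s m k\<bar>\<^sup>2)\<bar> \<le>
          real k * ((real m + 2) * (cmod (?c k - of_real (s m k)))\<^sup>2 + (cmod (?c k))\<^sup>2 / (real m + 1))"
          unfolding abs_mult by (simp add: mult_left_mono)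
      qed
      also have "\<dots> = (real m + 2) * (\<Sum>k=1..M. real k * (cmod (?c k - of_real (s m k)))\<^sup>2)
        + sum ?f {1..M} / (real m + 1)"
        by (simp add: distrib_left sum.distrib sum_distrib_left sum_divide_distrib mult_ac)
      also have "\<dots> \<le> (real m + 2) * ((?e m)\<^sup>2 * var_unit) + sum ?f {1..M} / (real m + 1)"
        by (intro add_right_mono mult_left_mono D) auto
      finally show ?thesis .
    qed
    then show "\<exists>N. \<forall>M\<ge>N. \<bar>sum ?f {1..M} - \<sigma> m\<bar> \<le> (real m + 2) * ((?e m)\<^sup>2 * var_unit) + sum ?f {1..M} /
      (real m + 1)"
      by blast
  qed
  then have b: "\<bar>\<sigma> m - ?v\<bar> \<le> (?e m + (?e m)\<^sup>2) * var_unit + ?v * ?e m" for m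
  proof -
    have "(x + 1) * (1 / x)\<^sup>2 = 1 / x + (1 / x)\<^sup>2" if "x \<noteq> 0" for x :: real
      using that by (simp add: power2_eq_square field_simps)
    from this[of "real m + 1"] have "(real m + 2) * (?e m)\<^sup>2 = ?e m + (?e m)\<^sup>2"
      by (simp add: add.assoc)
    then show ?thesis
      using \<open>\<bar>?v - \<sigma> m\<bar> \<le> _\<close> by (simp add: abs_minus_commute mult.assoc[symmetric])
  qed
  have "(\<lambda>m. (?e m + (?e m)\<^sup>2) * var_unit + ?v * ?e m) \<longlonglongrightarrow> (0 + 0\<^sup>2) * var_unit + ?v * 0"
    by (intro tendsto_intros e0)
  then have "(\<lambda>m. (?e m + (?e m)\<^sup>2) * var_unit + ?v * ?e m) \<longlonglongrightarrow> 0" by simp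
  then have "(\<lambda>m. \<sigma> m - ?v) \<longlonglongrightarrow> 0"
    by (rule Lim_null_comparison[rotated]) (use b in \<open>auto intro: always_eventually\<close>)
  then show ?thesis unfolding \<sigma>_def by (rule LIM_zero_cancel)
qed

lemma clt:
  fixes f h :: "real \<Rightarrow> real"
  assumes fh: "\<And>x. f x = h (\<mu> x)" and C1: "C1_on (\<mu> ` K) h" and growth: "poly_growth_on (range \<mu>) h"
  shows "weak_conv_m
           (\<lambda>n. distr (measure_pmf (P n)) borel (\<lambda>x. linear_stat n f x - expect n (linear_stat n f)))
           (centered_normal (\<Sum>\<^sub>\<infinity>k\<in>{1..}. real k * (cmod (fourier_coeff \<alpha> \<beta> h k))\<^sup>2))"
proof -
  let ?v = "\<Sum>\<^sub>\<infinity>k\<in>{1..}. real k * (cmod (fourier_coeff \<alpha> \<beta> h k))\<^sup>2"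
  have v0: "0 \<le> ?v" by (rule infsum_nonneg) simp
  obtain g g' where g: "\<And>t. (g has_real_derivative g' t) (at t)" "continuous_on UNIV g'"
    and gh: "\<And>t. t \<in> \<mu> ` K \<Longrightarrow> g t = h t"
    using C1_on_extend[OF mu_K_compact C1] by metis
  have "continuous_on (\<mu> ` K) g"
    using g(1) by (meson DERIV_isCont continuous_at_imp_continuous_on)
  then have h: "continuous_on (\<mu> ` K) h" by (rule continuous_on_eq) (rule gh)
  obtain Bh where Bh: "\<And>t. t \<in> \<mu> ` K \<Longrightarrow> \<bar>h t\<bar> \<le> Bh"
    using compact_imp_bounded[OF compact_continuous_image[OF h mu_K_compact]]
    unfolding bounded_iff by auto
  obtain C m0 where C: "\<And>t. t \<in> range \<mu> \<Longrightarrow> \<bar>h t\<bar> \<le> C * (1 + \<bar>t\<bar> ^ m0)"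
    using growth unfolding poly_growth_on_def by blast
  obtain R where R: "0 < R" "\<And>x. x \<in> K \<Longrightarrow> \<bar>\<mu> x\<bar> \<le> R" using mu_K_bound by blast
  then have KR: "t \<in> {-R..R}" if "t \<in> \<mu> ` K" for t using that by (fastforce simp: abs_le_iff)
  let ?e = "\<lambda>m. 1 / (real m + 1)"
  have "\<exists>q. (\<forall>t\<in>\<mu> ` K. \<bar>h t - poly q t\<bar> \<le> ?e m) \<and>
     (\<forall>s\<in>\<mu> ` K. \<forall>t\<in>\<mu> ` K. \<bar>(h s - poly q s) - (h t - poly q t)\<bar> \<le> ?e m * \<bar>s - t\<bar>)" for m
  proof -
    obtain q where "\<And>t. t \<in> {-R..R} \<Longrightarrow> \<bar>g t - poly q t\<bar> \<le> ?e m"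
      "\<And>x y. x \<in> {-R..R} \<Longrightarrow> y \<in> {-R..R} \<Longrightarrow> \<bar>(g x - poly q x) - (g y - poly q y)\<bar> \<le> ?e m * \<bar>x - y\<bar>"
      using C1_weierstrass[OF g, of "?e m" R] R(1) by auto
    then show ?thesis using gh KR by metis
  qed
  then obtain q where q: "\<And>m t. t \<in> \<mu> ` K \<Longrightarrow> \<bar>h t - poly (q m) t\<bar> \<le> ?e m"
    and q_lip: "\<And>m s t. s \<in> \<mu> ` K \<Longrightarrow> t \<in> \<mu> ` K \<Longrightarrow>
       \<bar>(h s - poly (q m) s) - (h t - poly (q m) t)\<bar> \<le> ?e m * \<bar>s - t\<bar>"
    by metis
  have \<sigma>: "(\<lambda>m. symbol_variance \<alpha> \<beta> (q m)) \<longlonglongrightarrow> ?v"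
    by (rule limit_variance[OF h q q_lip])
  define X where "X = (\<lambda>n x. linear_stat n f x - expect n (linear_stat n f))"
  define Y where "Y = (\<lambda>m n x. pstat n (q m) x - expect n (pstat n (q m)))"
  let ?ch = "\<lambda>Z n t. char (distr (measure_pmf (P n)) borel (Z n)) t"
  have e0: "?e \<longlonglongrightarrow> 0"
    using LIMSEQ_inverse_real_of_nat by (simp add: inverse_eq_divide add.commute)
  have "(\<lambda>n. ?ch X n t) \<longlonglongrightarrow> char (centered_normal ?v) t" for t
    unfolding char_centered_normal[OF v0]
  proof (rule LIMSEQ_I)
    fix r :: real assume r: "0 < r"
    let ?N = "\<lambda>v. complex_of_real (exp (- (t\<^sup>2 * v / 2)))"
    \<comment> \<open>Its square is \<open>\<delta>\<^sup>2 * var_unit + \<eta>\<close> for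
      \<open>\<delta> = ?e m\<close> and \<open>\<eta> = (?e m)\<^sup>2\<close>; adding 1 under the
      root also keeps it positive when \<open>var_unit\<close> is 0.\<close>
    let ?\<kappa> = "\<lambda>m. ?e m * sqrt (var_unit + 1)"
    have "(\<lambda>m. \<bar>t\<bar> * ?\<kappa> m) \<longlonglongrightarrow> \<bar>t\<bar> * (0 * sqrt (var_unit + 1))"
      by (intro tendsto_intros e0)
    then have "\<forall>\<^sub>F m in sequentially. \<bar>t\<bar> * ?\<kappa> m < r / 3"
      using r by (intro order_tendstoD(2)) auto
    moreover have "(\<lambda>m. ?N (symbol_variance \<alpha> \<beta> (q m))) \<longlonglongrightarrow> ?N ?v"
      by (intro tendsto_intros \<sigma>) auto
    then have "\<forall>\<^sub>F m in sequentially. norm (?N (symbol_variance \<alpha> \<beta> (q m)) - ?N ?v) < r / 3"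
      using r by (intro order_tendstoD(2)[OF tendsto_norm_zero[OF LIM_zero]]) auto
    ultimately obtain m where m: "\<bar>t\<bar> * ?\<kappa> m < r / 3"
      "norm (?N (symbol_variance \<alpha> \<beta> (q m)) - ?N ?v) < r / 3"
      using eventually_happens[OF eventually_conj] trivial_limit_sequentially by blast
    have "(\<lambda>n. ?ch (Y m) n t) \<longlonglongrightarrow> ?N (symbol_variance \<alpha> \<beta> (q m))"
      unfolding Y_def by (intro char_tendsto_of_moments poly_moment_integrable poly_moment_tendsto)
    then have "\<forall>\<^sub>F n in sequentially. norm (?ch (Y m) n t - ?N (symbol_variance \<alpha> \<beta> (q m))) < r / 3"
      using r by (intro order_tendstoD(2)[OF tendsto_norm_zero[OF LIM_zero]]) auto
    moreover have "\<forall>\<^sub>F n in sequentially. integrable (measure_pmf (P n)) (\<lambda>x. (X n x - Y m n x)\<^sup>2) \<and>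
        expect n (\<lambda>x. (X n x - Y m n x)\<^sup>2) \<le> (?e m)\<^sup>2 * var_unit + (?e m)\<^sup>2"
      using variance_bound_eventually[where f = f and h = h and q = "q m" and \<delta> = "?e m" and \<eta> = "(?e m)\<^sup>2",
          OF fh Bh C q_lip]
      unfolding X_def Y_def by (auto elim: eventually_mono)
    \<comment> \<open>Three comparisons with \<open>m\<close> fixed before \<open>n\<close>:
      statistic with polynomial statistic, its law with its Gaussian limit, and the two
      Gaussians.\<close>
    ultimately have "\<forall>\<^sub>F n in sequentially. norm (?ch X n t - ?N ?v) < r"
    proof eventually_elim
      case (elim n)
      have "(?\<kappa> m)\<^sup>2 = (?e m)\<^sup>2 * var_unit + (?e m)\<^sup>2"
        unfolding power_mult_distrib using var_unit_nonneg by (simp add: distrib_left)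
      then have d: "cmod (?ch X n t - ?ch (Y m) n t) \<le> \<bar>t\<bar> * ?\<kappa> m"
        using elim var_unit_nonneg by (intro char_difference_bound) auto
      have tri: "cmod (x - w) \<le> cmod (x - y) + cmod (y - z) + cmod (z - w)" for x y z w
        using norm_triangle_ineq[of "x - y" "y - w"] norm_triangle_ineq[of "y - z" "z - w"] by simp
      show ?case
        using tri[of "?ch X n t" "?N ?v" "?ch (Y m) n t" "?N (symbol_variance \<alpha> \<beta> (q m))"] d elim m
        by linarith
    qed
    then show "\<exists>no. \<forall>n\<ge>no. norm (?ch X n t - ?N ?v) < r"
      by (simp add: eventually_sequentially)
  qed
  then have "weak_conv_m (\<lambda>n. distr (measure_pmf (P n)) borel (X n)) (centered_normal ?v)"
    by (intro levy_continuity real_distribution_centered_normal v0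
        prob_space.real_distribution_distr prob_space_measure_pmf) auto
  then show ?thesis unfolding X_def .
qed

end

theorem theorem2p4:
  fixes \<nu> w :: "nat \<Rightarrow> int \<Rightarrow> real"
    and P :: "nat \<Rightarrow> (nat \<Rightarrow> real) pmf"
    and a b :: "nat \<Rightarrow> nat \<Rightarrow> real"
    and \<mu> f :: "real \<Rightarrow> real"
    and K :: "real set"
    and a1 b1 :: real
  assumes nu_mono: "\<And>n. n \<ge> 1 \<Longrightarrow> strict_mono (\<nu> n) \<or> strict_antimono_on UNIV (\<nu> n)"
    and w_nonneg: "\<And>n y. n \<ge> 1 \<Longrightarrow> w n y \<ge> 0"
    and w_moments: "\<And>n k. n \<ge> 1 \<Longrightarrow> (\<lambda>y. \<bar>\<nu> n y\<bar> ^ k * w n y) summable_on UNIV"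
    and w_support: "\<And>n. n \<ge> 1 \<Longrightarrow> support_at_least (w n) n"
    and law: "\<And>n. n \<ge> 1 \<Longrightarrow> is_ensemble_law (\<nu> n) (w n) n (P n)"
    and coeffs: "\<And>n. n \<ge> 1 \<Longrightarrow> recurrence_coeffs (\<nu> n) (w n) (a n) (b n)"
    and mu_inj: "inj \<mu>"
    and mu_K_compact: "compact (\<mu> ` K)"
    and mu_K_bounded: "bdd_above ((\<lambda>x. \<bar>\<mu> x\<bar>) ` K)"
    and mu_K_lipschitz: "lip_const UNIV K \<mu> < \<infinity>"
    and tail: "\<And>k::nat.
      (\<lambda>n. measure_pmf.expectation (P n)
             (linear_stat n (\<lambda>x. \<bar>rescale (\<nu> n) n x\<bar> ^ k * indicator (- K) x)))
        \<in> o(\<lambda>n. 1 / real n)"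
    \<comment> \<open>Off \<open>K\<close> nothing else relates \<open>\<mu>\<close> to \<open>rescale (\<nu> n) n\<close>, so the tail condition does not control
       functions of polynomial growth in \<open>\<mu>\<close>; without \<open>tail_mu\<close> the mean of the statistic of \<open>f\<close> may
       fail to exist. If \<open>\<mu>\<close> agrees with \<open>rescale (\<nu> n) n\<close> on the lattice, it follows from \<open>tail\<close>.\<close>
    and tail_mu: "\<And>k::nat.
      (\<lambda>n. \<integral>\<^sup>+ x. ennreal (linear_stat n (\<lambda>t. \<bar>\<mu> t\<bar> ^ k * indicator (- K) t) x)
             \<partial>measure_pmf (P n)) \<longlonglongrightarrow> 0"
    and mu_conv:
      "(\<lambda>n. SUP x\<in>lattice n \<inter> K. ennreal \<bar>rescale (\<nu> n) n x - \<mu> x\<bar>) \<longlonglongrightarrow> 0"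
    and mu_conv_lipschitz:
      "(\<lambda>n. lip_const (rescale (\<nu> n) n ` lattice n) (rescale (\<nu> n) n ` (lattice n \<inter> K))
              (\<lambda>t. (\<mu> \<circ> rescale_inv (\<nu> n) n) t - t)) \<longlonglongrightarrow> 0"
    and coeffs_exist: "\<And>m::nat. \<forall>\<^sub>F n in sequentially. support_at_least (w n) (n + m)"
    and a_lim: "\<And>j::int. (\<lambda>n. a n (nat (j + int n))) \<longlonglongrightarrow> a1"
    and b_lim: "\<And>j::int. (\<lambda>n. b n (nat (j + int n))) \<longlonglongrightarrow> b1"
    and f_C1: "C1_on (\<mu> ` K) (f \<circ> inv \<mu>)"
    and f_growth: "poly_growth_on (range \<mu>) (f \<circ> inv \<mu>)"
  shows "weak_conv_m
           (\<lambda>n. distr (measure_pmf (P n)) borel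
                  (\<lambda>x. linear_stat n f x - measure_pmf.expectation (P n) (linear_stat n f)))
           (centered_normal
              (\<Sum>\<^sub>\<infinity>k\<in>{1..}. real k * (cmod (fourier_coeff a1 b1 (f \<circ> inv \<mu>) k))\<^sup>2))"
proof -
  interpret ensemble_sequence \<nu> w P a b \<mu> K a1 b1
  proof
    show "inj (\<nu> n)" if "1 \<le> n" for n
      using nu_mono[OF that]
    proof
      assume "strict_mono (\<nu> n)"
      then show ?thesis by (rule strict_mono_imp_inj_on)
    next
      assume *: "strict_antimono_on UNIV (\<nu> n)"
      show ?thesis
      proof (rule injI)
        fix x y assume "\<nu> n x = \<nu> n y"
        then show "x = y"
          using * unfolding monotone_on_def by (metis UNIV_I less_irrefl linorder_neqE)
      qed
    qed
    show "(\<lambda>n. measure_pmf.expectation (P n)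
             (linear_stat n (\<lambda>x. \<bar>rescale (\<nu> n) n x\<bar> ^ k * indicator (- K) x))) \<longlonglongrightarrow> 0" for k
    proof (rule Lim_null_comparison)
      show "\<forall>\<^sub>F n in sequentially. norm (measure_pmf.expectation (P n)
             (linear_stat n (\<lambda>x. \<bar>rescale (\<nu> n) n x\<bar> ^ k * indicator (- K) x))) \<le> 1 / real n"
        using landau_o.smallD[OF tail[of k], of 1] by (simp add: eventually_mono)
      show "(\<lambda>n. 1 / real n) \<longlonglongrightarrow> 0" by (rule lim_1_over_n)
    qed
  qed (rule w_nonneg law coeffs mu_K_compact tail_mu mu_conv mu_conv_lipschitz coeffs_exist a_lim b_lim;
    assumption?)+
  show ?thesis
    \<comment> \<open>The function \<open>h\<close> of \<open>clt\<close> is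
      \<open>f \<circ> inv \<mu>\<close>; injectivity of \<mu> gives back \<open>f\<close> when it
      is evaluated at \<open>\<mu> x\<close>.\<close>
    using f_C1 f_growth by (intro clt) (simp_all add: inv_f_f[OF mu_inj])
qed

end
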